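(* Let $D_n$ be $n$ i.i.d. samples from the non-parametric regression model $y=m(x)+\varepsilon$, where $x\sim\mathcal D_x$ on $\{0,1\}^d$, $m(x)\in[-1/2,1/2]$, $\varepsilon\sim\mathcal E$, $\mathbb E[\varepsilon]=0$, $\varepsilon\in[-1/2,1/2]$. Suppose that $m$ is $(\beta,r)$-strongly sparse with set of relevant features $R$, and that for every $w\in\{0,1\}^r$ we have $\mathbb P_{z\sim\mathcal D_x}(z_R=w)\notin(0,\zeta/2^r)$. Suppose further that $\sigma^2(x)=\mathrm{Var}(y^{(i)}\mid x^{(i)}=x)\ge\sigma^2>0$ for all $x$. Let $x\in\{0,1\}^d$ be an a priori fixed point with $\mathbb P_{z\sim\mathcal D_x}(z_R=x_R)\ge\zeta/2^r$. Let $m_{n,s,B}$ be the Monte Carlo forest estimator (see context) with $B\ge n^2\log(n)$, sub-sample size $s$, and trees built by the Level Split Algorithm with honesty flag $h=1$ and $\log(t)$ large enough so that every leaf has two or three samples. If $$\tilde\Theta\left(\frac{2^r(\log(d)+\log(n))}{\beta^2}+\frac{2^r\log(n)}{\zeta}\right)\le s\le o(\sqrt n),$$ then, for some $\sigma_n^2(x)=O\left(\frac{s^2}{n}\right)$, as $n\to\infty$, $$\sigma_n^{-1}(x)\,(m_{n,s,B}(x)-m(x))\to_d N(0,1).$$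
   Context: **Model.** $D_n=\{(x^{(i)},y^{(i)})\}_{i=1}^n$ is i.i.d. from $\mathcal D$: $x^{(i)}$ is drawn from a distribution $\mathcal D_x$ with support $\{0,1\}^d$, $\varepsilon^{(i)}\in[-1/2,1/2]$ is drawn from a zero-mean distribution $\mathcal E$, and $y^{(i)}=m(x^{(i)})+\varepsilon^{(i)}$ with $m:\{0,1\}^d\to[-1/2,1/2]$. For $S\subseteq[d]$, $x_S$ is the sub-vector of $x$ with coordinates in $S$. **Sparsity.** $m$ is $r$-sparse if there is $R\subseteq[d]$, $|R|=r$ (the relevant features), and $h_0:\{0,1\}^r\to\mathbb R$ with $m(z)=h_0(z_R)$ for all $z$. Let $\bar V(S)=\mathbb E_{z\sim\mathcal D_x}\left[\left(\mathbb E_{w\sim\mathcal D_x}[m(w)\mid w_S=z_S]\right)^2\right]$. **$(\beta,r)$-strong sparsity:** $m$ is $r$-sparse with relevant features $R$, and $\bar V(T\cup\{j\})-\bar V(T)+\beta\le\bar V(T\cup\{i\})-\bar V(T)$ for all $i\in R$, $j\in[d]\setminus R$, $T\subset[d]\setminus\{i\}$. **Level Split Algorithm with honesty** (inputs: $\log t$, a data set $D_s$, flag $h=1$). Split $D_s$ randomly into two halves: a structure sample and an estimation sample. Let $V(S)$ be the average, over structure points $j$, of $a_j(S)^2$, where $a_j(S)$ is the average of $y^{(k)}$ over structure points $k$ with $x^{(k)}_S=x^{(j)}_S$. Start with $S=\emptyset$, $\mathcal P_0=\{\{0,1\}^d\}$, $\mathrm{level}=-1$. While $\mathrm{level}<\log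 t$: increase $\mathrm{level}$ by one; select $i\in[d]$ maximizing $V(S\cup\{i\})$ (ties broken randomly); for every $A\in\mathcal P_{\mathrm{level}}$ let $A^i_k=\{x\in A:x_i=k\}$, $k=0,1$; if each of $A_0^i,A_1^i$ contains at least one covariate vector of the estimation sample, put both into $\mathcal P_{\mathrm{level}+1}$, otherwise put $A$ into it; set $S\leftarrow S\cup\{i\}$. The resulting tree prediction is the average of $y^{(j)}$ over the estimation points lying in the cell of the final partition that contains $x$. **Monte Carlo forest.** $m_{n,s,B}(x)$ is the empirical average of $B$ tree predictions at $x$; for each tree one independently draws a uniformly random permutation of the training set (so that samples are treated symmetrically) and a uniformly random sub-sample of size $s$, and runs the algorithm on it. **Conventions.** $\log$ is base 2. $\tilde\Theta(a)$ denotes a quantity of the form $K\cdot a\cdot L$ with $K$ a universal constant and $L$ a suitable factor polylogarithmic in $n,2^r,1/\beta,1/\zeta$. Here $s=s(n)$ and $B=B(n)$ may depend on $n$, and $s\le o(\sqrt n)$ means $s/\sqrt n\to0$. $\to_d$ is convergence in distribution.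
   Formalization: With d fixed and s→∞, not every leaf can have only two or three samples; it is assumed instead that, except with probability o(n^{-1/2}), every leaf has two or three estimation samples or only samples with the same covariate vector (a weaker hypothesis). *)

theory Defs
  imports "HOL-Probability.Probability" "HOL-Library.Landau_Symbols"
begin

text \<open>
  Points of \<open>{0,1}\<^sup>d\<close> are Boolean lists of length \<open>d\<close>, features are the indices \<open>i < d\<close>, and the
  sub-vector \<open>x\<^sub>S\<close> is \<^term>\<open>nths x S\<close>. A training set of size \<open>n\<close> is a function on the
  indices \<open>k < n\<close>, whose value at \<open>k\<close> is the pair of the covariate vector and the response.
\<close>

definition cube :: "nat \<Rightarrow> bool list set" where
  "cube d = {x. length x = d}"

type_synonym sample = "bool list \<times> real"


subsection \<open>The regression model\<close>

definition regression_model ::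
  "nat \<Rightarrow> bool list pmf \<Rightarrow> real measure \<Rightarrow> (bool list \<Rightarrow> real) \<Rightarrow> bool" where
  "regression_model d Dx \<E> m \<longleftrightarrow>
     0 < d \<and> set_pmf Dx \<subseteq> cube d \<and>
     prob_space \<E> \<and> sets \<E> = sets borel \<and>
     (AE e in \<E>. e \<in> {-1/2..1/2}) \<and> (\<integral>e. e \<partial>\<E>) = 0 \<and>
     (\<forall>z\<in>cube d. m z \<in> {-1/2..1/2})"

definition sample_law :: "bool list pmf \<Rightarrow> real measure \<Rightarrow> (bool list \<Rightarrow> real) \<Rightarrow> sample measure" where
  "sample_law Dx \<E> m =
     distr (measure_pmf Dx \<Otimes>\<^sub>M \<E>) (count_space UNIV \<Otimes>\<^sub>M borel) (\<lambda>(z, e). (z, m z + e))"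

definition data_law ::
  "bool list pmf \<Rightarrow> real measure \<Rightarrow> (bool list \<Rightarrow> real) \<Rightarrow> nat \<Rightarrow> (nat \<Rightarrow> sample) measure" where
  "data_law Dx \<E> m n = (\<Pi>\<^sub>M k\<in>{..<n}. sample_law Dx \<E> m)"

text \<open>
  The noise is independent of the covariates, so the law of the response given that the covariate
  vector is \<open>z\<close> is that of \<open>m z + e\<close> with \<open>e\<close> drawn from \<open>\<E>\<close>, also where \<open>z\<close> has probability 0.
\<close>

definition response_law :: "real measure \<Rightarrow> (bool list \<Rightarrow> real) \<Rightarrow> bool list \<Rightarrow> real measure" where
  "response_law \<E> m z = distr \<E> borel (\<lambda>e. m z + e)"

definition response_variance :: "real measure \<Rightarrow> (bool list \<Rightarrow> real) \<Rightarrow> bool list \<Rightarrow> real" where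
  "response_variance \<E> m z =
     (\<integral>y. (y - (\<integral>y'. y' \<partial>response_law \<E> m z))\<^sup>2 \<partial>response_law \<E> m z)"


subsection \<open>Sparsity\<close>

definition sparse_wrt :: "nat \<Rightarrow> (bool list \<Rightarrow> real) \<Rightarrow> nat \<Rightarrow> nat set \<Rightarrow> bool" where
  "sparse_wrt d m r R \<longleftrightarrow>
     R \<subseteq> {..<d} \<and> card R = r \<and> (\<exists>h0 :: bool list \<Rightarrow> real. \<forall>z\<in>cube d. m z = h0 (nths z R))"

definition V_bar :: "bool list pmf \<Rightarrow> (bool list \<Rightarrow> real) \<Rightarrow> nat set \<Rightarrow> real" where
  "V_bar Dx m S =
     measure_pmf.expectation Dx
       (\<lambda>z. (measure_pmf.expectation (cond_pmf Dx {w. nths w S = nths z S}) m)\<^sup>2)"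

definition strongly_sparse ::
  "nat \<Rightarrow> bool list pmf \<Rightarrow> (bool list \<Rightarrow> real) \<Rightarrow> real \<Rightarrow> nat \<Rightarrow> nat set \<Rightarrow> bool" where
  "strongly_sparse d Dx m \<beta> r R \<longleftrightarrow>
     sparse_wrt d m r R \<and>
     (\<forall>i\<in>R. \<forall>j\<in>{..<d} - R. \<forall>T. T \<subset> {..<d} - {i} \<longrightarrow>
        V_bar Dx m (T \<union> {j}) - V_bar Dx m T + \<beta> \<le> V_bar Dx m (T \<union> {i}) - V_bar Dx m T)"


subsection \<open>The Level Split Algorithm with honesty\<close>

text \<open>
  Below, \<open>D\<close> holds the samples, \<open>J\<close> is the index set of the structure sample and \<open>H\<close> that of the
  estimation sample.
\<close>

definition mean_response :: "(nat \<Rightarrow> sample) \<Rightarrow> nat set \<Rightarrow> real" where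
  "mean_response D K = (\<Sum>k\<in>K. snd (D k)) / real (card K)"

definition V_emp :: "(nat \<Rightarrow> sample) \<Rightarrow> nat set \<Rightarrow> nat set \<Rightarrow> real" where
  "V_emp D J S =
     (\<Sum>j\<in>J. (mean_response D {k\<in>J. nths (fst (D k)) S = nths (fst (D j)) S})\<^sup>2) / real (card J)"

definition best_features :: "nat \<Rightarrow> (nat \<Rightarrow> sample) \<Rightarrow> nat set \<Rightarrow> nat set \<Rightarrow> nat set" where
  "best_features d D J S =
     {i\<in>{..<d}. \<forall>j\<in>{..<d}. V_emp D J (S \<union> {j}) \<le> V_emp D J (S \<union> {i})}"

definition points_in :: "(nat \<Rightarrow> sample) \<Rightarrow> nat set \<Rightarrow> bool list set \<Rightarrow> nat set" where
  "points_in D H A = {k\<in>H. fst (D k) \<in> A}"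

definition split_cell ::
  "(nat \<Rightarrow> sample) \<Rightarrow> nat set \<Rightarrow> nat \<Rightarrow> bool list set \<Rightarrow> bool list set set" where
  "split_cell D H i A =
     (let A0 = {z\<in>A. \<not> z ! i}; A1 = {z\<in>A. z ! i}
      in if points_in D H A0 \<noteq> {} \<and> points_in D H A1 \<noteq> {} then {A0, A1} else {A})"

fun grow ::
  "nat \<Rightarrow> (nat \<Rightarrow> sample) \<Rightarrow> nat set \<Rightarrow> nat set \<Rightarrow> nat \<Rightarrow> (nat set \<times> bool list set set) pmf" where
  "grow d D J H 0 = return_pmf ({}, {cube d})"
| "grow d D J H (Suc l) = do {
     (S, P) \<leftarrow> grow d D J H l;
     i \<leftarrow> pmf_of_set (best_features d D J S);
     return_pmf (S \<union> {i}, \<Union>A\<in>P. split_cell D H i A)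
   }"

text \<open>
  The loop starts with level \<open>-1\<close> and increments the level as long as it is less than \<open>logt\<close>, so its
  body is executed \<open>\<lceil>logt\<rceil> + 1\<close> times. The set \<open>I\<close> contains the indices of the input data set; the
  result is the index set of the estimation sample together with the final partition.
\<close>

definition level_split ::
  "nat \<Rightarrow> real \<Rightarrow> (nat \<Rightarrow> sample) \<Rightarrow> nat set \<Rightarrow> (nat set \<times> bool list set set) pmf" where
  "level_split d logt D I = do {
     J \<leftarrow> pmf_of_set {J. J \<subseteq> I \<and> card J = card I div 2};
     (S, P) \<leftarrow> grow d D J (I - J) (nat (\<lceil>logt\<rceil> + 1));
     return_pmf (I - J, P)
   }"

fun tree_predict :: "(nat \<Rightarrow> sample) \<Rightarrow> nat set \<times> bool list set set \<Rightarrow> bool list \<Rightarrow> real" where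
  "tree_predict D (H, P) x = mean_response D (points_in D H (THE A. A \<in> P \<and> x \<in> A))"

text \<open>
  Every leaf has two or three samples of the estimation sample, as far as the algorithm permits: the
  exception are leaves whose samples all carry the same covariate vector (in particular those with
  a single sample), which no further level can split. Without it the condition would be
  unsatisfiable: the samples of the leaves add up to the estimation sample, whose size tends to
  infinity, while there are at most \<open>2\<^sup>d\<close> leaves.
\<close>

fun fully_grown :: "(nat \<Rightarrow> sample) \<Rightarrow> nat set \<times> bool list set set \<Rightarrow> bool" where
  "fully_grown D (H, P) \<longleftrightarrow>
     (\<forall>A\<in>P. card (points_in D H A) \<in> {2, 3} \<or>
        (\<forall>k\<in>points_in D H A. \<forall>l\<in>points_in D H A. fst (D k) = fst (D l)))"


subsection \<open>The Monte Carlo forest\<close>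

text \<open>
  The algorithm runs on the permuted training set \<open>D \<circ> \<pi>\<close>; the image under \<open>\<pi>\<close> turns the indices of
  its estimation sample into indices of the original training set \<open>D\<close>.
\<close>

definition random_tree ::
  "nat \<Rightarrow> real \<Rightarrow> nat \<Rightarrow> nat \<Rightarrow> (nat \<Rightarrow> sample) \<Rightarrow> (nat set \<times> bool list set set) pmf" where
  "random_tree d logt n s D = do {
     \<pi> \<leftarrow> pmf_of_set {\<pi>. \<pi> permutes {..<n}};
     I \<leftarrow> pmf_of_set {I. I \<subseteq> {..<n} \<and> card I = s};
     (H, P) \<leftarrow> level_split d logt (D \<circ> \<pi>) I;
     return_pmf (\<pi> ` H, P)
   }"

definition mc_forest ::
  "nat \<Rightarrow> real \<Rightarrow> nat \<Rightarrow> nat \<Rightarrow> nat \<Rightarrow> bool list \<Rightarrow> (nat \<Rightarrow> sample) \<Rightarrow> real pmf" where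
  "mc_forest d logt n s B x D =
     map_pmf (\<lambda>hs. (\<Sum>h\<leftarrow>hs. tree_predict D h x) / real B) (replicate_pmf B (random_tree d logt n s D))"

text \<open>The law of \<open>m\<^sub>n\<^sub>,\<^sub>s\<^sub>,\<^sub>B(x)\<close> over both the training data and the internal randomness of the forest.\<close>

definition mc_forest_law ::
  "nat \<Rightarrow> bool list pmf \<Rightarrow> real measure \<Rightarrow> (bool list \<Rightarrow> real) \<Rightarrow> real \<Rightarrow> nat \<Rightarrow> nat \<Rightarrow> nat
    \<Rightarrow> bool list \<Rightarrow> real measure" where
  "mc_forest_law d Dx \<E> m logt n s B x =
     Giry_Monad.bind (data_law Dx \<E> m n)
       (\<lambda>D. distr (measure_pmf (mc_forest d logt n s B x D)) borel (\<lambda>v. v))"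

text \<open>
  As ties may make the algorithm select the same feature repeatedly, no value of \<open>logt\<close> excludes
  with certainty that a tree is not fully grown, but the probability tends to 0 as \<open>logt\<close> grows.
\<close>

definition not_fully_grown_prob ::
  "nat \<Rightarrow> bool list pmf \<Rightarrow> real measure \<Rightarrow> (bool list \<Rightarrow> real) \<Rightarrow> real \<Rightarrow> nat \<Rightarrow> nat \<Rightarrow> real" where
  "not_fully_grown_prob d Dx \<E> m logt n s =
     (\<integral>D. measure_pmf.prob (random_tree d logt n s D) {h. \<not> fully_grown D h} \<partial>data_law Dx \<E> m n)"


subsection \<open>The sub-sample size\<close>

text \<open>
  All factors are at least 1, so up to constants every polylogarithmic function of \<open>n\<close>, \<open>2\<^sup>r\<close>,
  \<open>1/\<beta>\<close> and \<open>1/\<zeta>\<close> is dominated by this one for a suitable exponent \<open>p\<close>.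
\<close>

definition polylog :: "nat \<Rightarrow> nat \<Rightarrow> nat \<Rightarrow> real \<Rightarrow> real \<Rightarrow> real" where
  "polylog p n r \<beta> \<zeta> =
     (log 2 (2 + real n) * log 2 (2 + 2 ^ r) * log 2 (2 + 1 / \<beta>) * log 2 (2 + 1 / \<zeta>)) ^ p"

definition subsample_bound ::
  "real \<Rightarrow> nat \<Rightarrow> nat \<Rightarrow> nat \<Rightarrow> real \<Rightarrow> real \<Rightarrow> nat \<Rightarrow> real" where
  "subsample_bound K p d r \<beta> \<zeta> n =
     K * (2 ^ r * (log 2 (real d) + log 2 (real n)) / \<beta>\<^sup>2 + 2 ^ r * log 2 (real n) / \<zeta>)
       * polylog p n r \<beta> \<zeta>"

end

theory Submission
  imports Defs "HOL-Real_Asymp.Real_Asymp"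
begin

text \<open>
  A tree prediction is a weighted average \<open>\<Sum>\<^sub>k w\<^sub>k y\<^sub>k\<close> of the responses, so the conditional mean of
  the forest given the data is \<open>\<Sum>\<^sub>k a\<^sub>k y\<^sub>k\<close> for deterministic functions \<open>a\<^sub>k\<close> of the data.

  Bias: by strong sparsity and Hoeffding's inequality the structure sample selects relevant features
  as long as there are any, and the estimation sample contains many copies of a covariate vector in
  the class of \<open>x\<close>. Hence the leaf of \<open>x\<close> in a fully grown tree only contains samples with mean
  response \<open>m x\<close>, up to an event of probability \<open>o(1/\<surd>n)\<close>.

  Noise: by honesty the partition depends on the estimation sample only through its covariates.
  So \<open>a\<^sub>k\<close> is almost the same for all \<open>k\<close> with \<open>x\<^sub>k = z\<close>: exchanging two of them can matter only if
  one of them is in the structure sample. The sum \<open>A\<^sub>z\<close> of these \<open>a\<^sub>k\<close> is an average over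
  sub-samples of functions of the data in the sub-sample, and most pairs of sub-samples are
  disjoint since \<open>s\<^sup>2/n \<longrightarrow> 0\<close>. Hence \<open>A\<^sub>z\<close> concentrates around its mean \<open>p\<^sub>z\<close>, and the forest is
  \<open>m x + (1/n) \<Sum>\<^sub>k (p\<^sub>z/\<pi>\<^sub>z)(x\<^sub>k) \<epsilon>\<^sub>k + o(1/\<surd>n)\<close> in \<open>L\<^sup>1\<close>, with \<open>\<pi>\<^sub>z\<close> the probability of \<open>z\<close>. The sum has
  bounded i.i.d. summands, and their variance is at least \<open>\<sigma>\<^sup>2\<close> because \<open>\<Sum>\<^sub>z p\<^sub>z = 1\<close>.
\<close>


section \<open>Level splits, cells and leaves\<close>

text \<open>All of \<open>d\<close>, \<open>Dx\<close>, \<open>\<E>\<close>, \<open>m\<close> and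
  \<open>R\<close> stay fixed while \<open>n\<close> grows, so constants may depend on them in any
  way, for instance through negative powers of the class probabilities; only rates in
  \<open>n\<close> and \<open>s\<close> count. Every error has to be \<open>o(1 / sqrt n)\<close>,
  because the standard deviation of the linear term is of exactly this order. Failure probabilities
  \<open>exp (- c * s)\<close> meet this for every \<open>c > 0\<close> since the lower bound on
  \<open>s\<close> contains a squared logarithm. A variance of order \<open>1 / n\<close> is also
  \<open>O(s\<^sup>2 / n)\<close>, as \<open>s\<close> is at least 1. The random permutation inside
  each tree is handled by exchangeability: estimates are proved for trees on the data in the given
  order and then averaged over all permutations, and the linear term, being symmetric, passes
  through the average. The summands of the linear term change their law with \<open>n\<close>, so
  the limit is computed with characteristic functions of rows. Errors in mean carry over to
  characteristic functions because sine and cosine are Lipschitz.\<close>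

lemma nths_eq_map_nth: "nths xs S = map ((!) xs) (filter (\<lambda>i. i \<in> S) [0..<length xs])"
proof -
  have "zip xs [0..<length xs] = map (\<lambda>i. (xs ! i, i)) [0..<length xs]"
    by (intro nth_equalityI) auto
  then show ?thesis
    by (simp add: nths_def filter_map o_def)
qed

lemma nths_eq_iff:
  assumes "length xs = length ys"
  shows "nths xs S = nths ys S \<longleftrightarrow> (\<forall>i\<in>S. i < length ys \<longrightarrow> xs ! i = ys ! i)"
  using assms by (auto simp: nths_eq_map_nth map_eq_conv)

section \<open>What the grown tree depends on\<close>

lemma V_emp_cong:
  assumes "\<And>k. k \<in> J \<Longrightarrow> D k = D' k"
  shows "V_emp D J S = V_emp D' J S"
proof -
  have "mean_response D {k\<in>J. nths (fst (D k)) S = nths (fst (D j)) S} =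
        mean_response D' {k\<in>J. nths (fst (D' k)) S = nths (fst (D' j)) S}" if "j \<in> J" for j
  proof -
    have "{k\<in>J. nths (fst (D k)) S = nths (fst (D j)) S} =
          {k\<in>J. nths (fst (D' k)) S = nths (fst (D' j)) S}"
      using assms that by auto
    then show ?thesis unfolding mean_response_def by (auto intro!: sum.cong simp: assms)
  qed
  then show ?thesis unfolding V_emp_def by simp
qed

lemma points_in_eq_empty_iff: "points_in D H A = {} \<longleftrightarrow> (\<lambda>k. fst (D k)) ` H \<inter> A = {}"
  by (auto simp: points_in_def)

text \<open>The source of honesty: a split only asks whether both halves are inhabited, so it sees
  the estimation sample through the set of its covariate vectors, and neither through responses nor
  through indices or multiplicities.\<close>

lemma split_cell_cong:
  assumes "(\<lambda>k. fst (D k)) ` H = (\<lambda>k. fst (D' k)) ` H'"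
  shows "split_cell D H i A = split_cell D' H' i A"
  unfolding split_cell_def points_in_eq_empty_iff assms ..

text \<open>Data and estimation sample may both change. Other data with the same values on the
  sub-sample give locality; a relabelled estimation sample gives the exchange argument.\<close>

lemma grow_cong:
  assumes "\<And>k. k \<in> J \<Longrightarrow> D k = D' k" and "(\<lambda>k. fst (D k)) ` H = (\<lambda>k. fst (D' k)) ` H'"
  shows "grow d D J H l = grow d D' J H' l"
proof -
  have "V_emp D J = V_emp D' J"
    using V_emp_cong[OF assms(1)] by (intro ext) auto
  then have "best_features d D J = best_features d D' J"
    by (simp add: best_features_def fun_eq_iff)
  then show ?thesis
    by (induction l) (simp_all add: split_cell_cong[OF assms(2)])
qed

text \<open>\<open>pmf_of_set\<close> is meaningful only on finite non-empty sets; with at least one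
  feature the maximum is attained.\<close>

lemma best_features_finite_nonempty:
  assumes "0 < d"
  shows "best_features d D J S \<noteq> {}" "finite (best_features d D J S)"
proof -
  have "Max ((\<lambda>i. V_emp D J (S \<union> {i})) ` {..<d}) \<in> (\<lambda>i. V_emp D J (S \<union> {i})) ` {..<d}"
    using assms by (intro Max_in) auto
  then obtain i where i: "i < d" "V_emp D J (S \<union> {i}) = Max ((\<lambda>i. V_emp D J (S \<union> {i})) ` {..<d})"
    by auto
  have "V_emp D J (S \<union> {j}) \<le> V_emp D J (S \<union> {i})" if "j < d" for j
    unfolding i(2) using that by (intro Max_ge) auto
  with i(1) show "best_features d D J S \<noteq> {}"
    by (auto simp: best_features_def)
  show "finite (best_features d D J S)"
    by (simp add: best_features_def)
qed

lemma set_pmf_grow_Suc: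
  assumes "0 < d"
  shows "set_pmf (grow d D J H (Suc l)) =
    (\<Union>(S, P)\<in>set_pmf (grow d D J H l). (\<lambda>i. (S \<union> {i}, \<Union>A\<in>P. split_cell D H i A)) ` best_features d D J S)"
  using best_features_finite_nonempty[OF assms] by (auto simp: split_beta)

declare grow.simps(2) [simp del]

section \<open>Partitions of the cube and the cell of a point\<close>

definition cells_partition :: "nat \<Rightarrow> bool list set set \<Rightarrow> bool" where
  "cells_partition d P \<longleftrightarrow> P \<subseteq> Pow (cube d) \<and> (\<forall>z\<in>cube d. \<exists>!A. A \<in> P \<and> z \<in> A)"

text \<open>The same choice by \<open>THE\<close> as in \<open>tree_predict\<close>. It is well
  defined because \<open>cells_partition\<close> is phrased by unique existence.\<close>

definition cell :: "bool list set set \<Rightarrow> bool list \<Rightarrow> bool list set" where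
  "cell P x = (THE A. A \<in> P \<and> x \<in> A)"

lemma cell_in:
  assumes "cells_partition d P" "x \<in> cube d"
  shows "cell P x \<in> P" "x \<in> cell P x"
  using theI'[of "\<lambda>A. A \<in> P \<and> x \<in> A"] assms unfolding cell_def cells_partition_def by auto

lemma cell_unique:
  assumes "cells_partition d P" "x \<in> cube d" "A \<in> P" "x \<in> A"
  shows "cell P x = A"
  using assms unfolding cell_def cells_partition_def by (intro the1_equality) auto

lemma split_cell_subset: "B \<in> split_cell D H i A \<Longrightarrow> B \<subseteq> A"
  by (auto simp: split_cell_def Let_def split: if_splits)

text \<open>The second part follows the cell of one point through a level, so that inductions over
  levels can ignore all other cells.\<close>

lemma cells_partition_split:
  assumes P: "cells_partition d P"
  shows "cells_partition d (\<Union>A\<in>P. split_cell D H i A)"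
    and "x \<in> cube d \<Longrightarrow> cell (\<Union>A\<in>P. split_cell D H i A) x =
      (if points_in D H {z\<in>cell P x. z ! i} \<noteq> {} \<and> points_in D H {z\<in>cell P x. \<not> z ! i} \<noteq> {}
       then {z\<in>cell P x. z ! i = x ! i} else cell P x)"
proof -
  let ?P = "\<Union>A\<in>P. split_cell D H i A"
  define C where "C x = (if points_in D H {z\<in>cell P x. z ! i} \<noteq> {} \<and> points_in D H {z\<in>cell P x. \<not> z ! i} \<noteq> {}
       then {z\<in>cell P x. z ! i = x ! i} else cell P x)" for x
  have C: "C x \<in> ?P" "x \<in> C x" "\<And>B. B \<in> ?P \<Longrightarrow> x \<in> B \<Longrightarrow> B = C x" if x: "x \<in> cube d" for x
  proof -
    note cx = cell_in[OF P x]
    have "C x \<in> split_cell D H i (cell P x)"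
      unfolding C_def split_cell_def Let_def by (cases "x ! i") (auto intro: arg_cong)
    then show "C x \<in> ?P" using cx by blast
    show "x \<in> C x" using cx by (auto simp: C_def)
    fix B assume B: "B \<in> ?P" "x \<in> B"
    then obtain A where A: "A \<in> P" "B \<in> split_cell D H i A" by blast
    then have "x \<in> A" using B split_cell_subset by blast
    then have "A = cell P x" using cell_unique[OF P x A(1)] by simp
    with A(2) have "B \<in> split_cell D H i (cell P x)" by simp
    then show "B = C x" using B(2)
      unfolding C_def split_cell_def Let_def by (simp split: if_splits) blast+
  qed
  have sub: "?P \<subseteq> Pow (cube d)"
  proof
    fix B assume "B \<in> ?P"
    then obtain A where "A \<in> P" "B \<in> split_cell D H i A" by blast
    then show "B \<in> Pow (cube d)" using P split_cell_subset unfolding cells_partition_def by blast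
  qed
  have unique: "\<exists>!A. A \<in> ?P \<and> z \<in> A" if "z \<in> cube d" for z
  proof (rule ex1I)
    show "C z \<in> ?P \<and> z \<in> C z" using C(1,2)[OF that] by (rule conjI)
  next
    fix A assume "A \<in> ?P \<and> z \<in> A"
    then show "A = C z" by (elim conjE C(3)[OF that])
  qed
  show Q: "cells_partition d ?P"
    unfolding cells_partition_def by (rule conjI[OF sub ballI[OF unique]])
  show "cell ?P x = (if points_in D H {z\<in>cell P x. z ! i} \<noteq> {} \<and> points_in D H {z\<in>cell P x. \<not> z ! i} \<noteq> {}
       then {z\<in>cell P x. z ! i = x ! i} else cell P x)" if "x \<in> cube d"
    using cell_unique[OF Q that C(1)[OF that] C(2)[OF that]] unfolding C_def .
qed

lemma grow_partition:
  assumes "0 < d" "(S, P) \<in> set_pmf (grow d D J H l)"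
  shows "S \<subseteq> {..<d} \<and> cells_partition d P"
  using assms(2)
proof (induction l arbitrary: S P)
  case 0
  then show ?case by (auto simp: cells_partition_def)
next
  case (Suc l)
  then obtain S' P' i where SP: "(S', P') \<in> set_pmf (grow d D J H l)" "i \<in> best_features d D J S'"
    "S = S' \<union> {i}" "P = (\<Union>A\<in>P'. split_cell D H i A)"
    by (auto simp: set_pmf_grow_Suc[OF assms(1)])
  with Suc.IH[OF SP(1)] show ?case
    using cells_partition_split(1)[of d P' D H i] by (auto simp: best_features_def)
qed

section \<open>Leaves and their purity\<close>

definition leaf :: "(nat \<Rightarrow> sample) \<Rightarrow> nat set \<Rightarrow> bool list set set \<Rightarrow> bool list \<Rightarrow> nat set" where
  "leaf D H P x = points_in D H (cell P x)"

lemma leaf_subset: "leaf D H P x \<subseteq> H"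
  by (auto simp: leaf_def points_in_def)

text \<open>A cell is divided only when both halves are inhabited, so by induction every cell holds
  an estimation point, the root holding \<open>h\<close>. This makes the weights of a tree add up to
  exactly 1; over an empty leaf they would add up to 0.\<close>

lemma leaf_nonempty:
  assumes "0 < d" "(S, P) \<in> set_pmf (grow d D J H l)" "x \<in> cube d"
    and "h \<in> H" "fst (D h) \<in> cube d"
  shows "leaf D H P x \<noteq> {}"
proof -
  have "\<forall>A\<in>P. points_in D H A \<noteq> {}"
    using assms(2)
  proof (induction l arbitrary: S P)
    case 0
    then show ?case using assms(4,5) by (auto simp: points_in_def)
  next
    case (Suc l)
    then obtain S' P' i where "(S', P') \<in> set_pmf (grow d D J H l)"
      "P = (\<Union>A\<in>P'. split_cell D H i A)"
      by (auto simp: set_pmf_grow_Suc[OF assms(1)])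
    with Suc.IH show ?case
      by (fastforce simp: split_cell_def Let_def split: if_splits)
  qed
  then show ?thesis
    using cell_in(1)[of d P x] grow_partition[OF assms(1,2)] assms(3) by (auto simp: leaf_def)
qed

text \<open>
  As long as a relevant feature is left, only relevant features are selected, so the cell of \<open>x\<close>
  keeps the whole class of \<open>x\<close>; a cell that has not been separated by all relevant features thus
  contains the many copies of \<open>z0\<close>, and being fully grown it contains nothing else.
\<close>
lemma fully_grown_leaf_relevant:
  assumes d: "0 < d" and x: "x \<in> cube d" and R: "R \<subseteq> {..<d}"
    and best: "\<And>S. S \<subset> R \<Longrightarrow> best_features d D J S \<subseteq> R"
    and H: "\<And>k. k \<in> H \<Longrightarrow> fst (D k) \<in> cube d"
    and z0: "z0 \<in> cube d" "nths z0 R = nths x R"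
    and card_z0: "3 < card {k\<in>H. fst (D k) = z0}"
    and SP: "(S, P) \<in> set_pmf (grow d D J H l)"
    and full: "fully_grown D (H, P)"
    and k: "k \<in> leaf D H P x"
  shows "nths (fst (D k)) R = nths x R"
proof -
  define agree where "agree T z \<longleftrightarrow> (\<forall>i\<in>T. z ! i = x ! i)" for T and z :: "bool list"
  have agree_iff: "agree R z \<longleftrightarrow> nths z R = nths x R" if "z \<in> cube d" for z
    using nths_eq_iff[of z x R] that x R by (auto simp: agree_def cube_def)
  have fin: "finite {k\<in>H. fst (D k) = z0}"
    using card_z0 by (intro card_ge_0_finite) simp
  obtain k0 where k0: "k0 \<in> H" "fst (D k0) = z0"
    using card_z0 by (cases "{k\<in>H. fst (D k) = z0} = {}") auto
  \<comment> \<open>Invariant over the levels. While relevant features are missing, the cell of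
    \<open>x\<close> contains its whole class; once all of \<open>R\<close> has been used, the leaf
    is pure and stays so because cells only shrink. For \<open>S = R\<close> the first alternative
    implies the second.\<close>
  have inv: "(S \<subseteq> R \<and> {z\<in>cube d. agree R z} \<subseteq> cell P x \<and> (\<forall>k\<in>leaf D H P x. agree S (fst (D k))))
           \<or> (R \<subseteq> S \<and> (\<forall>k\<in>leaf D H P x. agree R (fst (D k))))"
    using SP
  proof (induction l arbitrary: S P)
    case 0
    then have "S = {}" "P = {cube d}" by auto
    moreover have "cells_partition d {cube d}" by (auto simp: cells_partition_def)
    ultimately have "cell P x = cube d" using cell_unique[OF _ x] x by blast
    with \<open>S = {}\<close> show ?case by (auto simp: agree_def)
  next
    case (Suc l)
    then obtain S' P' i where SP: "(S', P') \<in> set_pmf (grow d D J H l)" "i \<in> best_features d D J S'"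
      "S = S' \<union> {i}" "P = (\<Union>A\<in>P'. split_cell D H i A)"
      by (auto simp: set_pmf_grow_Suc[OF d])
    have P': "cells_partition d P'" using grow_partition[OF d SP(1)] by simp
    note cell = cells_partition_split(2)[OF P' x, of D H i, folded SP(4)]
    have sub: "leaf D H P x \<subseteq> leaf D H P' x"
      using cell by (auto simp: leaf_def points_in_def split: if_splits)
    consider "R \<subseteq> S'" "\<forall>k\<in>leaf D H P' x. agree R (fst (D k))"
      | "S' \<subset> R" "{z\<in>cube d. agree R z} \<subseteq> cell P' x" "\<forall>k\<in>leaf D H P' x. agree S' (fst (D k))"
      using Suc.IH[OF SP(1)] by (cases "S' = R") auto
    then show ?case
    proof cases
      case 1
      then show ?thesis using sub SP(3) by blast
    next
      case 2
      have i: "i \<in> R" using best[OF 2(1)] SP(2) by blast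
      have z0_agree: "agree R z0" using agree_iff[OF z0(1)] z0(2) by simp
      have "z0 \<in> cell P' x" using 2(2) z0(1) z0_agree by blast
      \<comment> \<open>An undivided cell agrees with \<open>x\<close> at \<open>i\<close> as well:
        the half on the side of \<open>x\<close> holds a copy of \<open>z0\<close>, so the split can
        only have been refused because the other half is empty.\<close>
      have eq: "fst (D k) ! i = x ! i" if k: "k \<in> leaf D H P x" for k
      proof (cases "points_in D H {z\<in>cell P' x. z ! i} \<noteq> {} \<and> points_in D H {z\<in>cell P' x. \<not> z ! i} \<noteq> {}")
        case True
        then have "cell P x = {z\<in>cell P' x. z ! i = x ! i}" using cell by simp
        then show ?thesis using k by (auto simp: leaf_def points_in_def)
      next
        case False
        have "z0 ! i = x ! i" using z0_agree i by (simp add: agree_def)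
        then have "points_in D H {z\<in>cell P' x. z ! i = x ! i} \<noteq> {}"
          using k0 \<open>z0 \<in> cell P' x\<close> by (auto simp: points_in_def)
        with False have "points_in D H {z\<in>cell P' x. z ! i \<noteq> x ! i} = {}"
          by (cases "x ! i") (auto simp: points_in_def)
        then show ?thesis using k sub by (auto simp: leaf_def points_in_def)
      qed
      have "S \<subseteq> R" using 2(1) i SP(3) by blast
      moreover have "{z\<in>cube d. agree R z} \<subseteq> cell P x"
        using cell 2(2) i by (auto simp: agree_def split: if_splits)
      moreover have "\<forall>k\<in>leaf D H P x. agree S (fst (D k))"
        using 2(3) sub eq SP(3) by (auto simp: agree_def)
      ultimately show ?thesis by blast
    qed
  qed
  have kH: "k \<in> H" using k leaf_subset by blast
  have "agree R (fst (D k))"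
  proof (cases "R \<subseteq> S \<and> (\<forall>k\<in>leaf D H P x. agree R (fst (D k)))")
    case True
    then show ?thesis using k by blast
  next
    case False
    with inv have "{z\<in>cube d. agree R z} \<subseteq> cell P x" by blast
    then have z0': "z0 \<in> cell P x" using z0 agree_iff[OF z0(1)] by blast
    then have sub: "{k\<in>H. fst (D k) = z0} \<subseteq> leaf D H P x"
      by (auto simp: leaf_def points_in_def)
    have "cell P x \<in> P" using cell_in(1)[of d P x] grow_partition[OF d SP] x by blast
    then have disj: "card (leaf D H P x) \<in> {2, 3} \<or>
        (\<forall>k\<in>leaf D H P x. \<forall>l\<in>leaf D H P x. fst (D k) = fst (D l))"
      using full unfolding leaf_def by simp
    have "card (leaf D H P x) \<notin> {2, 3}"
    proof
      assume *: "card (leaf D H P x) \<in> {2, 3}"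
      then have "finite (leaf D H P x)" by (intro card_ge_0_finite) auto
      then have "card {k\<in>H. fst (D k) = z0} \<le> card (leaf D H P x)" using sub by (rule card_mono)
      with * card_z0 show False by auto
    qed
    with disj have "fst (D k) = fst (D k0)" using k sub k0 by blast
    then show ?thesis using z0 agree_iff[OF z0(1)] k0 by simp
  qed
  then show ?thesis using agree_iff H[OF kH] by simp
qed

section \<open>Tree predictions as weighted averages of responses\<close>

definition tree_weight :: "(nat \<Rightarrow> sample) \<Rightarrow> nat set \<Rightarrow> bool list set set \<Rightarrow> bool list \<Rightarrow> nat \<Rightarrow> real" where
  "tree_weight D H P x k = (if k \<in> leaf D H P x then 1 / real (card (leaf D H P x)) else 0)"

lemma tree_weight_nonneg: "0 \<le> tree_weight D H P x k"
  by (simp add: tree_weight_def)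

text \<open>For an empty leaf both sides are 0, since division by 0 gives 0. Hence the total weight
  is always at most 1, but equals 1 only over a non-empty leaf.\<close>

lemma sum_tree_weight:
  assumes "finite K" "H \<subseteq> K"
  shows "(\<Sum>k\<in>K. tree_weight D H P x k * f k) = (\<Sum>k\<in>leaf D H P x. f k) / real (card (leaf D H P x))"
proof -
  have "(\<Sum>k\<in>K. tree_weight D H P x k * f k) =
        (\<Sum>k\<in>K. if k \<in> leaf D H P x then f k / real (card (leaf D H P x)) else 0)"
    by (intro sum.cong) (auto simp: tree_weight_def)
  also have "\<dots> = (\<Sum>k\<in>K \<inter> leaf D H P x. f k / real (card (leaf D H P x)))"
    using assms by (simp add: sum.inter_restrict)
  also have "K \<inter> leaf D H P x = leaf D H P x"
    using leaf_subset[of D H P x] assms by blast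
  finally show ?thesis by (simp add: sum_divide_distrib)
qed

lemma tree_predict_eq_sum_weight:
  assumes "finite K" "H \<subseteq> K"
  shows "tree_predict D (H, P) x = (\<Sum>k\<in>K. tree_weight D H P x k * snd (D k))"
  unfolding sum_tree_weight[OF assms] by (simp add: mean_response_def leaf_def cell_def)

lemma sum_tree_weight_le_1:
  assumes "finite K" "H \<subseteq> K"
  shows "(\<Sum>k\<in>K. tree_weight D H P x k) \<le> 1"
  using sum_tree_weight[OF assms, of D P x "\<lambda>_. 1"] by simp

lemma sum_tree_weight_eq_1:
  assumes "finite K" "H \<subseteq> K" "leaf D H P x \<noteq> {}"
  shows "(\<Sum>k\<in>K. tree_weight D H P x k) = 1"
proof -
  have "finite (leaf D H P x)"
    using finite_subset[OF leaf_subset finite_subset[OF assms(2,1)]] .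
  then show ?thesis using assms(3) sum_tree_weight[OF assms(1,2), of D P x "\<lambda>_. 1"] by simp
qed

lemma tree_weight_outside: "k \<notin> H \<Longrightarrow> tree_weight D H P x k = 0"
  using leaf_subset[of D H P x] by (auto simp: tree_weight_def)

lemma points_in_image: "inj \<pi> \<Longrightarrow> points_in D (\<pi> ` H) A = \<pi> ` points_in (D \<circ> \<pi>) H A"
  by (auto simp: points_in_def)

lemma tree_predict_image:
  assumes "inj \<pi>"
  shows "tree_predict D (\<pi> ` H, P) x = tree_predict (D \<circ> \<pi>) (H, P) x"
proof -
  have "mean_response D (\<pi> ` K) = mean_response (D \<circ> \<pi>) K" for K
    using assms by (simp add: mean_response_def sum.reindex inj_on_def inj_def card_image)
  then show ?thesis by (simp add: points_in_image[OF assms])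
qed

lemma fully_grown_image:
  assumes "inj \<pi>"
  shows "fully_grown D (\<pi> ` H, P) \<longleftrightarrow> fully_grown (D \<circ> \<pi>) (H, P)"
  using assms by (simp add: points_in_image card_image inj_on_def inj_def)

section \<open>Random sub-samples and forest weights\<close>

lemma expectation_bind_pmf_finite:
  fixes h :: "'b \<Rightarrow> 'c::{banach, second_countable_topology}"
  assumes "finite (set_pmf p)" "\<And>x. x \<in> set_pmf p \<Longrightarrow> finite (set_pmf (f x))"
  shows "measure_pmf.expectation (bind_pmf p f) h =
    measure_pmf.expectation p (\<lambda>x. measure_pmf.expectation (f x) h)"
  by (subst pmf_expectation_bind[OF assms(1) assms(2) subset_refl], assumption)
     (simp add: integral_measure_pmf[OF assms(1)])

lemma expectation_sum_finite:
  fixes f :: "'i \<Rightarrow> 'a \<Rightarrow> real"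
  assumes "finite (set_pmf p)"
  shows "measure_pmf.expectation p (\<lambda>x. \<Sum>i\<in>I. f i x) = (\<Sum>i\<in>I. measure_pmf.expectation p (f i))"
  by (intro Bochner_Integration.integral_sum integrable_measure_pmf_finite assms)

lemma expectation_mono_finite:
  fixes f g :: "'a \<Rightarrow> real"
  assumes "finite (set_pmf p)" "\<And>x. x \<in> set_pmf p \<Longrightarrow> f x \<le> g x"
  shows "measure_pmf.expectation p f \<le> measure_pmf.expectation p g"
  by (intro integral_mono_AE integrable_measure_pmf_finite assms(1))
     (simp add: AE_measure_pmf_iff assms(2))

lemma expectation_cong_pmf:
  assumes "\<And>x. x \<in> set_pmf p \<Longrightarrow> f x = g x"
  shows "measure_pmf.expectation p f = measure_pmf.expectation p g"
  by (intro integral_cong_AE) (simp_all add: AE_measure_pmf_iff assms)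

lemma expectation_nonneg_pmf:
  fixes f :: "'a \<Rightarrow> real"
  assumes "\<And>x. x \<in> set_pmf p \<Longrightarrow> 0 \<le> f x"
  shows "0 \<le> measure_pmf.expectation p f"
  by (intro integral_nonneg_AE) (simp add: AE_measure_pmf_iff assms)

lemma abs_expectation_le_finite:
  fixes f :: "'a \<Rightarrow> real"
  assumes "finite (set_pmf p)"
  shows "\<bar>measure_pmf.expectation p f\<bar> \<le> measure_pmf.expectation p (\<lambda>x. \<bar>f x\<bar>)"
  using integral_norm_bound[of p f] by simp

lemma finite_set_pmf_grow:
  assumes "0 < d"
  shows "finite (set_pmf (grow d D J H l))"
  by (induction l)
     (auto simp: set_pmf_grow_Suc[OF assms] best_features_finite_nonempty[OF assms])

section \<open>Random sub-samples and their symmetry\<close>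

definition splits :: "nat \<Rightarrow> nat \<Rightarrow> (nat set \<times> nat set) pmf" where
  "splits n s = do {
     I \<leftarrow> pmf_of_set {I. I \<subseteq> {..<n} \<and> card I = s};
     J \<leftarrow> pmf_of_set {J. J \<subseteq> I \<and> card J = card I div 2};
     return_pmf (J, I - J)
   }"

text \<open>A tree without the permutation of the training set. Its sub-sample law
  \<open>splits\<close> does not depend on the data and is kept apart from the growth, which exposes
  its invariance under relabelling of indices.\<close>

definition base_tree ::
  "nat \<Rightarrow> nat \<Rightarrow> nat \<Rightarrow> nat \<Rightarrow> (nat \<Rightarrow> sample) \<Rightarrow> (nat set \<times> bool list set set) pmf" where
  "base_tree d L n s D = do {
     (J, H) \<leftarrow> splits n s;
     (S, P) \<leftarrow> grow d D J H L;
     return_pmf (H, P)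
   }"

abbreviation tree_levels :: "real \<Rightarrow> nat" where
  "tree_levels logt \<equiv> nat (\<lceil>logt\<rceil> + 1)"

lemma random_tree_eq_base_tree:
  "random_tree d logt n s D = do {
     \<pi> \<leftarrow> pmf_of_set {\<pi>. \<pi> permutes {..<n}};
     (H, P) \<leftarrow> base_tree d (tree_levels logt) n s (D \<circ> \<pi>);
     return_pmf (\<pi> ` H, P)
   }"
  unfolding random_tree_def base_tree_def splits_def level_split_def
  by (simp add: bind_assoc_pmf bind_return_pmf case_prod_unfold)

lemma subsets_finite_nonempty:
  assumes "finite I" "k \<le> card I"
  shows "finite {J. J \<subseteq> I \<and> card J = k}" "{J. J \<subseteq> I \<and> card J = k} \<noteq> {}"
  using assms obtain_subset_with_card_n[OF assms(2)] by auto

lemma set_pmf_splits: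
  assumes "s \<le> n"
  shows "set_pmf (splits n s) =
    {(J, H). J \<union> H \<subseteq> {..<n} \<and> J \<inter> H = {} \<and> card (J \<union> H) = s \<and> card J = s div 2}"
proof -
  have [simp]: "set_pmf (pmf_of_set {I. I \<subseteq> {..<n} \<and> card I = s}) = {I. I \<subseteq> {..<n} \<and> card I = s}"
    using subsets_finite_nonempty[of "{..<n}" s] assms by simp
  have [simp]: "set_pmf (pmf_of_set {J. J \<subseteq> I \<and> card J = card I div 2}) =
      {J. J \<subseteq> I \<and> card J = card I div 2}" if "I \<subseteq> {..<n}" for I
    using subsets_finite_nonempty[of I "card I div 2"] finite_subset[OF that] by simp
  show ?thesis
  proof (intro set_eqI iffI)
    fix p assume "p \<in> set_pmf (splits n s)"
    then obtain I J where "p = (J, I - J)" "I \<subseteq> {..<n}" "card I = s" "J \<subseteq> I" "card J = s div 2"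
      by (auto simp: splits_def)
    moreover from this have "J \<union> (I - J) = I" by blast
    ultimately show "p \<in> {(J, H). J \<union> H \<subseteq> {..<n} \<and> J \<inter> H = {} \<and> card (J \<union> H) = s \<and> card J = s div 2}"
      by auto
  next
    fix p assume p: "p \<in> {(J, H). J \<union> H \<subseteq> {..<n} \<and> J \<inter> H = {} \<and> card (J \<union> H) = s \<and> card J = s div 2}"
    obtain J H where JH: "p = (J, H)" by (cases p)
    with p have "H = (J \<union> H) - J" by auto
    moreover have "J \<union> H \<in> {I. I \<subseteq> {..<n} \<and> card I = s}" using p JH by auto
    moreover have "J \<in> {J'. J' \<subseteq> J \<union> H \<and> card J' = card (J \<union> H) div 2}" using p JH by auto
    ultimately show "p \<in> set_pmf (splits n s)"
      using p JH by (auto simp: splits_def intro!: exI[of _ "J \<union> H"])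
  qed
qed

lemma finite_set_pmf_splits:
  assumes "s \<le> n"
  shows "finite (set_pmf (splits n s))"
proof (rule finite_subset)
  show "set_pmf (splits n s) \<subseteq> Pow {..<n} \<times> Pow {..<n}"
    by (auto simp: set_pmf_splits[OF assms])
qed auto

lemma splitsD:
  assumes "s \<le> n" "(J, H) \<in> set_pmf (splits n s)"
  shows "J \<subseteq> {..<n}" "H \<subseteq> {..<n}" "finite J" "finite H" "J \<inter> H = {}" "card (J \<union> H) = s"
    "card J = s div 2" "card H = s - s div 2"
proof -
  from assms show *: "J \<subseteq> {..<n}" "H \<subseteq> {..<n}" "J \<inter> H = {}" "card (J \<union> H) = s" "card J = s div 2"
    by (auto simp: set_pmf_splits)
  show fin: "finite J" "finite H" using * finite_subset by blast+
  show "card H = s - s div 2" using card_Un_disjoint[OF fin *(3)] * by simp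
qed

lemma map_pmf_of_set_subsets_image:
  assumes "inj \<pi>" "finite I" "k \<le> card I"
  shows "map_pmf ((`) \<pi>) (pmf_of_set {J. J \<subseteq> I \<and> card J = k}) =
         pmf_of_set {J. J \<subseteq> \<pi> ` I \<and> card J = k}"
proof (rule map_pmf_of_set_bij_betw)
  show "bij_betw ((`) \<pi>) {J. J \<subseteq> I \<and> card J = k} {J. J \<subseteq> \<pi> ` I \<and> card J = k}"
    unfolding bij_betw_def
  proof
    show "inj_on ((`) \<pi>) {J. J \<subseteq> I \<and> card J = k}"
      using assms(1) by (auto simp: inj_on_def inj_image_eq_iff)
    show "(`) \<pi> ` {J. J \<subseteq> I \<and> card J = k} = {J. J \<subseteq> \<pi> ` I \<and> card J = k}"
    proof (intro set_eqI iffI)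
      fix J assume "J \<in> {J. J \<subseteq> \<pi> ` I \<and> card J = k}"
      then obtain J' where J': "J' \<subseteq> I" "J = \<pi> ` J'" "card J = k" by (auto simp: subset_image_iff)
      then have "card J' = k" using assms(1) by (simp add: card_image inj_on_def inj_def)
      with J' show "J \<in> (`) \<pi> ` {J. J \<subseteq> I \<and> card J = k}" by blast
    qed (use assms(1) in \<open>auto simp: card_image inj_on_def inj_def\<close>)
  qed
qed (use subsets_finite_nonempty[OF assms(2,3)] in auto)

text \<open>An injection maps the subsets of a given size bijectively to those of the image, so it
  preserves the uniform choice of the sub-sample and then that of its half. With a transposition
  this compares two samples.\<close>

lemma map_pmf_splits_permutes:
  assumes "s \<le> n" "\<pi> permutes {..<n}"
  shows "map_pmf (\<lambda>(J, H). (\<pi> ` J, \<pi> ` H)) (splits n s) = splits n s"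
proof -
  note inj = permutes_inj[OF assms(2)]
  have s: "finite {..<n}" "s \<le> card {..<n}" using assms by auto
  have "splits n s = map_pmf ((`) \<pi>) (pmf_of_set {I. I \<subseteq> {..<n} \<and> card I = s}) \<bind>
      (\<lambda>I. pmf_of_set {J. J \<subseteq> I \<and> card J = card I div 2} \<bind> (\<lambda>J. return_pmf (J, I - J)))"
    unfolding splits_def using map_pmf_of_set_subsets_image[OF inj s] permutes_image[OF assms(2)] by simp
  also have "\<dots> = pmf_of_set {I. I \<subseteq> {..<n} \<and> card I = s} \<bind>
      (\<lambda>I. pmf_of_set {J. J \<subseteq> \<pi> ` I \<and> card J = card (\<pi> ` I) div 2} \<bind> (\<lambda>J. return_pmf (J, \<pi> ` I - J)))"
    by (simp add: bind_map_pmf)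
  also have "\<dots> = pmf_of_set {I. I \<subseteq> {..<n} \<and> card I = s} \<bind>
      (\<lambda>I. pmf_of_set {J. J \<subseteq> I \<and> card J = card I div 2} \<bind> (\<lambda>J. return_pmf (\<pi> ` J, \<pi> ` (I - J))))"
  proof (rule bind_pmf_cong[OF refl])
    fix I assume "I \<in> set_pmf (pmf_of_set {I. I \<subseteq> {..<n} \<and> card I = s})"
    then have I: "I \<subseteq> {..<n}" "card I = s"
      using subsets_finite_nonempty[OF s] by auto
    then have "finite I" by (auto intro: finite_subset)
    have "card (\<pi> ` I) = card I" using inj by (simp add: card_image inj_on_def inj_def)
    then have eq: "pmf_of_set {J. J \<subseteq> \<pi> ` I \<and> card J = card (\<pi> ` I) div 2} =
        map_pmf ((`) \<pi>) (pmf_of_set {J. J \<subseteq> I \<and> card J = card I div 2})"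
      using map_pmf_of_set_subsets_image[OF inj \<open>finite I\<close>, of "card I div 2"] by simp
    show "pmf_of_set {J. J \<subseteq> \<pi> ` I \<and> card J = card (\<pi> ` I) div 2} \<bind> (\<lambda>J. return_pmf (J, \<pi> ` I - J)) =
       pmf_of_set {J. J \<subseteq> I \<and> card J = card I div 2} \<bind> (\<lambda>J. return_pmf (\<pi> ` J, \<pi> ` (I - J)))"
      unfolding eq by (simp add: bind_map_pmf image_set_diff[OF inj])
  qed
  also have "\<dots> = map_pmf (\<lambda>(J, H). (\<pi> ` J, \<pi> ` H)) (splits n s)"
    by (simp add: splits_def map_bind_pmf)
  finally show ?thesis ..
qed

lemma expectation_splits_permutes:
  fixes f :: "nat set \<Rightarrow> nat set \<Rightarrow> real"
  assumes "s \<le> n" "\<pi> permutes {..<n}"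
  shows "measure_pmf.expectation (splits n s) (\<lambda>(J, H). f (\<pi> ` J) (\<pi> ` H)) =
         measure_pmf.expectation (splits n s) (\<lambda>(J, H). f J H)"
  by (subst (2) map_pmf_splits_permutes[OF assms, symmetric]) (simp add: case_prod_unfold)

text \<open>By a transposition all indices have the same inclusion probability, and these
  probabilities add up to the size \<open>s\<close> of the sub-sample.\<close>

lemma splits_inclusion_prob:
  assumes "s \<le> n" "k < n"
  shows "measure_pmf.expectation (splits n s) (\<lambda>(J, H). of_bool (k \<in> J \<union> H)) = real s / real n"
proof -
  define q where "q k = measure_pmf.expectation (splits n s) (\<lambda>(J, H). of_bool (k \<in> J \<union> H) :: real)" for k
  have "q l = q k" if "l < n" for l
  proof -
    define \<tau> where "\<tau> = Transposition.transpose k l"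
    have \<tau>: "\<tau> permutes {..<n}" unfolding \<tau>_def using that assms(2) by (intro permutes_swap_id) auto
    have "l \<in> \<tau> ` J \<longleftrightarrow> k \<in> J" for J
      using inj_image_mem_iff[OF permutes_inj[OF \<tau>], of k J] by (simp add: \<tau>_def)
    then show ?thesis
      using expectation_splits_permutes[OF assms(1) \<tau>, of "\<lambda>J H. of_bool (l \<in> J \<union> H)"]
      by (simp add: q_def)
  qed
  then have "real n * q k = (\<Sum>l<n. q l)" by simp
  also have "\<dots> = measure_pmf.expectation (splits n s) (\<lambda>p. \<Sum>l<n. case p of (J, H) \<Rightarrow> of_bool (l \<in> J \<union> H))"
    unfolding q_def by (rule expectation_sum_finite[OF finite_set_pmf_splits[OF assms(1)], symmetric])
  also have "\<dots> = measure_pmf.expectation (splits n s) (\<lambda>_. real s)"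
  proof (rule expectation_cong_pmf)
    fix p assume p: "p \<in> set_pmf (splits n s)"
    obtain J H where [simp]: "p = (J, H)" by (cases p)
    have "(\<Sum>l<n. of_bool (l \<in> J \<union> H) :: real) = (\<Sum>l\<in>{..<n} \<inter> (J \<union> H). 1)"
      by (subst sum.inter_restrict) (auto intro!: sum.cong)
    also have "{..<n} \<inter> (J \<union> H) = J \<union> H" using splitsD[of s n J H] p assms(1) by auto
    finally show "(\<Sum>l<n. case p of (J, H) \<Rightarrow> of_bool (l \<in> J \<union> H)) = real s"
      using splitsD[of s n J H] p assms(1) by simp
  qed
  finally have "real n * q k = real s" by simp
  then show ?thesis using assms(2) by (simp add: q_def field_simps)
qed

section \<open>Weights of the samples in the forest\<close>

definition grow_weight ::
  "nat \<Rightarrow> nat \<Rightarrow> (nat \<Rightarrow> sample) \<Rightarrow> nat set \<Rightarrow> nat set \<Rightarrow> bool list \<Rightarrow> nat \<Rightarrow> real" where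
  "grow_weight d L D J H x k =
     measure_pmf.expectation (grow d D J H L) (\<lambda>(S, P). tree_weight D H P x k)"

text \<open>The coefficients \<open>a_k\<close> of the overview, for trees without
  permutation.\<close>

definition forest_weight ::
  "nat \<Rightarrow> nat \<Rightarrow> nat \<Rightarrow> nat \<Rightarrow> (nat \<Rightarrow> sample) \<Rightarrow> bool list \<Rightarrow> nat \<Rightarrow> real" where
  "forest_weight d L n s D x k =
     measure_pmf.expectation (splits n s) (\<lambda>(J, H). grow_weight d L D J H x k)"

lemma grow_weight_nonneg: "0 \<le> grow_weight d L D J H x k"
  unfolding grow_weight_def by (intro expectation_nonneg_pmf) (auto simp: tree_weight_nonneg)

lemma forest_weight_nonneg: "0 \<le> forest_weight d L n s D x k"
  unfolding forest_weight_def by (intro expectation_nonneg_pmf) (auto simp: grow_weight_nonneg)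

lemma grow_weight_outside: "k \<notin> H \<Longrightarrow> grow_weight d L D J H x k = 0"
  by (simp add: grow_weight_def tree_weight_outside case_prod_unfold)

lemma sum_grow_weight:
  assumes "0 < d"
  shows "(\<Sum>k\<in>K. grow_weight d L D J H x k * f k) =
    measure_pmf.expectation (grow d D J H L) (\<lambda>(S, P). \<Sum>k\<in>K. tree_weight D H P x k * f k)"
  by (simp add: grow_weight_def case_prod_unfold expectation_sum_finite finite_set_pmf_grow[OF assms]
      integrable_measure_pmf_finite)

lemma sum_grow_weight_le_1:
  assumes "0 < d" "finite K" "H \<subseteq> K"
  shows "(\<Sum>k\<in>K. grow_weight d L D J H x k) \<le> 1"
proof -
  have "(\<Sum>k\<in>K. grow_weight d L D J H x k) =
      measure_pmf.expectation (grow d D J H L) (\<lambda>(S, P). \<Sum>k\<in>K. tree_weight D H P x k)"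
    using sum_grow_weight[OF assms(1), of L D J H x "\<lambda>_. 1" K] by simp
  also have "\<dots> \<le> measure_pmf.expectation (grow d D J H L) (\<lambda>_. 1)"
    using sum_tree_weight_le_1[OF assms(2,3)]
    by (intro expectation_mono_finite finite_set_pmf_grow assms) auto
  finally show ?thesis by simp
qed

lemma sum_grow_weight_eq_1:
  assumes "0 < d" "finite K" "H \<subseteq> K" "x \<in> cube d" "h \<in> H" "fst (D h) \<in> cube d"
  shows "(\<Sum>k\<in>K. grow_weight d L D J H x k) = 1"
proof -
  have "(\<Sum>k\<in>K. grow_weight d L D J H x k) =
      measure_pmf.expectation (grow d D J H L) (\<lambda>(S, P). \<Sum>k\<in>K. tree_weight D H P x k)"
    using sum_grow_weight[OF assms(1), of L D J H x "\<lambda>_. 1" K] by simp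
  also have "\<dots> = measure_pmf.expectation (grow d D J H L) (\<lambda>_. 1)"
    using sum_tree_weight_eq_1[OF assms(2,3)] leaf_nonempty[where d = d and x = x and h = h] assms
    by (intro expectation_cong_pmf) auto
  finally show ?thesis by simp
qed

lemma expectation_base_tree:
  fixes f :: "nat set \<times> bool list set set \<Rightarrow> real"
  assumes "0 < d" "s \<le> n"
  shows "measure_pmf.expectation (base_tree d L n s D) f =
    measure_pmf.expectation (splits n s)
      (\<lambda>(J, H). measure_pmf.expectation (grow d D J H L) (\<lambda>(S, P). f (H, P)))"
  unfolding base_tree_def
  by (subst expectation_bind_pmf_finite)
     (auto simp: finite_set_pmf_splits[OF assms(2)] finite_set_pmf_grow[OF assms(1)] case_prod_unfold
       map_pmf_def[symmetric])

lemma finite_set_pmf_base_tree: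
  assumes "0 < d" "s \<le> n"
  shows "finite (set_pmf (base_tree d L n s D))"
  unfolding base_tree_def
  by (auto simp: finite_set_pmf_splits[OF assms(2)] finite_set_pmf_grow[OF assms(1)])

lemma sum_forest_weight:
  assumes "s \<le> n"
  shows "(\<Sum>k\<in>K. forest_weight d L n s D x k * f k) =
    measure_pmf.expectation (splits n s) (\<lambda>(J, H). \<Sum>k\<in>K. grow_weight d L D J H x k * f k)"
  by (simp add: forest_weight_def case_prod_unfold expectation_sum_finite finite_set_pmf_splits[OF assms]
      integrable_measure_pmf_finite)

lemma expectation_base_tree_predict:
  assumes "0 < d" "s \<le> n"
  shows "measure_pmf.expectation (base_tree d L n s D) (\<lambda>h. tree_predict D h x) =
    (\<Sum>k<n. forest_weight d L n s D x k * snd (D k))"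
  unfolding expectation_base_tree[OF assms] sum_forest_weight[OF assms(2)]
proof (rule expectation_cong_pmf)
  fix p assume p: "p \<in> set_pmf (splits n s)"
  obtain J H where [simp]: "p = (J, H)" by (cases p)
  have H: "H \<subseteq> {..<n}" using splitsD[of s n J H] p assms by simp
  show "(case p of (J, H) \<Rightarrow> measure_pmf.expectation (grow d D J H L) (\<lambda>(S, P). tree_predict D (H, P) x)) =
        (case p of (J, H) \<Rightarrow> \<Sum>k<n. grow_weight d L D J H x k * snd (D k))"
    by (simp add: sum_grow_weight[OF assms(1)] tree_predict_eq_sum_weight[OF finite_lessThan H] del: tree_predict.simps)
qed

lemma sum_forest_weight_le_1:
  assumes "0 < d" "s \<le> n"
  shows "(\<Sum>k<n. forest_weight d L n s D x k) \<le> 1"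
proof -
  have "(\<Sum>k<n. forest_weight d L n s D x k) =
    measure_pmf.expectation (splits n s) (\<lambda>(J, H). \<Sum>k<n. grow_weight d L D J H x k)"
    using sum_forest_weight[OF assms(2), of d L D x "\<lambda>_. 1" "{..<n}"] by simp
  also have "\<dots> \<le> measure_pmf.expectation (splits n s) (\<lambda>_. 1)"
    by (intro expectation_mono_finite finite_set_pmf_splits assms(2))
       (auto intro!: sum_grow_weight_le_1 assms dest: splitsD[OF assms(2)])
  finally show ?thesis by simp
qed

lemma sum_forest_weight_eq_1:
  assumes "0 < d" "s \<le> n" "0 < s" "x \<in> cube d" "\<And>k. k < n \<Longrightarrow> fst (D k) \<in> cube d"
  shows "(\<Sum>k<n. forest_weight d L n s D x k) = 1"
proof -
  have "(\<Sum>k<n. forest_weight d L n s D x k) =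
    measure_pmf.expectation (splits n s) (\<lambda>(J, H). \<Sum>k<n. grow_weight d L D J H x k)"
    using sum_forest_weight[OF assms(2), of d L D x "\<lambda>_. 1" "{..<n}"] by simp
  also have "\<dots> = measure_pmf.expectation (splits n s) (\<lambda>_. 1)"
  proof (rule expectation_cong_pmf)
    fix p assume p: "p \<in> set_pmf (splits n s)"
    obtain J H where [simp]: "p = (J, H)" by (cases p)
    note JH = splitsD[OF assms(2), of J H]
    have "0 < card H" using JH(8) p assms(3) by simp
    then obtain h where "h \<in> H" by (auto simp: card_gt_0_iff)
    with JH p assms show "(case p of (J, H) \<Rightarrow> \<Sum>k<n. grow_weight d L D J H x k) = 1"
      by (auto intro!: sum_grow_weight_eq_1)
  qed
  finally show ?thesis by simp
qed

text \<open>Locality: the weights depend only on the data in the sub-sample, so disjoint sub-samples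
  yield independent weights.\<close>

lemma grow_weight_cong:
  assumes "\<And>k. k \<in> J \<union> H \<Longrightarrow> D k = D' k"
  shows "grow_weight d L D J H x k = grow_weight d L D' J H x k"
proof -
  have "grow d D J H L = grow d D' J H L"
    using assms by (intro grow_cong) (auto intro!: image_cong)
  moreover have "leaf D H P x = leaf D' H P x" for P
    using assms by (auto simp: leaf_def points_in_def)
  then have "tree_weight D H P x k = tree_weight D' H P x k" for P
    by (simp add: tree_weight_def)
  ultimately show ?thesis by (simp add: grow_weight_def case_prod_unfold)
qed

text \<open>Honesty at work: relabelling estimation points among equal covariate vectors keeps their
  set of covariates, hence the partition, and carries the weights along.\<close>

lemma grow_weight_image:
  assumes "inj \<tau>" "\<And>k. k \<in> H \<Longrightarrow> fst (D (\<tau> k)) = fst (D k)"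
  shows "grow_weight d L D J (\<tau> ` H) x (\<tau> k) = grow_weight d L D J H x k"
proof -
  have "(\<lambda>k. fst (D k)) ` (\<tau> ` H) = (\<lambda>k. fst (D k)) ` H"
    unfolding image_image using assms(2) by (intro image_cong) auto
  then have "grow d D J (\<tau> ` H) L = grow d D J H L" by (intro grow_cong) auto
  moreover have "leaf D (\<tau> ` H) P x = \<tau> ` leaf D H P x" for P
    using assms(2) by (auto simp: leaf_def points_in_def)
  then have "tree_weight D (\<tau> ` H) P x (\<tau> k) = tree_weight D H P x k" for P
    using assms(1) by (simp add: tree_weight_def inj_image_mem_iff card_image inj_on_def inj_def)
  ultimately show ?thesis by (simp add: grow_weight_def case_prod_unfold)
qed

text \<open>
  Exchanging two samples with the same covariate vector does not change the partition unless one
  of them belongs to the structure sample.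
\<close>
lemma forest_weight_diff_le:
  assumes s: "s \<le> n" and kl: "k < n" "l < n" "fst (D k) = fst (D l)"
  shows "forest_weight d L n s D x k - forest_weight d L n s D x l \<le>
    measure_pmf.expectation (splits n s) (\<lambda>(J, H). of_bool (l \<in> J) * grow_weight d L D J H x k)"
proof -
  define \<tau> where "\<tau> = Transposition.transpose k l"
  have \<tau>: "\<tau> permutes {..<n}" unfolding \<tau>_def using kl by (intro permutes_swap_id) auto
  note inj = permutes_inj[OF \<tau>]
  note fin = finite_set_pmf_splits[OF s]
  note int = integrable_measure_pmf_finite[OF fin]
  \<comment> \<open>The transposition turns the weight of \<open>l\<close> into the weight of
    \<open>\<tau> k\<close> in the relabelled split, so the two weights can be compared split by
    split.\<close>
  have "forest_weight d L n s D x l =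
      measure_pmf.expectation (splits n s) (\<lambda>(J, H). grow_weight d L D (\<tau> ` J) (\<tau> ` H) x (\<tau> k))"
    using expectation_splits_permutes[OF s \<tau>, of "\<lambda>J H. grow_weight d L D J H x l"]
    by (simp add: forest_weight_def \<tau>_def)
  then have "forest_weight d L n s D x k - forest_weight d L n s D x l =
      measure_pmf.expectation (splits n s) (\<lambda>(J, H). grow_weight d L D J H x k - grow_weight d L D (\<tau> ` J) (\<tau> ` H) x (\<tau> k))"
    unfolding forest_weight_def by (simp add: case_prod_unfold int)
  also have "\<dots> \<le> measure_pmf.expectation (splits n s) (\<lambda>(J, H). of_bool (l \<in> J) * grow_weight d L D J H x k)"
  proof (intro expectation_mono_finite fin)
    fix p assume p: "p \<in> set_pmf (splits n s)"
    obtain J H where [simp]: "p = (J, H)" by (cases p)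
    have disj: "J \<inter> H = {}" using splitsD[OF s, of J H] p by simp
    \<comment> \<open>If \<open>l\<close> is in the structure sample, the subtracted term is merely
      dropped. If only \<open>k\<close> is, the weight of \<open>k\<close> is 0. Otherwise the
      structure sample is fixed by \<open>\<tau>\<close> and both terms agree.\<close>
    consider "l \<in> J" | "l \<notin> J" "k \<in> J" | "l \<notin> J" "k \<notin> J" by blast
    then show "(case p of (J, H) \<Rightarrow> grow_weight d L D J H x k - grow_weight d L D (\<tau> ` J) (\<tau> ` H) x (\<tau> k)) \<le>
       (case p of (J, H) \<Rightarrow> of_bool (l \<in> J) * grow_weight d L D J H x k)"
    proof cases
      case 1
      then show ?thesis using grow_weight_nonneg[of d L D "\<tau> ` J" "\<tau> ` H" x "\<tau> k"] by simp
    next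
      case 2
      then have "grow_weight d L D J H x k = 0" using disj by (intro grow_weight_outside) auto
      then show ?thesis
        using 2 grow_weight_nonneg[of d L D "\<tau> ` J" "\<tau> ` H" x "\<tau> k"] by simp
    next
      case 3
      have "\<tau> j = j" if "j \<in> J" for j
        using 3 that unfolding \<tau>_def by (intro transpose_apply_other) auto
      then have "\<tau> ` J = J" by simp
      moreover have "fst (D (\<tau> j)) = fst (D j)" for j
        using kl(3) by (auto simp: \<tau>_def Transposition.transpose_def)
      ultimately show ?thesis using 3 grow_weight_image[OF inj, of H D d L J x k] by simp
    qed
  qed
  finally show ?thesis .
qed

text \<open>Replacing the weights of a class by their average costs the mean over \<open>l\<close>
  of the sums of \<open>(a k - a l) * e k\<close>, and a difference of two weights is charged to the
  splits that put one of the two samples into the structure sample.\<close>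

lemma forest_noise_class_average:
  fixes e :: "nat \<Rightarrow> real" and D :: "nat \<Rightarrow> sample" and z :: "bool list"
  assumes d: "0 < d" and s: "s \<le> n" and e: "\<And>k. k < n \<Longrightarrow> \<bar>e k\<bar> \<le> 1/2"
  defines "K \<equiv> {k\<in>{..<n}. fst (D k) = z}"
  assumes K: "K \<noteq> {}"
  shows "\<bar>(\<Sum>k\<in>K. forest_weight d L n s D x k * e k) -
      (\<Sum>k\<in>K. forest_weight d L n s D x k) / real (card K) * (\<Sum>k\<in>K. e k)\<bar> \<le> real s / real (card K)"
proof -
  define a where "a = forest_weight d L n s D x"
  define g where "g l k = measure_pmf.expectation (splits n s)
      (\<lambda>(J, H). of_bool (l \<in> J) * grow_weight d L D J H x k)" for l k
  note fin = finite_set_pmf_splits[OF s]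
  have fK: "finite K" "K \<subseteq> {..<n}" by (auto simp: K_def)
  have N: "0 < real (card K)" using fK K by (simp add: card_gt_0_iff)
  have g0: "0 \<le> g l k" for l k
    unfolding g_def by (intro expectation_nonneg_pmf) (auto simp: grow_weight_nonneg)
  have ag: "\<bar>a k - a l\<bar> \<le> g l k + g k l" if "k \<in> K" "l \<in> K" for k l
  proof -
    have "a k - a l \<le> g l k" "a l - a k \<le> g k l"
      using that unfolding a_def g_def K_def by (auto intro!: forest_weight_diff_le[OF s])
    then show ?thesis using g0[of l k] g0[of k l] by linarith
  qed
  \<comment> \<open>For a fixed split the double sum factorises: summing over \<open>l\<close>
    counts structure points in the class, at most \<open>s div 2\<close>, and summing over
    \<open>k\<close> gives a total weight of at most 1.\<close>
  have sum_g: "(\<Sum>k\<in>K. \<Sum>l\<in>K. g l k) \<le> real s"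
  proof -
    have "(\<Sum>k\<in>K. \<Sum>l\<in>K. g l k) = measure_pmf.expectation (splits n s)
        (\<lambda>p. \<Sum>k\<in>K. \<Sum>l\<in>K. case p of (J, H) \<Rightarrow> of_bool (l \<in> J) * grow_weight d L D J H x k)"
      unfolding g_def by (simp add: expectation_sum_finite[OF fin])
    also have "\<dots> \<le> measure_pmf.expectation (splits n s) (\<lambda>_. real s)"
    proof (intro expectation_mono_finite fin)
      fix p assume p: "p \<in> set_pmf (splits n s)"
      obtain J H where [simp]: "p = (J, H)" by (cases p)
      note JH = splitsD[OF s, of J H]
      have "(\<Sum>k\<in>K. \<Sum>l\<in>K. of_bool (l \<in> J) * grow_weight d L D J H x k) =
            (\<Sum>l\<in>K. of_bool (l \<in> J)) * (\<Sum>k\<in>K. grow_weight d L D J H x k)"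
        by (subst sum.swap) (simp add: sum_product)
      also have "\<dots> \<le> real (s div 2) * 1"
      proof (rule mult_mono)
        have "(\<Sum>l\<in>K. of_bool (l \<in> J) :: real) = (\<Sum>l\<in>K \<inter> J. 1)"
          by (subst sum.inter_restrict[OF fK(1)]) (auto intro!: sum.cong)
        also have "\<dots> = real (card (K \<inter> J))" by simp
        also have "\<dots> \<le> real (card J)" using JH p by (intro of_nat_mono card_mono) auto
        finally show "(\<Sum>l\<in>K. of_bool (l \<in> J) :: real) \<le> real (s div 2)" using JH p by simp
        have "(\<Sum>k\<in>K. grow_weight d L D J H x k) \<le> (\<Sum>k<n. grow_weight d L D J H x k)"
          using fK by (intro sum_mono2) (auto simp: grow_weight_nonneg)
        also have "\<dots> \<le> 1" using JH p by (intro sum_grow_weight_le_1 d) auto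
        finally show "(\<Sum>k\<in>K. grow_weight d L D J H x k) \<le> 1" .
      qed (auto intro!: sum_nonneg simp: grow_weight_nonneg)
      also have "\<dots> \<le> real s" by simp
      finally show "(\<Sum>k\<in>K. \<Sum>l\<in>K. case p of (J, H) \<Rightarrow> of_bool (l \<in> J) * grow_weight d L D J H x k) \<le> real s"
        by simp
    qed
    finally show ?thesis by simp
  qed
  have "(\<Sum>k\<in>K. \<Sum>l\<in>K. a k * e k) = real (card K) * (\<Sum>k\<in>K. a k * e k)"
    by (simp add: sum_distrib_left)
  then have "(\<Sum>k\<in>K. a k * e k) - (\<Sum>k\<in>K. a k) / real (card K) * (\<Sum>k\<in>K. e k) =
      ((\<Sum>k\<in>K. \<Sum>l\<in>K. a k * e k) - (\<Sum>l\<in>K. a l) * (\<Sum>k\<in>K. e k)) / real (card K)"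
    using N by (simp add: field_simps)
  also have "(\<Sum>l\<in>K. a l) * (\<Sum>k\<in>K. e k) = (\<Sum>k\<in>K. \<Sum>l\<in>K. a l * e k)"
    by (subst sum.swap) (simp add: sum_product)
  also have "(\<Sum>k\<in>K. \<Sum>l\<in>K. a k * e k) - \<dots> = (\<Sum>k\<in>K. \<Sum>l\<in>K. (a k - a l) * e k)"
    by (simp add: sum_subtractf algebra_simps)
  finally have eq: "(\<Sum>k\<in>K. a k * e k) - (\<Sum>k\<in>K. a k) / real (card K) * (\<Sum>k\<in>K. e k) =
      (\<Sum>k\<in>K. \<Sum>l\<in>K. (a k - a l) * e k) / real (card K)" .
  \<comment> \<open>The factor 1/2 from the bound on \<open>e\<close> absorbs the two terms of the
    symmetric bound \<open>ag\<close>.\<close>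
  have "\<bar>\<Sum>k\<in>K. \<Sum>l\<in>K. (a k - a l) * e k\<bar> \<le> (\<Sum>k\<in>K. \<Sum>l\<in>K. (g l k + g k l) * (1/2))"
  proof (intro sum_abs[THEN order_trans] sum_mono)
    fix k l assume "k \<in> K" "l \<in> K"
    moreover have "\<bar>e k\<bar> \<le> 1/2" using \<open>k \<in> K\<close> fK by (intro e) auto
    ultimately show "\<bar>(a k - a l) * e k\<bar> \<le> (g l k + g k l) * (1/2)"
      unfolding abs_mult using ag[of k l] by (intro mult_mono) auto
  qed
  also have "\<dots> = ((\<Sum>k\<in>K. \<Sum>l\<in>K. g l k) + (\<Sum>k\<in>K. \<Sum>l\<in>K. g k l)) / 2"
    by (simp add: sum.distrib sum_divide_distrib add_divide_distrib)
  also have "(\<Sum>k\<in>K. \<Sum>l\<in>K. g k l) = (\<Sum>k\<in>K. \<Sum>l\<in>K. g l k)" by (rule sum.swap)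
  finally have "\<bar>\<Sum>k\<in>K. \<Sum>l\<in>K. (a k - a l) * e k\<bar> \<le> real s" using sum_g by simp
  then show ?thesis
    unfolding eq[unfolded a_def] using N by (simp add: a_def abs_divide divide_right_mono)
qed

section \<open>Measurability in the data\<close>

text \<open>A random choice depending measurably on \<open>w\<close>, with one finite set carrying
  its values for all \<open>w\<close>. Expectations become finite sums, so measurability is checked
  point by point and the set of trees needs no sigma-algebra.\<close>

definition finite_kernel :: "'a measure \<Rightarrow> 'b set \<Rightarrow> ('a \<Rightarrow> 'b pmf) \<Rightarrow> bool" where
  "finite_kernel M F K \<longleftrightarrow>
     finite F \<and> (\<forall>w. set_pmf (K w) \<subseteq> F) \<and> (\<forall>b. (\<lambda>w. pmf (K w) b) \<in> borel_measurable M)"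

lemma finite_kernel_expectation:
  fixes f :: "'b \<Rightarrow> real"
  assumes "finite_kernel M F K"
  shows "measure_pmf.expectation (K w) f = (\<Sum>b\<in>F. pmf (K w) b * f b)"
  using assms by (subst integral_measure_pmf[of F]) (auto simp: finite_kernel_def)

lemma finite_kernel_expectation_measurable:
  fixes f :: "'a \<Rightarrow> 'b \<Rightarrow> real"
  assumes "finite_kernel M F K" "\<And>b. b \<in> F \<Longrightarrow> (\<lambda>w. f w b) \<in> borel_measurable M"
  shows "(\<lambda>w. measure_pmf.expectation (K w) (f w)) \<in> borel_measurable M"
  unfolding finite_kernel_expectation[OF assms(1)]
  using assms by (intro borel_measurable_sum borel_measurable_times) (auto simp: finite_kernel_def)

lemma finite_kernel_const: "finite (set_pmf p) \<Longrightarrow> set_pmf p \<subseteq> F \<Longrightarrow> finite F \<Longrightarrow> finite_kernel M F (\<lambda>_. p)"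
  by (simp add: finite_kernel_def)

lemma finite_kernel_bind:
  assumes "finite_kernel M F K" "\<And>b. b \<in> F \<Longrightarrow> finite_kernel M G (\<lambda>w. N w b)" "finite G"
  shows "finite_kernel M G (\<lambda>w. bind_pmf (K w) (N w))"
  unfolding finite_kernel_def
proof (intro conjI allI)
  show "set_pmf (K w \<bind> N w) \<subseteq> G" for w
    using assms by (fastforce simp: finite_kernel_def)
  show "(\<lambda>w. pmf (K w \<bind> N w) b) \<in> borel_measurable M" for b
    unfolding pmf_bind using assms
    by (intro finite_kernel_expectation_measurable[OF assms(1)]) (auto simp: finite_kernel_def)
qed fact

lemma finite_kernel_return:
  assumes "finite G" "\<And>w. g w \<in> G" "\<And>b. Measurable.pred M (\<lambda>w. g w = b)"
  shows "finite_kernel M G (\<lambda>w. return_pmf (g w))"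
  unfolding finite_kernel_def
proof (intro conjI allI)
  have "pmf (return_pmf (g w)) b = (if g w = b then 1 else 0)" for w b
    by (simp add: pmf_return)
  then show "(\<lambda>w. pmf (return_pmf (g w)) b) \<in> borel_measurable M" for b
    using assms(3)[of b] by simp
qed (use assms in auto)

lemma finite_kernel_replicate:
  assumes "finite_kernel M F K"
  shows "finite_kernel M {hs. set hs \<subseteq> F \<and> length hs = N} (\<lambda>w. replicate_pmf N (K w))"
proof (induction N)
  case 0
  then show ?case by (simp add: finite_kernel_def)
next
  case (Suc N)
  have fin: "finite {hs. set hs \<subseteq> F \<and> length hs = k}" for k
    using assms by (intro finite_lists_length_eq) (simp add: finite_kernel_def)
  show ?case
    unfolding replicate_pmf.simps
    by (intro finite_kernel_bind[OF assms] finite_kernel_bind[OF Suc] finite_kernel_const)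
       (auto simp: fin)
qed

lemma finite_cube [simp]: "finite (cube d)"
  using finite_lists_length_eq[of "UNIV :: bool set" d] by (simp add: cube_def)

text \<open>The data are a random element on an arbitrary measure space. This covers the data
  themselves, the permuted data \<open>D \<circ> \<pi>\<close> and a single fixed data set.\<close>

definition samples_measurable :: "'a measure \<Rightarrow> nat set \<Rightarrow> ('a \<Rightarrow> nat \<Rightarrow> sample) \<Rightarrow> bool" where
  "samples_measurable M K X \<longleftrightarrow> (\<forall>k\<in>K. (\<lambda>w. X w k) \<in> measurable M (count_space UNIV \<Otimes>\<^sub>M borel))"

section \<open>Measurability of a single tree\<close>

context
  fixes M :: "'a measure" and K :: "nat set" and X :: "'a \<Rightarrow> nat \<Rightarrow> sample"
  assumes X: "samples_measurable M K X"
begin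

lemma snd_sample_measurable: "k \<in> K \<Longrightarrow> (\<lambda>w. snd (X w k)) \<in> borel_measurable M"
  using X by (auto simp: samples_measurable_def intro: measurable_compose[OF _ measurable_snd])

lemma fst_sample_measurable: "k \<in> K \<Longrightarrow> (\<lambda>w. fst (X w k)) \<in> measurable M (count_space UNIV)"
  using X by (auto simp: samples_measurable_def intro: measurable_compose[OF _ measurable_fst])

lemma covariate_function_measurable: "k \<in> K \<Longrightarrow> (\<lambda>w. f (fst (X w k))) \<in> measurable M (count_space UNIV)"
  by (rule measurable_compose[OF fst_sample_measurable]) auto

lemma covariate_pred: "k \<in> K \<Longrightarrow> Measurable.pred M (\<lambda>w. Q (fst (X w k)))"
  by (rule covariate_function_measurable)

lemma covariate_eq_pred:
  fixes f :: "bool list \<Rightarrow> 'c :: countable"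
  assumes "k \<in> K" "l \<in> K"
  shows "Measurable.pred M (\<lambda>w. f (fst (X w k)) = f (fst (X w l)))"
proof -
  have "(\<lambda>w. f (fst (X w k)) = f (fst (X w l))) = (\<lambda>w. \<exists>c. f (fst (X w k)) = c \<and> f (fst (X w l)) = c)"
    by auto
  also have "Measurable.pred M \<dots>"
    using covariate_pred[OF assms(1)] covariate_pred[OF assms(2)] by measurable
  finally show ?thesis .
qed

lemma mean_response_measurable:
  assumes "finite J" "J \<subseteq> K" and Q: "\<And>k. k \<in> J \<Longrightarrow> Measurable.pred M (\<lambda>w. Q w k)"
  shows "(\<lambda>w. mean_response (X w) {k\<in>J. Q w k}) \<in> borel_measurable M"
proof -
  \<comment> \<open>The set averaged over depends on \<open>w\<close>; indicators turn this into
    sums over the fixed set \<open>J\<close>.\<close>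
  have eq: "mean_response (X w) {k\<in>J. Q w k} =
      (\<Sum>k\<in>J. if Q w k then snd (X w k) else 0) / (\<Sum>k\<in>J. if Q w k then 1 else 0)" for w
    by (simp only: mean_response_def real_of_card sum.inter_filter[OF assms(1)])
  show ?thesis
    unfolding eq using assms snd_sample_measurable
    by (intro borel_measurable_divide borel_measurable_sum measurable_If) (auto simp: pred_def)
qed

lemma V_emp_measurable:
  assumes "finite J" "J \<subseteq> K"
  shows "(\<lambda>w. V_emp (X w) J S) \<in> borel_measurable M"
  unfolding V_emp_def using assms
  by (intro borel_measurable_divide borel_measurable_sum borel_measurable_power
      mean_response_measurable covariate_eq_pred) auto

lemma best_features_pred:
  assumes "finite J" "J \<subseteq> K"
  shows "Measurable.pred M (\<lambda>w. i \<in> best_features d (X w) J S)"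
  unfolding best_features_def using V_emp_measurable[OF assms] by simp measurable

lemma best_features_kernel:
  assumes "0 < d" "finite J" "J \<subseteq> K"
  shows "finite_kernel M {..<d} (\<lambda>w. pmf_of_set (best_features d (X w) J S))"
  unfolding finite_kernel_def
proof (intro conjI allI)
  show "set_pmf (pmf_of_set (best_features d (X w) J S)) \<subseteq> {..<d}" for w
    using best_features_finite_nonempty[OF assms(1), of "X w" J S] by (auto simp: best_features_def)
  have eq: "pmf (pmf_of_set (best_features d (X w) J S)) i =
      (if i \<in> best_features d (X w) J S then 1 else 0) /
      (\<Sum>j<d. if j \<in> best_features d (X w) J S then 1 else 0)" for w i
  proof -
    have "(\<Sum>j<d. if j \<in> best_features d (X w) J S then 1 else 0 :: real) =
        real (card ({..<d} \<inter> best_features d (X w) J S))"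
      by (simp add: sum.If_cases)
    also have "{..<d} \<inter> best_features d (X w) J S = best_features d (X w) J S"
      by (auto simp: best_features_def)
    finally show ?thesis
      using best_features_finite_nonempty[OF assms(1), of "X w" J S] by (simp add: indicator_def)
  qed
  show "(\<lambda>w. pmf (pmf_of_set (best_features d (X w) J S)) i) \<in> borel_measurable M" for i
    unfolding eq using best_features_pred[OF assms(2,3)]
    by (intro borel_measurable_divide borel_measurable_sum measurable_If) (auto simp: pred_def)
qed simp

lemma points_in_nonempty_pred:
  assumes "finite H" "H \<subseteq> K"
  shows "Measurable.pred M (\<lambda>w. points_in (X w) H A \<noteq> {})"
proof -
  have "(\<lambda>w. points_in (X w) H A \<noteq> {}) = (\<lambda>w. \<exists>k\<in>H. fst (X w k) \<in> A)"
    by (auto simp: points_in_def)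
  also have "Measurable.pred M \<dots>"
    using assms by (intro pred_intros_finite(4) covariate_pred) auto
  finally show ?thesis .
qed

lemma split_partition_kernel:
  assumes "finite H" "H \<subseteq> K" "P \<subseteq> Pow (cube d)" "S \<subseteq> {..<d}" "i < d"
  shows "finite_kernel M (Pow {..<d} \<times> Pow (Pow (cube d)))
    (\<lambda>w. return_pmf (S \<union> {i}, \<Union>A\<in>P. split_cell (X w) H i A))"
proof (rule finite_kernel_return)
  show "(S \<union> {i}, \<Union>A\<in>P. split_cell (X w) H i A) \<in> Pow {..<d} \<times> Pow (Pow (cube d))" for w
    using assms(3-5) split_cell_subset[of _ "X w" H i] by (simp, blast)
  have sub: "(\<Union>A\<in>P. split_cell (X w) H i A) \<subseteq> Pow (cube d)" for w
    using assms(3) split_cell_subset[of _ "X w" H i] by blast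
  fix b :: "nat set \<times> bool list set set"
  have mem: "Measurable.pred M (\<lambda>w. B \<in> split_cell (X w) H i A)" for A B
  proof -
    have "(\<lambda>w. B \<in> split_cell (X w) H i A) = (\<lambda>w. if points_in (X w) H {z\<in>A. \<not> z ! i} \<noteq> {} \<and>
        points_in (X w) H {z\<in>A. z ! i} \<noteq> {} then B = {z\<in>A. \<not> z ! i} \<or> B = {z\<in>A. z ! i} else B = A)"
      by (auto simp: split_cell_def Let_def)
    also have "Measurable.pred M \<dots>"
      using points_in_nonempty_pred[OF assms(1,2)]
      by (intro measurable_If) (auto simp: pred_def[symmetric] intro!: pred_intros_logic)
    finally show ?thesis .
  qed
  \<comment> \<open>A partition is determined by which of the finitely many subsets of the cube
    belong to it, so equality with \<open>b\<close> is a finite conjunction of measurable events.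
    The inclusion condition rejects those \<open>b\<close> that contain anything else.\<close>
  have "(\<lambda>w. (S \<union> {i}, \<Union>A\<in>P. split_cell (X w) H i A) = b) =
      (\<lambda>w. S \<union> {i} = fst b \<and> snd b \<subseteq> Pow (cube d) \<and>
        (\<forall>B\<in>Pow (cube d). B \<in> snd b \<longleftrightarrow> (\<exists>A\<in>P. B \<in> split_cell (X w) H i A)))"
    (is "_ = (\<lambda>w. ?rhs w)")
  proof
    fix w
    define U where "U = (\<Union>A\<in>P. split_cell (X w) H i A)"
    have "U = Q \<longleftrightarrow> Q \<subseteq> Pow (cube d) \<and> (\<forall>B\<in>Pow (cube d). B \<in> Q \<longleftrightarrow> B \<in> U)" for Q
      using sub[of w, folded U_def] by blast
    moreover have "B \<in> U \<longleftrightarrow> (\<exists>A\<in>P. B \<in> split_cell (X w) H i A)" for B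
      by (auto simp: U_def)
    ultimately show "((S \<union> {i}, \<Union>A\<in>P. split_cell (X w) H i A) = b) = ?rhs w"
      unfolding U_def[symmetric] by (cases b) simp
  qed
  also have "Measurable.pred M \<dots>"
    using finite_subset[OF assms(3)] mem
    by (intro pred_intros_logic pred_intros_finite) auto
  finally show "Measurable.pred M (\<lambda>w. (S \<union> {i}, \<Union>A\<in>P. split_cell (X w) H i A) = b)" .
qed simp

lemma grow_kernel:
  assumes "0 < d" "finite J" "finite H" "J \<union> H \<subseteq> K"
  shows "finite_kernel M (Pow {..<d} \<times> Pow (Pow (cube d))) (\<lambda>w. grow d (X w) J H l)"
proof (induction l)
  case 0
  then show ?case by (simp add: finite_kernel_def)
next
  case (Suc l)
  show ?case
    unfolding grow.simps case_prod_unfold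
  proof (rule finite_kernel_bind[OF Suc])
    fix p assume p: "p \<in> Pow {..<d} \<times> Pow (Pow (cube d))"
    show "finite_kernel M (Pow {..<d} \<times> Pow (Pow (cube d)))
      (\<lambda>w. pmf_of_set (best_features d (X w) J (fst p)) \<bind>
        (\<lambda>i. return_pmf (fst p \<union> {i}, \<Union>A\<in>snd p. split_cell (X w) H i A)))"
    proof (rule finite_kernel_bind[OF best_features_kernel])
      show "finite_kernel M (Pow {..<d} \<times> Pow (Pow (cube d)))
        (\<lambda>w. return_pmf (fst p \<union> {i}, \<Union>A\<in>snd p. split_cell (X w) H i A))" if "i \<in> {..<d}" for i
        using assms p that by (intro split_partition_kernel) auto
    qed (use assms in auto)
  qed simp
qed

lemma tree_predict_measurable:
  assumes "finite H" "H \<subseteq> K"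
  shows "(\<lambda>w. tree_predict (X w) (H, P) x) \<in> borel_measurable M"
  unfolding tree_predict.simps points_in_def
  using assms by (intro mean_response_measurable covariate_pred) auto

lemma tree_weight_measurable:
  assumes "finite H" "H \<subseteq> K"
  shows "(\<lambda>w. tree_weight (X w) H P x k) \<in> borel_measurable M"
proof (cases "k \<in> H")
  case True
  have eq: "tree_weight (X w) H P x k = (if fst (X w k) \<in> cell P x then 1 else 0) /
      (\<Sum>k\<in>H. if fst (X w k) \<in> cell P x then 1 else 0)" for w
    using assms(1) True by (simp add: tree_weight_def leaf_def points_in_def sum.If_cases Int_def)
  show ?thesis
    unfolding eq using assms True covariate_pred[of _ "\<lambda>z. z \<in> cell P x"]
    by (intro borel_measurable_divide borel_measurable_sum measurable_If) (auto simp: pred_def)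
qed (simp add: tree_weight_outside)

lemma grow_weight_measurable:
  assumes "0 < d" "finite J" "finite H" "J \<union> H \<subseteq> K"
  shows "(\<lambda>w. grow_weight d L (X w) J H x k) \<in> borel_measurable M"
  unfolding grow_weight_def case_prod_unfold
  using assms by (intro finite_kernel_expectation_measurable[OF grow_kernel] tree_weight_measurable) auto

end

section \<open>Measurability of the forest\<close>

lemma finite_kernel_splits:
  assumes "s \<le> n"
  shows "finite_kernel M (set_pmf (splits n s)) (\<lambda>_. splits n s)"
  using finite_set_pmf_splits[OF assms] by (intro finite_kernel_const) auto

lemma forest_weight_measurable:
  assumes "samples_measurable M {..<n} X" "0 < d" "s \<le> n"
  shows "(\<lambda>w. forest_weight d L n s (X w) x k) \<in> borel_measurable M"
  unfolding forest_weight_def case_prod_unfold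
proof (rule finite_kernel_expectation_measurable[OF finite_kernel_splits[OF assms(3)]])
  fix p assume "p \<in> set_pmf (splits n s)"
  then show "(\<lambda>w. grow_weight d L (X w) (fst p) (snd p) x k) \<in> borel_measurable M"
    using splitsD[OF assms(3), of "fst p" "snd p"]
    by (intro grow_weight_measurable[OF assms(1,2)]) auto
qed

lemma base_tree_kernel:
  assumes "samples_measurable M {..<n} X" "0 < d" "s \<le> n"
  shows "finite_kernel M (Pow {..<n} \<times> Pow (Pow (cube d))) (\<lambda>w. base_tree d L n s (X w))"
  unfolding base_tree_def case_prod_unfold
proof (intro finite_kernel_bind[OF finite_kernel_splits[OF assms(3)]])
  fix p assume p: "p \<in> set_pmf (splits n s)"
  have JH: "finite (fst p)" "finite (snd p)" "fst p \<union> snd p \<subseteq> {..<n}"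
    using splitsD[OF assms(3), of "fst p" "snd p"] p by auto
  show "finite_kernel M (Pow {..<n} \<times> Pow (Pow (cube d)))
     (\<lambda>w. grow d (X w) (fst p) (snd p) L \<bind> (\<lambda>q. return_pmf (snd p, snd q)))"
    using JH by (intro finite_kernel_bind[OF grow_kernel[OF assms(1,2)]] finite_kernel_const) auto
qed auto

lemma permutes_finite_nonempty:
  "finite {\<pi>. \<pi> permutes {..<n::nat}}" "{\<pi>. \<pi> permutes {..<n::nat}} \<noteq> {}"
  using finite_permutations[of "{..<n}"] permutes_id[of "{..<n}"] by (simp, blast)

lemma random_tree_kernel:
  assumes "samples_measurable M {..<n} X" "0 < d" "s \<le> n"
  shows "finite_kernel M (Pow {..<n} \<times> Pow (Pow (cube d))) (\<lambda>w. random_tree d logt n s (X w))"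
  unfolding random_tree_eq_base_tree case_prod_unfold
proof (rule finite_kernel_bind)
  show "finite_kernel M {\<pi>. \<pi> permutes {..<n}} (\<lambda>_. pmf_of_set {\<pi>. \<pi> permutes {..<n}})"
    using permutes_finite_nonempty[of n] by (intro finite_kernel_const) auto
  fix \<pi> :: "nat \<Rightarrow> nat" assume "\<pi> \<in> {\<pi>. \<pi> permutes {..<n}}"
  then have \<pi>: "\<pi> permutes {..<n}" by simp
  have "samples_measurable M {..<n} (\<lambda>w. X w \<circ> \<pi>)"
    using assms(1) permutes_in_image[OF \<pi>] by (auto simp: samples_measurable_def)
  then show "finite_kernel M (Pow {..<n} \<times> Pow (Pow (cube d)))
      (\<lambda>w. base_tree d (tree_levels logt) n s (X w \<circ> \<pi>) \<bind> (\<lambda>p. return_pmf (\<pi> ` fst p, snd p)))"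
    using assms(2,3) permutes_in_image[OF \<pi>]
    by (intro finite_kernel_bind[OF base_tree_kernel] finite_kernel_const) fastforce+
qed auto

lemma mc_forest_expectation_measurable:
  fixes f :: "'a \<Rightarrow> real \<Rightarrow> real"
  assumes "samples_measurable M {..<n} X" "0 < d" "s \<le> n"
    and f: "(\<lambda>(w, v). f w v) \<in> borel_measurable (M \<Otimes>\<^sub>M borel)"
  shows "(\<lambda>w. measure_pmf.expectation (mc_forest d logt n s B x (X w)) (f w)) \<in> borel_measurable M"
  unfolding mc_forest_def integral_map_pmf
proof (rule finite_kernel_expectation_measurable[OF finite_kernel_replicate[OF random_tree_kernel[OF assms(1-3)]]])
  fix hs assume hs: "hs \<in> {hs. set hs \<subseteq> Pow {..<n} \<times> Pow (Pow (cube d)) \<and> length hs = B}"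
  have "(\<lambda>w. \<Sum>h\<leftarrow>hs. tree_predict (X w) h x) \<in> borel_measurable M"
    using hs[THEN CollectD, THEN conjunct1]
  proof (induction hs)
    case (Cons h hs)
    then obtain H P where "h = (H, P)" "H \<subseteq> {..<n}" by auto
    with Cons tree_predict_measurable[OF assms(1), of H P x] finite_subset[of H "{..<n}"]
    show ?case by (simp del: tree_predict.simps)
  qed simp
  then have "(\<lambda>w. (w, (\<Sum>h\<leftarrow>hs. tree_predict (X w) h x) / real B)) \<in> measurable M (M \<Otimes>\<^sub>M borel)"
    by measurable
  from measurable_compose[OF this f] show "(\<lambda>w. f w ((\<Sum>h\<leftarrow>hs. tree_predict (X w) h x) / real B)) \<in> borel_measurable M"
    by simp
qed

text \<open>\<open>Giry_Monad.bind\<close> is a mixture of laws only for a measurable kernel.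
  Evaluated at a Borel set, this kernel is the expectation of an indicator, which the preceding
  lemma covers.\<close>

lemma mc_forest_kernel_measurable:
  assumes "samples_measurable M {..<n} X" "0 < d" "s \<le> n"
  shows "(\<lambda>w. distr (measure_pmf (mc_forest d logt n s B x (X w))) borel (\<lambda>v. v)) \<in> measurable M (subprob_algebra borel)"
proof (rule measurable_subprob_algebra)
  fix w
  have "prob_space (distr (measure_pmf (mc_forest d logt n s B x (X w))) borel (\<lambda>v. v))"
    by (intro measure_pmf.prob_space_distr) simp
  then show "subprob_space (distr (measure_pmf (mc_forest d logt n s B x (X w))) borel (\<lambda>v. v))"
    by (rule prob_space_imp_subprob_space)
next
  fix A :: "real set" assume A: "A \<in> sets borel"
  have "emeasure (distr (measure_pmf (mc_forest d logt n s B x (X w))) borel (\<lambda>v. v)) A =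
      ennreal (measure_pmf.expectation (mc_forest d logt n s B x (X w)) (indicator A))" for w
    using A by (simp add: emeasure_distr measure_pmf.emeasure_eq_measure)
  moreover have "(\<lambda>w. ennreal (measure_pmf.expectation (mc_forest d logt n s B x (X w)) (indicator A))) \<in> borel_measurable M"
    using measurable_compose[OF measurable_snd borel_measurable_indicator[OF A]]
    by (intro measurable_compose[OF mc_forest_expectation_measurable[OF assms] measurable_ennreal])
      (simp add: case_prod_unfold)
  ultimately show "(\<lambda>w. emeasure (distr (measure_pmf (mc_forest d logt n s B x (X w))) borel (\<lambda>v. v)) A) \<in> borel_measurable M"
    by (simp only:)
qed simp

section \<open>The regression model\<close>

lemma (in prob_space) integral_le_of_AE:
  fixes f :: "'a \<Rightarrow> real"
  assumes "f \<in> borel_measurable M" "integrable M g" "AE x in M. \<bar>f x\<bar> \<le> g x"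
  shows "integrable M f" "(\<integral>x. f x \<partial>M) \<le> (\<integral>x. g x \<partial>M)"
proof -
  show int: "integrable M f"
    by (rule Bochner_Integration.integrable_bound[OF assms(2,1)]) (use assms(3) in auto)
  show "(\<integral>x. f x \<partial>M) \<le> (\<integral>x. g x \<partial>M)"
    by (intro integral_mono_AE int assms(2)) (use assms(3) in auto)
qed

section \<open>The law of one sample\<close>

locale regression =
  fixes d :: nat and Dx :: "bool list pmf" and \<E> :: "real measure" and m :: "bool list \<Rightarrow> real"
  assumes model: "regression_model d Dx \<E> m"
begin

lemma d_pos: "0 < d"
  and set_Dx: "set_pmf Dx \<subseteq> cube d"
  and prob_\<E>: "prob_space \<E>"
  and sets_\<E> [measurable_cong]: "sets \<E> = sets borel"
  and AE_\<E>: "AE e in \<E>. e \<in> {-1/2..1/2}"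
  and mean_\<E>: "(\<integral>e. e \<partial>\<E>) = 0"
  and m_bound: "z \<in> cube d \<Longrightarrow> \<bar>m z\<bar> \<le> 1/2"
  using model by (auto simp: regression_model_def abs_le_iff)

sublocale noise: prob_space \<E> by (rule prob_\<E>)

sublocale pair: pair_prob_space "measure_pmf Dx" \<E> ..

lemma finite_set_Dx: "finite (set_pmf Dx)"
  using finite_subset[OF set_Dx] by simp

definition noise_var :: real where "noise_var = (\<integral>e. e\<^sup>2 \<partial>\<E>)"

text \<open>Applied to a sample \<open>(z, m z + e)\<close> it returns the noise
  \<open>e\<close>.\<close>

definition residual :: "sample \<Rightarrow> real" where "residual z = snd z - m (fst z)"

abbreviation Z :: "sample measure" where "Z \<equiv> sample_law Dx \<E> m"

lemma sample_map_measurable: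
  "(\<lambda>(z, e). (z, m z + e)) \<in> measurable (measure_pmf Dx \<Otimes>\<^sub>M \<E>) (count_space UNIV \<Otimes>\<^sub>M borel)"
proof -
  have m: "m \<in> borel_measurable (measure_pmf Dx)" by simp
  have "(\<lambda>p. m (fst p) + snd p) \<in> borel_measurable (measure_pmf Dx \<Otimes>\<^sub>M \<E>)"
    by (intro borel_measurable_add measurable_compose[OF measurable_fst m])
       (auto intro: measurable_compose[OF measurable_snd] simp: measurable_cong_sets[OF sets_\<E> refl])
  moreover have "fst \<in> measurable (measure_pmf Dx \<Otimes>\<^sub>M \<E>) (count_space UNIV)"
    using measurable_fst[of "measure_pmf Dx" \<E>] by simp
  ultimately show ?thesis
    by (simp add: case_prod_unfold)
qed

lemma sets_Z: "sets Z = sets (count_space UNIV \<Otimes>\<^sub>M borel)"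
  by (simp add: sample_law_def)

lemma space_Z [simp]: "space Z = UNIV"
  by (simp add: sample_law_def space_pair_measure)

lemma prob_space_Z: "prob_space Z"
  unfolding sample_law_def by (rule pair.prob_space_distr[OF sample_map_measurable])

sublocale Z: prob_space Z by (rule prob_space_Z)

lemma Z_measurable_iff: "f \<in> measurable Z N \<longleftrightarrow> f \<in> measurable (count_space UNIV \<Otimes>\<^sub>M borel) N"
  by (simp add: measurable_cong_sets[OF sets_Z refl])

lemma fst_Z_measurable [measurable]: "fst \<in> measurable Z (count_space UNIV)"
  unfolding Z_measurable_iff by simp

lemma snd_Z_measurable [measurable]: "snd \<in> borel_measurable Z"
  unfolding Z_measurable_iff by simp

lemma covariate_Z_measurable [measurable]: "(\<lambda>z. f (fst z)) \<in> borel_measurable Z" for f :: "bool list \<Rightarrow> real"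
  by (rule measurable_compose[OF fst_Z_measurable]) simp

lemma residual_measurable [measurable]: "residual \<in> borel_measurable Z"
  unfolding residual_def[abs_def]
  by (intro borel_measurable_diff snd_Z_measurable covariate_Z_measurable)

text \<open>Under \<open>Z\<close> the covariate vector and the residual are independent with laws
  \<open>Dx\<close> and \<open>\<E>\<close>, so this is Fubini's theorem; the bound on the supports
  supplies integrability.\<close>

lemma integral_Z:
  fixes g :: "bool list \<Rightarrow> real \<Rightarrow> real"
  assumes "(\<lambda>z. g (fst z) (residual z)) \<in> borel_measurable Z"
    and "\<And>z e. z \<in> set_pmf Dx \<Longrightarrow> e \<in> {-1/2..1/2} \<Longrightarrow> \<bar>g z e\<bar> \<le> c"
  shows "(\<integral>z. g (fst z) (residual z) \<partial>Z) = measure_pmf.expectation Dx (\<lambda>z. \<integral>e. g z e \<partial>\<E>)"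
    and "integrable Z (\<lambda>z. g (fst z) (residual z))"
proof -
  have g: "(\<lambda>p. g (fst p) (snd p)) \<in> borel_measurable (measure_pmf Dx \<Otimes>\<^sub>M \<E>)"
    using measurable_compose[OF sample_map_measurable assms(1)[unfolded Z_measurable_iff]]
    by (simp add: case_prod_unfold residual_def)
  have "AE p in measure_pmf Dx \<Otimes>\<^sub>M \<E>. \<bar>g (fst p) (snd p)\<bar> \<le> c"
  proof (rule pair.AE_pair_measure)
    show "{p \<in> space (measure_pmf Dx \<Otimes>\<^sub>M \<E>). \<bar>g (fst p) (snd p)\<bar> \<le> c} \<in> sets (measure_pmf Dx \<Otimes>\<^sub>M \<E>)"
      using g by measurable
    show "AE z in measure_pmf Dx. AE e in \<E>. \<bar>g (fst (z, e)) (snd (z, e))\<bar> \<le> c"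
      unfolding AE_measure_pmf_iff
    proof
      fix z assume "z \<in> set_pmf Dx"
      from AE_\<E> show "AE e in \<E>. \<bar>g (fst (z, e)) (snd (z, e))\<bar> \<le> c"
      proof eventually_elim
        case (elim e)
        then show ?case using assms(2)[OF \<open>z \<in> set_pmf Dx\<close>] by simp
      qed
    qed
  qed
  then have int: "integrable (measure_pmf Dx \<Otimes>\<^sub>M \<E>) (\<lambda>p. g (fst p) (snd p))"
    by (intro pair.integrable_const_bound[OF _ g]) auto
  show "integrable Z (\<lambda>z. g (fst z) (residual z))"
    unfolding sample_law_def using int assms(1)[unfolded Z_measurable_iff]
    by (subst integrable_distr_eq[OF sample_map_measurable]) (auto simp: case_prod_unfold residual_def)
  have "(\<integral>z. g (fst z) (residual z) \<partial>Z) = (\<integral>p. g (fst p) (snd p) \<partial>(measure_pmf Dx \<Otimes>\<^sub>M \<E>))"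
    unfolding sample_law_def using assms(1)[unfolded Z_measurable_iff]
    by (subst integral_distr[OF sample_map_measurable]) (auto simp: case_prod_unfold residual_def)
  also have "\<dots> = measure_pmf.expectation Dx (\<lambda>z. \<integral>e. g z e \<partial>\<E>)"
    using pair.integral_fst'[OF int] by simp
  finally show "(\<integral>z. g (fst z) (residual z) \<partial>Z) = measure_pmf.expectation Dx (\<lambda>z. \<integral>e. g z e \<partial>\<E>)" .
qed

lemma AE_Z: "AE z in Z. fst z \<in> set_pmf Dx \<and> \<bar>residual z\<bar> \<le> 1/2"
proof -
  have "(\<lambda>z. fst z \<in> set_pmf Dx) \<in> measurable Z (count_space UNIV)"
    by (rule measurable_compose[OF fst_Z_measurable]) simp
  then have "{z \<in> space Z. fst z \<in> set_pmf Dx \<and> \<bar>residual z\<bar> \<le> 1/2} \<in> sets Z"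
    by measurable
  then have S: "{z. fst z \<in> set_pmf Dx \<and> \<bar>residual z\<bar> \<le> 1/2} \<in> sets (count_space UNIV \<Otimes>\<^sub>M borel)"
    by (simp add: sets_Z)
  have "AE p in measure_pmf Dx \<Otimes>\<^sub>M \<E>. fst p \<in> set_pmf Dx \<and> \<bar>snd p\<bar> \<le> 1/2"
  proof (rule pair.AE_pair_measure)
    have "(\<lambda>p. fst p \<in> set_pmf Dx) \<in> measurable (measure_pmf Dx \<Otimes>\<^sub>M \<E>) (count_space UNIV)"
      by (rule measurable_compose[OF measurable_fst]) simp
    moreover have "snd \<in> borel_measurable (measure_pmf Dx \<Otimes>\<^sub>M \<E>)"
      using measurable_snd[of "measure_pmf Dx" \<E>] by (simp add: measurable_cong_sets[OF refl sets_\<E>])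
    ultimately show "{p \<in> space (measure_pmf Dx \<Otimes>\<^sub>M \<E>). fst p \<in> set_pmf Dx \<and> \<bar>snd p\<bar> \<le> 1/2} \<in> sets (measure_pmf Dx \<Otimes>\<^sub>M \<E>)"
      by measurable
    show "AE z in measure_pmf Dx. AE e in \<E>. fst (z, e) \<in> set_pmf Dx \<and> \<bar>snd (z, e)\<bar> \<le> 1/2"
      unfolding AE_measure_pmf_iff
    proof
      fix z assume "z \<in> set_pmf Dx"
      from AE_\<E> show "AE e in \<E>. fst (z, e) \<in> set_pmf Dx \<and> \<bar>snd (z, e)\<bar> \<le> 1/2"
      proof eventually_elim
        case (elim e)
        then show ?case using \<open>z \<in> set_pmf Dx\<close> by (auto simp: abs_le_iff)
      qed
    qed
  qed
  then show ?thesis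
    unfolding sample_law_def using S
    by (subst AE_distr_iff[OF sample_map_measurable]) (auto simp: case_prod_unfold residual_def space_pair_measure)
qed

lemma integral_Z_covariate: "(\<integral>z. f (fst z) \<partial>Z) = measure_pmf.expectation Dx f" for f :: "bool list \<Rightarrow> real"
proof -
  have "\<bar>f z\<bar> \<le> (\<Sum>z\<in>set_pmf Dx. \<bar>f z\<bar>)" if "z \<in> set_pmf Dx" for z
    using that by (intro member_le_sum) (auto simp: finite_set_Dx)
  then show ?thesis
    by (subst integral_Z(1)[of "\<lambda>z e. f z"]) (auto simp: noise.prob_space)
qed

lemma integral_Z_residual: "(\<integral>z. f (fst z) * residual z \<partial>Z) = 0" for f :: "bool list \<Rightarrow> real"
proof -
  have "\<bar>f z * e\<bar> \<le> (\<Sum>z\<in>set_pmf Dx. \<bar>f z\<bar>)" if "z \<in> set_pmf Dx" "e \<in> {-1/2..1/2}" for z e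
  proof -
    have "\<bar>f z\<bar> \<le> (\<Sum>z\<in>set_pmf Dx. \<bar>f z\<bar>)"
      using that by (intro member_le_sum) (auto simp: finite_set_Dx)
    moreover have "\<bar>e\<bar> \<le> 1" using that by auto
    ultimately have "\<bar>f z\<bar> * \<bar>e\<bar> \<le> (\<Sum>z\<in>set_pmf Dx. \<bar>f z\<bar>) * 1" by (intro mult_mono) auto
    then show ?thesis by (simp add: abs_mult)
  qed
  then show ?thesis
    by (subst integral_Z(1)[of "\<lambda>z e. f z * e"]) (auto simp: mean_\<E>)
qed

lemma integral_Z_residual_sq:
  "(\<integral>z. (f (fst z) * residual z)\<^sup>2 \<partial>Z) = measure_pmf.expectation Dx (\<lambda>z. (f z)\<^sup>2) * noise_var"
  for f :: "bool list \<Rightarrow> real"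
proof -
  have "\<bar>(f z * e)\<^sup>2\<bar> \<le> (\<Sum>z\<in>set_pmf Dx. (f z)\<^sup>2)" if "z \<in> set_pmf Dx" "e \<in> {-1/2..1/2}" for z e
  proof -
    have "(f z)\<^sup>2 \<le> (\<Sum>z\<in>set_pmf Dx. (f z)\<^sup>2)"
      using that by (intro member_le_sum) (auto simp: finite_set_Dx)
    moreover have "e\<^sup>2 \<le> 1" using that by (auto simp: abs_square_le_1)
    ultimately have "(f z)\<^sup>2 * e\<^sup>2 \<le> (\<Sum>z\<in>set_pmf Dx. (f z)\<^sup>2) * 1" by (intro mult_mono) (auto intro: sum_nonneg)
    then show ?thesis by (simp add: power_mult_distrib)
  qed
  then show ?thesis
    by (subst integral_Z(1)[of "\<lambda>z e. (f z * e)\<^sup>2"]) (auto simp: power_mult_distrib noise_var_def)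
qed

section \<open>The law of the training set: moments, independence, exchangeability\<close>

abbreviation data :: "nat \<Rightarrow> (nat \<Rightarrow> sample) measure" where
  "data n \<equiv> data_law Dx \<E> m n"

sublocale product: product_prob_space "\<lambda>_ :: nat. Z" UNIV ..

lemma prob_space_data: "prob_space (data n)"
  unfolding data_law_def by (intro prob_space_PiM prob_space_Z)

lemma samples_measurable_data: "samples_measurable (data n) {..<n} (\<lambda>D. D)"
  unfolding samples_measurable_def data_law_def
  using measurable_component_singleton[of _ "{..<n}" "\<lambda>_. Z"]
  by (simp add: measurable_cong_sets[OF refl sets_Z])

lemma component_measurable:
  assumes "k < n" "f \<in> measurable Z N"
  shows "(\<lambda>D. f (D k)) \<in> measurable (data n) N"
  unfolding data_law_def using assms
  by (intro measurable_compose[OF measurable_component_singleton[of k "{..<n}" "\<lambda>_. Z"] assms(2)]) auto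

lemma distr_component:
  assumes "k < n"
  shows "distr (data n) Z (\<lambda>D. D k) = Z"
  unfolding data_law_def using assms by (intro distr_PiM_component prob_space_Z) auto

lemma integral_component:
  fixes f :: "sample \<Rightarrow> real"
  assumes "k < n" "f \<in> borel_measurable Z"
  shows "(\<integral>D. f (D k) \<partial>data n) = (\<integral>z. f z \<partial>Z)"
  using integral_distr[OF component_measurable[OF assms(1) measurable_ident_sets[OF refl]] assms(2)]
  by (simp add: distr_component[OF assms(1)])

lemma AE_component:
  assumes "AE z in Z. P z" "k < n"
  shows "AE D in data n. P (D k)"
  unfolding data_law_def using assms by (intro AE_PiM_component prob_space_Z) auto

lemma AE_data: "AE D in data n. \<forall>k<n. fst (D k) \<in> set_pmf Dx \<and> \<bar>residual (D k)\<bar> \<le> 1/2"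
proof -
  have "AE D in data n. \<forall>k\<in>{..<n}. fst (D k) \<in> set_pmf Dx \<and> \<bar>residual (D k)\<bar> \<le> 1/2"
    by (intro AE_finite_allI AE_component[OF AE_Z]) auto
  then show ?thesis by eventually_elim blast
qed

lemma integral_product:
  fixes f :: "nat \<Rightarrow> sample \<Rightarrow> 'b :: {real_normed_field, banach, second_countable_topology}"
  assumes "\<And>k. k < n \<Longrightarrow> integrable Z (f k)"
  shows "(\<integral>D. (\<Prod>k<n. f k (D k)) \<partial>data n) = (\<Prod>k<n. \<integral>z. f k z \<partial>Z)"
  unfolding data_law_def by (rule product.product_integral_prod) (use assms in auto)

text \<open>Summands at different indices are independent and centred, so only the diagonal of the
  double sum survives.\<close>

lemma second_moment_sum:
  fixes g :: "sample \<Rightarrow> real"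
  assumes g: "g \<in> borel_measurable Z" "AE z in Z. \<bar>g z\<bar> \<le> c" "(\<integral>z. g z \<partial>Z) = 0"
  shows "(\<integral>D. (\<Sum>k<n. g (D k))\<^sup>2 \<partial>data n) = real n * (\<integral>z. (g z)\<^sup>2 \<partial>Z)"
    and "integrable (data n) (\<lambda>D. (\<Sum>k<n. g (D k))\<^sup>2)"
proof -
  interpret D: prob_space "data n" by (rule prob_space_data)
  have gi: "integrable Z g"
    using g by (intro Z.integrable_const_bound[of g c]) auto
  note gk = component_measurable[OF _ g(1)]
  have bnd: "AE D in data n. \<bar>g (D k)\<bar> \<le> c" if "k < n" for k
    using AE_component[OF g(2) that] by simp
  have int: "integrable (data n) (\<lambda>D. g (D k) * g (D l))" if "k < n" "l < n" for k l
  proof (rule D.integrable_const_bound)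
    show "AE D in data n. norm (g (D k) * g (D l)) \<le> \<bar>c\<bar> * \<bar>c\<bar>"
      using bnd[OF that(1)] bnd[OF that(2)] by eventually_elim (auto simp: abs_mult intro!: mult_mono)
    show "(\<lambda>D. g (D k) * g (D l)) \<in> borel_measurable (data n)"
      using gk that by measurable
  qed
  have cross: "(\<integral>D. g (D k) * g (D l) \<partial>data n) = (if k = l then \<integral>z. (g z)\<^sup>2 \<partial>Z else 0)"
    if "k < n" "l < n" for k l
  proof (cases "k = l")
    case True
    then show ?thesis using integral_component[OF that(1), of "\<lambda>z. (g z)\<^sup>2"] g(1)
      by (simp add: power2_eq_square)
  next
    case False
    \<comment> \<open>The mixed moment is written as a product over all coordinates with factor 1
      away from \<open>k\<close> and \<open>l\<close>, and the product rule exhibits the vanishing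
      factor.\<close>
    define f where "f i = (if i = k \<or> i = l then g else (\<lambda>_. 1))" for i
    have "(\<Prod>i<n. f i (D i)) = g (D k) * g (D l)" for D
    proof -
      have "(\<Prod>i<n. f i (D i)) = (\<Prod>i\<in>{k, l}. f i (D i))"
        using that by (intro prod.mono_neutral_right) (auto simp: f_def)
      then show ?thesis using False by (simp add: f_def)
    qed
    moreover have "(\<integral>D. (\<Prod>i<n. f i (D i)) \<partial>data n) = (\<Prod>i<n. \<integral>z. f i z \<partial>Z)"
      by (rule integral_product) (auto simp: f_def gi)
    moreover have "(\<Prod>i<n. \<integral>z. f i z \<partial>Z) = 0"
      using that g(3) by (auto simp: f_def intro!: bexI[of _ k])
    ultimately show ?thesis using False by simp
  qed
  have sq: "(\<Sum>k<n. g (D k))\<^sup>2 = (\<Sum>k<n. \<Sum>l<n. g (D k) * g (D l))" for D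
    by (simp add: power2_eq_square sum_product)
  show "integrable (data n) (\<lambda>D. (\<Sum>k<n. g (D k))\<^sup>2)"
    unfolding sq by (intro Bochner_Integration.integrable_sum int) auto
  show "(\<integral>D. (\<Sum>k<n. g (D k))\<^sup>2 \<partial>data n) = real n * (\<integral>z. (g z)\<^sup>2 \<partial>Z)"
  proof -
    have "(\<integral>D. (\<Sum>k<n. \<Sum>l<n. g (D k) * g (D l)) \<partial>data n) = (\<Sum>k<n. \<integral>D. (\<Sum>l<n. g (D k) * g (D l)) \<partial>data n)"
      by (intro Bochner_Integration.integral_sum Bochner_Integration.integrable_sum int) auto
    also have "\<dots> = (\<Sum>k<n. \<Sum>l<n. \<integral>D. g (D k) * g (D l) \<partial>data n)"
      by (intro sum.cong refl Bochner_Integration.integral_sum int) auto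
    also have "\<dots> = (\<Sum>k<n. \<Sum>l<n. if k = l then \<integral>z. (g z)\<^sup>2 \<partial>Z else 0)"
      by (intro sum.cong refl cross) auto
    finally show ?thesis unfolding sq by simp
  qed
qed

text \<open>Independence of functions of disjoint blocks of coordinates, by Fubini for the block
  \<open>A\<close> and its complement.\<close>

lemma integral_disjoint_mult:
  fixes f g :: "(nat \<Rightarrow> sample) \<Rightarrow> real"
  assumes f: "integrable (data n) f" and g: "integrable (data n) g"
    and fg: "integrable (data n) (\<lambda>D. f D * g D)"
    and A: "A \<subseteq> {..<n}" "\<And>D D'. (\<And>k. k \<in> A \<Longrightarrow> D k = D' k) \<Longrightarrow> f D = f D'"
    and B: "B \<subseteq> {..<n}" "\<And>D D'. (\<And>k. k \<in> B \<Longrightarrow> D k = D' k) \<Longrightarrow> g D = g D'"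
    and disj: "A \<inter> B = {}"
  shows "(\<integral>D. f D * g D \<partial>data n) = (\<integral>D. f D \<partial>data n) * (\<integral>D. g D \<partial>data n)"
proof -
  define C where "C = {..<n} - A"
  have AC: "A \<inter> C = {}" "A \<union> C = {..<n}" "finite A" "finite C" "B \<subseteq> C"
    using A(1) B(1) disj finite_subset[OF A(1)] by (auto simp: C_def)
  define MA where "MA = Pi\<^sub>M A (\<lambda>_ :: nat. Z)"
  define MC where "MC = Pi\<^sub>M C (\<lambda>_ :: nat. Z)"
  interpret MA: prob_space MA unfolding MA_def by (intro prob_space_PiM prob_space_Z)
  interpret MC: prob_space MC unfolding MC_def by (intro prob_space_PiM prob_space_Z)
  \<comment> \<open>Dummy data for the block that a function does not look at; with it the integrand
    becomes a product of a function of \<open>x\<close> and a function of \<open>y\<close>.\<close>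
  define u :: "nat \<Rightarrow> sample" where "u = (\<lambda>_. undefined)"
  have fold: "(\<integral>D. h D \<partial>data n) = (\<integral>x. (\<integral>y. h (merge A C (x, y)) \<partial>MC) \<partial>MA)"
    if "integrable (data n) h" for h :: "(nat \<Rightarrow> sample) \<Rightarrow> real"
    using product.product_integral_fold[of A C h] AC that by (simp add: data_law_def MA_def MC_def)
  have fA: "f (merge A C (x, y)) = f (merge A C (x, u))" for x y
    by (rule A(2)) (auto simp: merge_def)
  have gC: "g (merge A C (x, y)) = g (merge A C (u, y))" for x y
    using AC by (intro B(2)) (auto simp: merge_def)
  have "(\<integral>D. f D * g D \<partial>data n) =
      (\<integral>x. (\<integral>y. f (merge A C (x, u)) * g (merge A C (u, y)) \<partial>MC) \<partial>MA)"
    unfolding fold[OF fg] by (subst fA, subst gC) rule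
  also have "\<dots> = (\<integral>x. f (merge A C (x, u)) \<partial>MA) * (\<integral>y. g (merge A C (u, y)) \<partial>MC)"
    by simp
  also have "(\<integral>x. f (merge A C (x, u)) \<partial>MA) = (\<integral>D. f D \<partial>data n)"
    unfolding fold[OF f] by (subst (2) fA) (simp add: MC.prob_space)
  also have "(\<integral>y. g (merge A C (u, y)) \<partial>MC) = (\<integral>D. g D \<partial>data n)"
    unfolding fold[OF g] by (subst (2) gC) (simp add: MA.prob_space)
  finally show ?thesis .
qed

lemma data_permutes:
  assumes "\<pi> permutes {..<n}"
  shows "distr (data n) (data n) (\<lambda>D. D \<circ> \<pi>) = data n"
    and "(\<lambda>D. D \<circ> \<pi>) \<in> measurable (data n) (data n)"
proof -
  have \<pi>: "inj_on \<pi> {..<n}" "\<pi> \<in> {..<n} \<rightarrow> {..<n}"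
    using permutes_inj_on[OF assms] permutes_in_image[OF assms] by auto
  \<comment> \<open>Outside \<open>{..<n}\<close> a data set takes the default value of the product
    space and \<open>\<pi>\<close> is the identity, so the two functions agree there as
    well.\<close>
  have eq: "(\<lambda>k\<in>{..<n}. D (\<pi> k)) = D \<circ> \<pi>" if "D \<in> space (data n)" for D
  proof
    fix k show "(\<lambda>k\<in>{..<n}. D (\<pi> k)) k = (D \<circ> \<pi>) k"
      using that permutes_not_in[OF assms, of k]
      by (cases "k < n") (auto simp: data_law_def space_PiM PiE_def extensional_def)
  qed
  have "distr (data n) (data n) (\<lambda>D. \<lambda>k\<in>{..<n}. D (\<pi> k)) = data n"
    unfolding data_law_def by (rule product.distr_reorder[of \<pi> "{..<n}" "{..<n}", OF \<pi>]) simp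
  also have "distr (data n) (data n) (\<lambda>D. \<lambda>k\<in>{..<n}. D (\<pi> k)) = distr (data n) (data n) (\<lambda>D. D \<circ> \<pi>)"
    by (intro distr_cong refl eq)
  finally show "distr (data n) (data n) (\<lambda>D. D \<circ> \<pi>) = data n" .
  have "(\<lambda>D. \<lambda>k\<in>{..<n}. D (\<pi> k)) \<in> measurable (data n) (data n)"
    unfolding data_law_def using \<pi>(2) by (intro measurable_restrict measurable_component_singleton) auto
  then show "(\<lambda>D. D \<circ> \<pi>) \<in> measurable (data n) (data n)"
    by (subst measurable_cong[OF eq[symmetric]])
qed

lemma integral_data_permutes:
  fixes f :: "(nat \<Rightarrow> sample) \<Rightarrow> real"
  assumes "\<pi> permutes {..<n}" "f \<in> borel_measurable (data n)"
  shows "(\<integral>D. f (D \<circ> \<pi>) \<partial>data n) = (\<integral>D. f D \<partial>data n)"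
  using integral_distr[OF data_permutes(2)[OF assms(1)] assms(2)] by (simp add: data_permutes(1)[OF assms(1)])

text \<open>For \<open>N\<close> terms with values in an interval of length 2, Hoeffding's exponent
  \<open>2 * (\<delta> * N)\<^sup>2 / (4 * N)\<close> is
  \<open>\<delta>\<^sup>2 * N / 2\<close>.\<close>

lemma hoeffding_component:
  fixes g :: "sample \<Rightarrow> real"
  assumes g: "g \<in> borel_measurable Z" "AE z in Z. \<bar>g z\<bar> \<le> 1"
    and K: "K \<subseteq> {..<n}" "K \<noteq> {}" and \<delta>: "0 \<le> \<delta>"
  shows "measure (data n) {D\<in>space (data n). \<delta> * real (card K) \<le> \<bar>(\<Sum>k\<in>K. g (D k)) - real (card K) * (\<integral>z. g z \<partial>Z)\<bar>}
    \<le> 2 * exp (- \<delta>\<^sup>2 * real (card K) / 2)"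
proof -
  interpret D: prob_space "data n" by (rule prob_space_data)
  have fin: "finite K" and N: "0 < real (card K)"
    using finite_subset[OF K(1)] K(2) by (auto simp: card_gt_0_iff)
  have "D.indep_vars (\<lambda>_. Z) (\<lambda>k D. D k) {..<n}"
  proof (cases "n = 0")
    case False
    have "distr (data n) (Pi\<^sub>M {..<n} (\<lambda>_. Z)) (\<lambda>D. \<lambda>k\<in>{..<n}. D k) = distr (data n) (data n) (\<lambda>D. D)"
      by (intro distr_cong) (auto simp: data_law_def space_PiM PiE_def extensional_def fun_eq_iff)
    also have "\<dots> = data n" by (simp add: distr_id2)
    also have "data n = Pi\<^sub>M {..<n} (\<lambda>k. distr (data n) Z (\<lambda>D. D k))"
      using distr_component[of _ n] by (subst data_law_def, intro PiM_cong) auto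
    finally have eq: "distr (data n) (Pi\<^sub>M {..<n} (\<lambda>_. Z)) (\<lambda>D. \<lambda>k\<in>{..<n}. D k) =
      Pi\<^sub>M {..<n} (\<lambda>k. distr (data n) Z (\<lambda>D. D k))" .
    have "{..<n} \<noteq> {}" using False by auto
    moreover have "(\<lambda>D. D k) \<in> measurable (data n) Z" if "k \<in> {..<n}" for k
      using component_measurable[of k n "\<lambda>z. z" Z] that by simp
    ultimately show ?thesis
      by (rule D.indep_vars_iff_distr_eq_PiM'[THEN iffD2, OF _ _ eq])
  qed (use K in auto)
  from D.indep_vars_compose2[OF D.indep_vars_subset[OF this K(1)], of "\<lambda>_. g" "\<lambda>_. borel"] g(1)
  have indep: "D.indep_vars (\<lambda>_. borel) (\<lambda>k D. g (D k)) K" by simp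
  interpret H: Hoeffding_ineq "data n" K "\<lambda>k D. g (D k)" "\<lambda>_. -1" "\<lambda>_. 1" "\<Sum>k\<in>K. D.expectation (\<lambda>D. g (D k))"
  proof unfold_locales
    fix k assume "k \<in> K"
    then have "AE D in data n. \<bar>g (D k)\<bar> \<le> 1" using K by (intro AE_component[OF g(2)]) auto
    then show "AE D in data n. g (D k) \<in> {-1..1}" by eventually_elim (auto simp: abs_le_iff)
  qed (use fin indep in auto)
  have \<mu>: "(\<Sum>k\<in>K. D.expectation (\<lambda>D. g (D k))) = real (card K) * (\<integral>z. g z \<partial>Z)"
    using K(1) by (subst sum.cong[OF refl integral_component[OF _ g(1)]]) auto
  have "measure (data n) {D\<in>space (data n). \<delta> * real (card K) \<le> \<bar>(\<Sum>k\<in>K. g (D k)) - (\<Sum>k\<in>K. D.expectation (\<lambda>D. g (D k)))\<bar>}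
      \<le> 2 * exp (- 2 * (\<delta> * real (card K))\<^sup>2 / (\<Sum>k\<in>K. (1 - (-1))\<^sup>2))"
    by (rule H.Hoeffding_ineq_abs_ge) (use N \<delta> fin K(2) in auto)
  also have "- 2 * (\<delta> * real (card K))\<^sup>2 / (\<Sum>k\<in>K. (1 - (-1))\<^sup>2) = - \<delta>\<^sup>2 * real (card K) / 2"
    using N by (simp add: power2_eq_square field_simps)
  finally show ?thesis unfolding \<mu> .
qed

end

section \<open>The noise as a sum of independent terms\<close>

text \<open>Takes the place of the Cauchy-Schwarz inequality: means of products are reduced to
  second moments, with \<open>t\<close> chosen to balance the two terms.\<close>

lemma abs_mult_le_AMGM:
  fixes a b t :: real
  assumes "0 < t"
  shows "\<bar>a\<bar> * \<bar>b\<bar> \<le> (t * a\<^sup>2 + b\<^sup>2 / t) / 2"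
proof -
  have "0 \<le> (t * \<bar>a\<bar> - \<bar>b\<bar>)\<^sup>2 / t" using assms by simp
  also have "\<dots> = t * a\<^sup>2 + b\<^sup>2 / t - 2 * (\<bar>a\<bar> * \<bar>b\<bar>)"
    using assms by (simp add: power2_eq_square field_simps)
  finally show ?thesis by simp
qed

lemma sum_filter_of_bool:
  fixes f :: "nat \<Rightarrow> real"
  shows "(\<Sum>k | k < n \<and> Q k. f k) = (\<Sum>k<n. of_bool (Q k) * f k)"
proof -
  have "(\<Sum>k | k < n \<and> Q k. f k) = (\<Sum>k\<in>{k \<in> {..<n}. Q k}. f k)"
    by (intro sum.cong) auto
  also have "\<dots> = (\<Sum>k<n. if Q k then f k else 0)" by (rule sum.inter_filter) simp
  finally show ?thesis by (simp add: of_bool_def if_distrib[of "\<lambda>c. c * _"] cong: if_cong)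
qed

text \<open>Pointwise comparison for one class: \<open>T\<close> is its weighted noise,
  \<open>E\<close> its plain noise, \<open>N\<close> its size, \<open>A\<close> its weight, and
  \<open>p\<close>, \<open>\<pi>\<close> stand for the means of \<open>A\<close> and
  \<open>N / n\<close>. If \<open>N\<close> is at least half of \<open>n * \<pi>\<close>, the
  quotient \<open>n / N\<close> is bounded and the error is linear in the deviations; otherwise the
  quadratic term pays for everything.\<close>

lemma class_error_bound:
  fixes A E N T \<pi> n p s :: real
  assumes \<pi>: "0 < \<pi>" "\<pi> \<le> 1" and n: "0 < n" and N: "0 \<le> N" "N \<le> n" and p: "0 \<le> p" "p \<le> 1"
    and T: "\<bar>T\<bar> \<le> 1/2" "0 < N \<Longrightarrow> \<bar>T - A / N * E\<bar> \<le> s / N" and E: "\<bar>E\<bar> \<le> N / 2" and s: "0 \<le> s"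
  shows "\<bar>T - p / (n * \<pi>) * E\<bar> \<le> 2 * s / (n * \<pi>)
    + (2 / \<pi> * (\<bar>A - p\<bar> * \<bar>E\<bar>) + 2 / \<pi>\<^sup>2 * (\<bar>N / n - \<pi>\<bar> * \<bar>E\<bar>)) / n + 4 / \<pi>^3 * (N / n - \<pi>)\<^sup>2"
proof (cases "n * \<pi> / 2 \<le> N")
  case True
  have N0: "0 < N" using True n \<pi> by (smt (verit) divide_pos_pos mult_pos_pos)
  have nN: "n / N \<le> 2 / \<pi>" using True N0 \<pi> by (simp add: field_simps)
  have "s / N = s / n * (n / N)" using n by simp
  also have "\<dots> \<le> s / n * (2 / \<pi>)" using nN s n by (intro mult_left_mono) auto
  finally have 1: "s / N \<le> 2 * s / (n * \<pi>)" by (simp add: field_simps)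
  \<comment> \<open>The difference of \<open>A * n / N\<close> and \<open>p / \<pi>\<close> is
    telescoped through \<open>p * n / N\<close>.\<close>
  have "A / N * E - p / (n * \<pi>) * E = ((A - p) * (n / N) + p * (n / N) * (1 / \<pi>) * (\<pi> - N / n)) * E / n"
    using n N0 \<pi> by (simp add: field_simps)
  also have "\<bar>\<dots>\<bar> = \<bar>(A - p) * (n / N) + p * (n / N) * (1 / \<pi>) * (\<pi> - N / n)\<bar> * \<bar>E\<bar> / n"
    using n by (simp add: abs_mult)
  also have "\<dots> \<le> (\<bar>A - p\<bar> * (2 / \<pi>) + 2 / \<pi>\<^sup>2 * \<bar>N / n - \<pi>\<bar>) * \<bar>E\<bar> / n"
  proof (intro divide_right_mono mult_right_mono)
    have "\<bar>(A - p) * (n / N)\<bar> = \<bar>A - p\<bar> * (n / N)" using n N0 by (simp add: abs_mult)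
    also have "\<dots> \<le> \<bar>A - p\<bar> * (2 / \<pi>)" using nN by (intro mult_left_mono) auto
    finally have "\<bar>(A - p) * (n / N)\<bar> \<le> \<bar>A - p\<bar> * (2 / \<pi>)" .
    moreover have "\<bar>p * (n / N) * (1 / \<pi>) * (\<pi> - N / n)\<bar> \<le> 2 / \<pi>\<^sup>2 * \<bar>N / n - \<pi>\<bar>"
    proof -
      have "\<bar>p * (n / N) * (1 / \<pi>) * (\<pi> - N / n)\<bar> = p * (n / N) * (1 / \<pi>) * \<bar>N / n - \<pi>\<bar>"
        using p n N0 \<pi> by (simp add: abs_mult abs_minus_commute)
      also have "\<dots> \<le> 1 * (2 / \<pi>) * (1 / \<pi>) * \<bar>N / n - \<pi>\<bar>"
        using p nN n N0 \<pi> by (intro mult_right_mono mult_mono) auto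
      finally show ?thesis by (simp add: power2_eq_square)
    qed
    ultimately show "\<bar>(A - p) * (n / N) + p * (n / N) * (1 / \<pi>) * (\<pi> - N / n)\<bar>
        \<le> \<bar>A - p\<bar> * (2 / \<pi>) + 2 / \<pi>\<^sup>2 * \<bar>N / n - \<pi>\<bar>"
      by (rule order_trans[OF abs_triangle_ineq add_mono])
  qed (use n in auto)
  also have "\<dots> = (2 / \<pi> * (\<bar>A - p\<bar> * \<bar>E\<bar>) + 2 / \<pi>\<^sup>2 * (\<bar>N / n - \<pi>\<bar> * \<bar>E\<bar>)) / n"
    by (simp add: algebra_simps)
  finally have 2: "\<bar>A / N * E - p / (n * \<pi>) * E\<bar> \<le> \<dots>" .
  have "0 \<le> 4 / \<pi>^3 * (N / n - \<pi>)\<^sup>2" using \<pi> by simp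
  then show ?thesis using 1 2 T(2)[OF N0] by linarith
next
  case False
  then have "\<pi> / 2 \<le> \<bar>N / n - \<pi>\<bar>" using n by (simp add: field_simps abs_if)
  then have "(\<pi> / 2)\<^sup>2 \<le> (N / n - \<pi>)\<^sup>2" using \<pi> by (metis abs_le_square_iff abs_of_pos half_gt_zero)
  \<comment> \<open>The constant is chosen so that the quadratic term is at least
    \<open>4 / \<pi>^3 * (\<pi> / 2)\<^sup>2 = 1 / \<pi>\<close>, which is the crude bound for the
    left-hand side.\<close>
  then have far: "4 / \<pi>^3 * (\<pi> / 2)\<^sup>2 \<le> 4 / \<pi>^3 * (N / n - \<pi>)\<^sup>2" using \<pi> by (intro mult_left_mono) auto
  have "\<bar>p / (n * \<pi>) * E\<bar> = p * (\<bar>E\<bar> / (n * \<pi>))" using p n \<pi> by (simp add: abs_mult)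
  also have "\<dots> \<le> 1 * ((n / 2) / (n * \<pi>))"
    using p E N n \<pi> by (intro mult_mono divide_right_mono) auto
  also have "\<dots> = 1 / (2 * \<pi>)" using n by simp
  finally have pE: "\<bar>p / (n * \<pi>) * E\<bar> \<le> 1 / (2 * \<pi>)" .
  have "1 / 2 \<le> 1 / (2 * \<pi>)" using \<pi> by (simp add: field_simps)
  with T(1) have "\<bar>T\<bar> \<le> 1 / (2 * \<pi>)" by (rule order_trans)
  from add_mono[OF this pE] have "\<bar>T - p / (n * \<pi>) * E\<bar> \<le> 1 / (2 * \<pi>) + 1 / (2 * \<pi>)"
    by (rule order_trans[OF abs_triangle_ineq4])
  also have "\<dots> = 4 / \<pi>^3 * (\<pi> / 2)\<^sup>2"
    using \<pi> by (simp add: power2_eq_square power3_eq_cube field_simps)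
  also note far
  finally have "\<bar>T - p / (n * \<pi>) * E\<bar> \<le> 4 / \<pi>^3 * (N / n - \<pi>)\<^sup>2" .
  moreover have "0 \<le> 2 * s / (n * \<pi>)" using s n \<pi> by simp
  moreover have "0 \<le> (2 / \<pi> * (\<bar>A - p\<bar> * \<bar>E\<bar>) + 2 / \<pi>\<^sup>2 * (\<bar>N / n - \<pi>\<bar> * \<bar>E\<bar>)) / n" using n \<pi> by simp
  ultimately show ?thesis by linarith
qed

context regression
begin

section \<open>The total weight of a covariate class\<close>

definition split_class_weight ::
  "nat \<Rightarrow> bool list \<Rightarrow> bool list \<Rightarrow> (nat \<Rightarrow> sample) \<Rightarrow> nat set \<Rightarrow> nat set \<Rightarrow> real" where
  "split_class_weight L x z D J H = (\<Sum>k\<in>H. of_bool (fst (D k) = z) * grow_weight d L D J H x k)"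

text \<open>\<open>A_z\<close> of the overview; its mean \<open>p_z\<close> is
  \<open>mean_class_weight\<close>.\<close>

definition class_weight :: "nat \<Rightarrow> nat \<Rightarrow> nat \<Rightarrow> bool list \<Rightarrow> bool list \<Rightarrow> (nat \<Rightarrow> sample) \<Rightarrow> real" where
  "class_weight L n s x z D = (\<Sum>k | k < n \<and> fst (D k) = z. forest_weight d L n s D x k)"

definition mean_class_weight :: "nat \<Rightarrow> nat \<Rightarrow> nat \<Rightarrow> bool list \<Rightarrow> bool list \<Rightarrow> real" where
  "mean_class_weight L n s x z = (\<integral>D. class_weight L n s x z D \<partial>data n)"

lemma split_class_weight_bounds:
  assumes "finite H"
  shows "0 \<le> split_class_weight L x z D J H" "split_class_weight L x z D J H \<le> 1"
proof -
  show "0 \<le> split_class_weight L x z D J H"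
    unfolding split_class_weight_def by (intro sum_nonneg) (simp add: grow_weight_nonneg)
  have "split_class_weight L x z D J H \<le> (\<Sum>k\<in>H. grow_weight d L D J H x k)"
    unfolding split_class_weight_def by (intro sum_mono) (simp add: grow_weight_nonneg)
  also have "\<dots> \<le> 1" by (intro sum_grow_weight_le_1 d_pos assms) simp
  finally show "split_class_weight L x z D J H \<le> 1" .
qed

lemma split_class_weight_cong:
  assumes "\<And>k. k \<in> J \<union> H \<Longrightarrow> D k = D' k"
  shows "split_class_weight L x z D J H = split_class_weight L x z D' J H"
  unfolding split_class_weight_def using assms grow_weight_cong[OF assms, of J H]
  by (intro sum.cong) auto

text \<open>Exhibits the class weight in the manner of a U-statistic, as an average over sub-samples
  of functions that see only the data in the sub-sample, so that covariances can be counted.\<close>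

lemma class_weight_eq_expectation:
  assumes "s \<le> n"
  shows "class_weight L n s x z D =
    measure_pmf.expectation (splits n s) (\<lambda>(J, H). split_class_weight L x z D J H)"
proof -
  have "class_weight L n s x z D = (\<Sum>k | k < n \<and> fst (D k) = z. forest_weight d L n s D x k * 1)"
    by (simp add: class_weight_def)
  also have "\<dots> = measure_pmf.expectation (splits n s)
      (\<lambda>(J, H). \<Sum>k | k < n \<and> fst (D k) = z. grow_weight d L D J H x k * 1)"
    by (rule sum_forest_weight[OF assms])
  also have "\<dots> = measure_pmf.expectation (splits n s) (\<lambda>(J, H). split_class_weight L x z D J H)"
  proof (rule expectation_cong_pmf)
    fix p assume p: "p \<in> set_pmf (splits n s)"
    obtain J H where [simp]: "p = (J, H)" by (cases p)
    note JH = splitsD[OF assms, of J H]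
    have "(\<Sum>k | k < n \<and> fst (D k) = z. grow_weight d L D J H x k) =
        (\<Sum>k\<in>{..<n}. of_bool (fst (D k) = z) * grow_weight d L D J H x k)"
      by (rule sum_filter_of_bool)
    also have "\<dots> = (\<Sum>k\<in>H. of_bool (fst (D k) = z) * grow_weight d L D J H x k)"
      using JH p by (intro sum.mono_neutral_right) (auto simp: grow_weight_outside)
    finally show "(case p of (J, H) \<Rightarrow> \<Sum>k | k < n \<and> fst (D k) = z. grow_weight d L D J H x k * 1) =
       (case p of (J, H) \<Rightarrow> split_class_weight L x z D J H)"
      by (simp add: split_class_weight_def)
  qed
  finally show ?thesis .
qed

lemma split_class_weight_measurable:
  assumes "finite J" "finite H" "J \<union> H \<subseteq> {..<n}"
  shows "(\<lambda>D. split_class_weight L x z D J H) \<in> borel_measurable (data n)"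
proof -
  have "(\<lambda>D. of_bool (fst (D k) = z) :: real) \<in> borel_measurable (data n)" if "k \<in> H" for k
    using component_measurable[of k n "\<lambda>v. of_bool (fst v = z)" borel] covariate_Z_measurable[of "\<lambda>v. of_bool (v = z)"]
      assms that by auto
  then show ?thesis
    unfolding split_class_weight_def using assms
    by (intro borel_measurable_sum borel_measurable_times
        grow_weight_measurable[OF samples_measurable_data d_pos]) auto
qed

lemma class_weight_bounds:
  assumes "s \<le> n"
  shows "0 \<le> class_weight L n s x z D" "class_weight L n s x z D \<le> 1"
proof -
  show "0 \<le> class_weight L n s x z D"
    unfolding class_weight_def by (intro sum_nonneg forest_weight_nonneg)
  have "class_weight L n s x z D \<le> (\<Sum>k<n. forest_weight d L n s D x k)"
    unfolding class_weight_def by (intro sum_mono2) (auto simp: forest_weight_nonneg)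
  also have "\<dots> \<le> 1" by (rule sum_forest_weight_le_1[OF d_pos assms])
  finally show "class_weight L n s x z D \<le> 1" .
qed

lemma class_weight_measurable:
  assumes "s \<le> n"
  shows "(\<lambda>D. class_weight L n s x z D) \<in> borel_measurable (data n)"
  unfolding class_weight_eq_expectation[OF assms] case_prod_unfold
proof (rule finite_kernel_expectation_measurable[OF finite_kernel_splits[OF assms]])
  fix p assume "p \<in> set_pmf (splits n s)"
  then show "(\<lambda>D. split_class_weight L x z D (fst p) (snd p)) \<in> borel_measurable (data n)"
    using splitsD[OF assms, of "fst p" "snd p"] by (intro split_class_weight_measurable) auto
qed

lemma class_weight_integrable:
  assumes "s \<le> n"
  shows "integrable (data n) (class_weight L n s x z)"
proof -
  interpret D: prob_space "data n" by (rule prob_space_data)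
  show ?thesis
    using class_weight_bounds[OF assms] class_weight_measurable[OF assms, of L x z]
    by (intro D.integrable_const_bound[of _ 1]) auto
qed

lemma mean_class_weight_bounds:
  assumes "s \<le> n"
  shows "0 \<le> mean_class_weight L n s x z" "mean_class_weight L n s x z \<le> 1"
proof -
  interpret D: prob_space "data n" by (rule prob_space_data)
  show "0 \<le> mean_class_weight L n s x z"
    unfolding mean_class_weight_def by (intro integral_nonneg_AE) (simp add: class_weight_bounds[OF assms])
  have "mean_class_weight L n s x z \<le> (\<integral>D. 1 \<partial>data n)"
    unfolding mean_class_weight_def
    by (intro integral_mono class_weight_integrable assms) (auto simp: class_weight_bounds[OF assms])
  then show "mean_class_weight L n s x z \<le> 1" by (simp add: D.prob_space)
qed

text \<open>
  The class weight is an average over sub-samples of functions of the data in the sub-sample;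
  two independent sub-samples are disjoint up to probability \<open>s\<^sup>2/n\<close>, and then their functions
  are independent.
\<close>
lemma class_weight_variance:
  assumes s: "s \<le> n" and n: "0 < n"
  shows "(\<integral>D. (class_weight L n s x z D - mean_class_weight L n s x z)\<^sup>2 \<partial>data n) \<le> (real s)\<^sup>2 / real n"
    and "integrable (data n) (\<lambda>D. (class_weight L n s x z D - mean_class_weight L n s x z)\<^sup>2)"
proof -
  interpret D: prob_space "data n" by (rule prob_space_data)
  define Sp where "Sp = set_pmf (splits n s)"
  have fin: "finite Sp" using finite_set_pmf_splits[OF s] by (simp add: Sp_def)
  define q where "q = pmf (splits n s)"
  define \<rho> where "\<rho> i D = split_class_weight L x z D (fst i) (snd i)" for i D
  define r where "r i D = \<rho> i D - (\<integral>D. \<rho> i D \<partial>data n)" for i D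
  define I where "I i = fst i \<union> snd i" for i :: "nat set \<times> nat set"
  have E: "measure_pmf.expectation (splits n s) f = (\<Sum>i\<in>Sp. q i * f i)" for f :: "_ \<Rightarrow> real"
    by (subst integral_measure_pmf[OF fin]) (auto simp: Sp_def q_def)
  have q0: "0 \<le> q i" for i by (simp add: q_def)
  have Sp: "finite (fst i)" "finite (snd i)" "I i \<subseteq> {..<n}" if "i \<in> Sp" for i
    using splitsD[OF s, of "fst i" "snd i"] that by (auto simp: Sp_def I_def)
  have \<rho>m: "\<rho> i \<in> borel_measurable (data n)" if "i \<in> Sp" for i
    using split_class_weight_measurable[of "fst i" "snd i" n L x z] Sp[OF that] by (simp add: \<rho>_def[abs_def] I_def)
  have \<rho>b: "0 \<le> \<rho> i D" "\<rho> i D \<le> 1" if "i \<in> Sp" for i D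
    using split_class_weight_bounds[of "snd i"] Sp[OF that] by (auto simp: \<rho>_def)
  have \<rho>i: "integrable (data n) (\<rho> i)" if "i \<in> Sp" for i
    using \<rho>b[OF that] \<rho>m[OF that] by (intro D.integrable_const_bound[of _ 1]) auto
  have rm: "r i \<in> borel_measurable (data n)" if "i \<in> Sp" for i
    using \<rho>m[OF that] by (simp add: r_def[abs_def])
  have rb: "\<bar>r i D\<bar> \<le> 1" if i: "i \<in> Sp" for i D
  proof -
    have "0 \<le> (\<integral>D. \<rho> i D \<partial>data n)" by (intro integral_nonneg_AE) (simp add: \<rho>b[OF i])
    moreover have "(\<integral>D. \<rho> i D \<partial>data n) \<le> (\<integral>D. 1 \<partial>data n)"
      by (intro integral_mono \<rho>i i) (auto simp: \<rho>b[OF i])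
    ultimately show ?thesis using \<rho>b[OF i, of D] by (auto simp: r_def D.prob_space abs_le_iff)
  qed
  have ri: "integrable (data n) (r i)" if "i \<in> Sp" for i
    using rb[OF that] rm[OF that] by (intro D.integrable_const_bound[of _ 1]) auto
  have rij: "integrable (data n) (\<lambda>D. r i D * r j D)" if "i \<in> Sp" "j \<in> Sp" for i j
  proof (rule D.integrable_const_bound[of _ 1])
    show "AE D in data n. norm (r i D * r j D) \<le> 1"
      using mult_mono[OF rb[OF that(1)] rb[OF that(2)]] by (simp add: abs_mult)
  qed (use rm that in auto)
  have mean0: "(\<integral>D. r i D \<partial>data n) = 0" if "i \<in> Sp" for i
    unfolding r_def using \<rho>i[OF that] by (simp add: D.prob_space)
  \<comment> \<open>A covariance vanishes for disjoint sub-samples and is at most 1 otherwise, hence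
    at most the number of common indices in both cases. Unlike the indicator of a non-empty
    intersection, this number is a sum over \<open>k\<close> of products.\<close>
  have cov: "(\<integral>D. r i D * r j D \<partial>data n) \<le> (\<Sum>k<n. of_bool (k \<in> I i) * of_bool (k \<in> I j))"
    if ij: "i \<in> Sp" "j \<in> Sp" for i j
  proof (cases "I i \<inter> I j = {}")
    case True
    have cong: "r i D = r i D'" if "\<And>k. k \<in> I i \<Longrightarrow> D k = D' k" for i D D'
      using split_class_weight_cong[of "fst i" "snd i" D D'] that by (simp add: r_def \<rho>_def I_def)
    have "(\<integral>D. r i D * r j D \<partial>data n) = (\<integral>D. r i D \<partial>data n) * (\<integral>D. r j D \<partial>data n)"
      using True ij Sp by (intro integral_disjoint_mult[where A = "I i" and B = "I j"] ri rij cong) auto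
    then show ?thesis using mean0 ij by (auto intro!: sum_nonneg)
  next
    case False
    then obtain k where k: "k \<in> I i" "k \<in> I j" by blast
    then have "k < n" using Sp(3)[OF ij(1)] by auto
    have "(\<integral>D. r i D * r j D \<partial>data n) \<le> (\<integral>D. 1 \<partial>data n)"
    proof (intro integral_mono rij ij)
      show "r i D * r j D \<le> 1" for D
        using mult_mono[OF rb[OF ij(1), of D] rb[OF ij(2), of D]] abs_ge_self[of "r i D * r j D"] by (simp add: abs_mult)
    qed simp
    also have "\<dots> = of_bool (k \<in> I i) * of_bool (k \<in> I j)" using k by (simp add: D.prob_space)
    also have "\<dots> \<le> (\<Sum>k<n. of_bool (k \<in> I i) * of_bool (k \<in> I j))"
      using \<open>k < n\<close> by (intro member_le_sum) auto
    finally show ?thesis .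
  qed
  have cw: "class_weight L n s x z D = (\<Sum>i\<in>Sp. q i * \<rho> i D)" for D
    unfolding class_weight_eq_expectation[OF s] E by (simp add: case_prod_unfold \<rho>_def)
  have "mean_class_weight L n s x z = (\<Sum>i\<in>Sp. q i * (\<integral>D. \<rho> i D \<partial>data n))"
    unfolding mean_class_weight_def cw using \<rho>i by (subst Bochner_Integration.integral_sum) auto
  then have dev: "class_weight L n s x z D - mean_class_weight L n s x z = (\<Sum>i\<in>Sp. q i * r i D)" for D
    by (simp add: cw r_def sum_subtractf algebra_simps)
  have sq: "(class_weight L n s x z D - mean_class_weight L n s x z)\<^sup>2 =
      (\<Sum>i\<in>Sp. \<Sum>j\<in>Sp. (q i * q j) * (r i D * r j D))" for D
    unfolding dev power2_eq_square sum_product by (intro sum.cong refl) simp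
  show "integrable (data n) (\<lambda>D. (class_weight L n s x z D - mean_class_weight L n s x z)\<^sup>2)"
    unfolding sq by (intro Bochner_Integration.integrable_sum integrable_mult_right rij)
  have "(\<integral>D. (class_weight L n s x z D - mean_class_weight L n s x z)\<^sup>2 \<partial>data n) =
      (\<Sum>i\<in>Sp. \<integral>D. (\<Sum>j\<in>Sp. (q i * q j) * (r i D * r j D)) \<partial>data n)"
    unfolding sq by (intro Bochner_Integration.integral_sum Bochner_Integration.integrable_sum integrable_mult_right rij)
  also have "\<dots> = (\<Sum>i\<in>Sp. \<Sum>j\<in>Sp. \<integral>D. (q i * q j) * (r i D * r j D) \<partial>data n)"
    by (intro sum.cong refl Bochner_Integration.integral_sum integrable_mult_right rij)
  also have "\<dots> = (\<Sum>i\<in>Sp. \<Sum>j\<in>Sp. (q i * q j) * (\<integral>D. r i D * r j D \<partial>data n))"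
    by simp
  also have "\<dots> \<le> (\<Sum>i\<in>Sp. \<Sum>j\<in>Sp. (q i * q j) * (\<Sum>k<n. of_bool (k \<in> I i) * of_bool (k \<in> I j)))"
    using q0 cov by (intro sum_mono mult_left_mono) auto
  \<comment> \<open>The mean number of indices common to two independent sub-samples is the sum over
    \<open>k\<close> of squared inclusion probabilities, \<open>n * (s / n)\<^sup>2\<close>.\<close>
  also have "\<dots> = (\<Sum>k<n. \<Sum>i\<in>Sp. \<Sum>j\<in>Sp. (q i * of_bool (k \<in> I i)) * (q j * of_bool (k \<in> I j)))"
    by (simp only: sum_distrib_left sum.swap[where A = Sp and B = "{..<n}"]) (simp add: mult_ac)
  also have "\<dots> = (\<Sum>k<n. (\<Sum>i\<in>Sp. q i * of_bool (k \<in> I i))\<^sup>2)"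
    by (simp add: power2_eq_square sum_product)
  also have "\<dots> = (\<Sum>k<n. (real s / real n)\<^sup>2)"
    using splits_inclusion_prob[OF s] by (intro sum.cong refl) (simp add: E case_prod_unfold I_def)
  also have "\<dots> = (real s)\<^sup>2 / real n" using n by (simp add: power2_eq_square)
  finally show "(\<integral>D. (class_weight L n s x z D - mean_class_weight L n s x z)\<^sup>2 \<partial>data n) \<le> (real s)\<^sup>2 / real n" .
qed

text \<open>Within a class the weights may be averaged, the class weight is close to its mean, and
  the class size is close to \<open>n * pmf Dx z\<close>. Each of the three replacements costs at
  most order \<open>s / n\<close> in mean, which is \<open>o(1 / sqrt n)\<close> for
  \<open>s = o(sqrt n)\<close>.\<close>

lemma noise_class_approx:
  fixes L n s :: nat and x z :: "bool list"
  assumes s: "0 < s" "s \<le> n" and z: "z \<in> set_pmf Dx"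
  defines "T \<equiv> \<lambda>D. \<Sum>k | k < n \<and> fst (D k) = z. forest_weight d L n s D x k * residual (D k)"
    and "E \<equiv> \<lambda>D. \<Sum>k | k < n \<and> fst (D k) = z. residual (D k)"
  shows "(\<integral>D. \<bar>T D - mean_class_weight L n s x z / (real n * pmf Dx z) * E D\<bar> \<partial>data n) \<le>
      10 / (pmf Dx z)^3 * (real s / real n)" (is "?int \<le> _")
    and "integrable (data n) (\<lambda>D. \<bar>T D - mean_class_weight L n s x z / (real n * pmf Dx z) * E D\<bar>)" (is ?integrable)
proof -
  interpret D: prob_space "data n" by (rule prob_space_data)
  define \<pi> where "\<pi> = pmf Dx z"
  define p where "p = mean_class_weight L n s x z"
  define A where "A = class_weight L n s x z"
  define N where "N D = real (card {k. k < n \<and> fst (D k) = z})" for D :: "nat \<Rightarrow> sample"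
  have \<pi>: "0 < \<pi>" "\<pi> \<le> 1" using z by (auto simp: \<pi>_def pmf_le_1 pmf_positive)
  have n: "0 < real n" using s by simp
  have sum_of_bool: "(\<Sum>k | k < n \<and> fst (D k) = z. f k) = (\<Sum>k<n. of_bool (fst (D k) = z) * f k)"
    for f :: "nat \<Rightarrow> real" and D :: "nat \<Rightarrow> sample"
    by (rule sum_filter_of_bool)
  have ind_meas: "(\<lambda>v. of_bool (fst v = z) :: real) \<in> borel_measurable Z"
    by (rule covariate_Z_measurable)
  have E_eq: "E D = (\<Sum>k<n. of_bool (fst (D k) = z) * residual (D k))" for D
    unfolding E_def by (rule sum_of_bool)
  have N_eq: "N D / real n - \<pi> = (\<Sum>k<n. of_bool (fst (D k) = z) - \<pi>) / real n" for D
    using sum_of_bool[of "\<lambda>_. 1" D] n by (simp add: N_def sum_subtractf diff_divide_distrib)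
  have "measure_pmf.expectation Dx (\<lambda>v. of_bool (v = z) :: real) = \<pi>"
    unfolding \<pi>_def by (subst integral_measure_pmf_real[of "{z}"]) auto
  then have mean_N: "(\<integral>v. of_bool (fst v = z) - \<pi> \<partial>Z) = 0"
    using integral_Z_covariate[of "\<lambda>v. of_bool (v = z) - \<pi>"] finite_set_Dx
    by (simp add: integrable_measure_pmf_finite)
  have sq_le: "(\<integral>v. (g v)\<^sup>2 \<partial>Z) \<le> 1" if "g \<in> borel_measurable Z" "AE v in Z. \<bar>g v\<bar> \<le> 1" for g :: "sample \<Rightarrow> real"
  proof -
    have "AE v in Z. \<bar>(g v)\<^sup>2\<bar> \<le> 1" using that(2) by eventually_elim (simp add: abs_square_le_1)
    then show ?thesis using Z.integral_le_of_AE(2)[of "\<lambda>v. (g v)\<^sup>2" "\<lambda>_. 1"] that(1)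
      Z.prob_space by simp
  qed
  have bE: "AE v in Z. \<bar>of_bool (fst v = z) * residual v\<bar> \<le> 1"
    using AE_Z by eventually_elim auto
  have bN: "AE v in Z. \<bar>of_bool (fst v = z) - \<pi>\<bar> \<le> 1"
    using \<pi> by (intro AE_I2) auto
  have mE: "(\<lambda>v. of_bool (fst v = z) * residual v) \<in> borel_measurable Z"
    using ind_meas by measurable
  have mN: "(\<lambda>v. of_bool (fst v = z) - \<pi>) \<in> borel_measurable Z"
    using ind_meas by measurable
  note E2 = second_moment_sum[OF mE bE integral_Z_residual[of "\<lambda>v. of_bool (v = z)"], of n]
  note N2 = second_moment_sum[OF mN bN mean_N, of n]
  have E2_le: "(\<integral>D. (E D)\<^sup>2 \<partial>data n) \<le> real n"
    unfolding E_eq E2(1) using sq_le[OF mE bE] by (simp add: mult_left_le)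
  have E2_int: "integrable (data n) (\<lambda>D. (E D)\<^sup>2)" unfolding E_eq by (rule E2(2))
  have N2_le: "(\<integral>D. (N D / real n - \<pi>)\<^sup>2 \<partial>data n) \<le> 1 / real n"
    unfolding N_eq power_divide using N2(1) sq_le[OF mN bN] n by (simp add: power2_eq_square divide_right_mono)
  have N2_int: "integrable (data n) (\<lambda>D. (N D / real n - \<pi>)\<^sup>2)"
    unfolding N_eq power_divide using N2(2) by simp
  have A2_le: "(\<integral>D. (A D - p)\<^sup>2 \<partial>data n) \<le> (real s)\<^sup>2 / real n"
    and A2_int: "integrable (data n) (\<lambda>D. (A D - p)\<^sup>2)"
    using class_weight_variance[OF s(2), of L x z] n by (auto simp: A_def p_def)
  have p: "0 \<le> p" "p \<le> 1" using mean_class_weight_bounds[OF s(2)] by (auto simp: p_def)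
  \<comment> \<open>The weights in the AM-GM inequality balance second moments: \<open>n / s\<close>
    makes both \<open>s\<^sup>2 / n\<close> for \<open>A - p\<close> and \<open>n\<close> for
    \<open>E\<close> into \<open>s\<close>, and \<open>n\<close> makes both \<open>1 / n\<close> for
    the frequency and \<open>n\<close> for \<open>E\<close> into 1.\<close>
  define G where "G D = 2 * real s / (real n * \<pi>)
    + (2 / \<pi> * ((real n / real s * (A D - p)\<^sup>2 + (E D)\<^sup>2 / (real n / real s)) / 2)
      + 2 / \<pi>\<^sup>2 * ((real n * (N D / real n - \<pi>)\<^sup>2 + (E D)\<^sup>2 / real n) / 2)) / real n
    + 4 / \<pi>^3 * (N D / real n - \<pi>)\<^sup>2" for D
  have G_int: "integrable (data n) G"
    unfolding G_def[abs_def]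
    by (intro Bochner_Integration.integrable_add integrable_mult_right integrable_divide D.integrable_const A2_int E2_int N2_int)
  have bound: "AE D in data n. \<bar>\<bar>T D - p / (real n * \<pi>) * E D\<bar>\<bar> \<le> G D"
    using AE_data
  proof eventually_elim
    case (elim D)
    define K where "K = {k. k < n \<and> fst (D k) = z}"
    have finK: "finite K" by (simp add: K_def)
    have res: "\<bar>residual (D k)\<bar> \<le> 1/2" if "k < n" for k using elim that by blast
    have N: "N D = real (card K)" by (simp add: N_def K_def)
    have "card K \<le> card {..<n}" by (intro card_mono) (auto simp: K_def)
    then have "N D \<le> real n" by (simp add: N)
    have "\<bar>T D\<bar> \<le> (\<Sum>k\<in>K. forest_weight d L n s D x k * (1/2))"
      unfolding T_def K_def[symmetric]
    proof (intro sum_abs[THEN order_trans] sum_mono)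
      fix k assume "k \<in> K"
      then show "\<bar>forest_weight d L n s D x k * residual (D k)\<bar> \<le> forest_weight d L n s D x k * (1/2)"
        using mult_left_mono[OF res[of k] forest_weight_nonneg[of d L n s D x k]] forest_weight_nonneg[of d L n s D x k]
        by (simp add: K_def abs_mult)
    qed
    also have "\<dots> = A D * (1/2)" by (simp add: A_def class_weight_def K_def sum_distrib_right)
    also have "\<dots> \<le> 1/2" using class_weight_bounds[OF s(2), of L x z D] by (simp add: A_def)
    finally have T: "\<bar>T D\<bar> \<le> 1/2" .
    have "\<bar>E D\<bar> \<le> (\<Sum>k\<in>K. 1/2)"
      unfolding E_def K_def[symmetric] using res by (intro sum_abs[THEN order_trans] sum_mono) (auto simp: K_def)
    then have E: "\<bar>E D\<bar> \<le> N D / 2" by (simp add: N)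
    have TA: "\<bar>T D - A D / N D * E D\<bar> \<le> real s / N D" if "0 < N D"
    proof -
      have K': "{k \<in> {..<n}. fst (D k) = z} = K" by (auto simp: K_def)
      have "K \<noteq> {}" using that N by auto
      then show ?thesis
        using forest_noise_class_average[OF d_pos s(2), of "\<lambda>k. residual (D k)" D z L x] res
        unfolding K' by (simp add: T_def E_def A_def class_weight_def N K_def)
    qed
    have "\<bar>T D - p / (real n * \<pi>) * E D\<bar> \<le> 2 * real s / (real n * \<pi>)
      + (2 / \<pi> * (\<bar>A D - p\<bar> * \<bar>E D\<bar>) + 2 / \<pi>\<^sup>2 * (\<bar>N D / real n - \<pi>\<bar> * \<bar>E D\<bar>)) / real n
      + 4 / \<pi>^3 * (N D / real n - \<pi>)\<^sup>2"
      by (rule class_error_bound[OF \<pi> n _ \<open>N D \<le> real n\<close> p T TA E]) (auto simp: N)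
    also have "\<dots> \<le> G D"
      unfolding G_def using n s \<pi>
      by (intro add_mono divide_right_mono mult_left_mono abs_mult_le_AMGM order_refl) auto
    finally show ?case by simp
  qed
  have Tm: "T \<in> borel_measurable (data n)"
    unfolding T_def sum_of_bool
    using component_measurable[OF _ ind_meas] component_measurable[OF _ residual_measurable]
      forest_weight_measurable[OF samples_measurable_data d_pos s(2)]
    by (intro borel_measurable_sum borel_measurable_times) auto
  have Em: "E \<in> borel_measurable (data n)"
    unfolding E_def sum_of_bool
    using component_measurable[OF _ ind_meas] component_measurable[OF _ residual_measurable]
    by (intro borel_measurable_sum borel_measurable_times) auto
  have meas: "(\<lambda>D. \<bar>T D - p / (real n * \<pi>) * E D\<bar>) \<in> borel_measurable (data n)"
    using Tm Em by measurable
  show ?integrable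
    using D.integral_le_of_AE(1)[OF meas G_int bound] by (simp add: p_def \<pi>_def)
  have "?int \<le> (\<integral>D. G D \<partial>data n)"
    using D.integral_le_of_AE(2)[OF meas G_int bound] by (simp add: p_def \<pi>_def)
  also have "\<dots> = 2 * real s / (real n * \<pi>)
    + (2 / \<pi> * ((real n / real s * (\<integral>D. (A D - p)\<^sup>2 \<partial>data n) + (\<integral>D. (E D)\<^sup>2 \<partial>data n) / (real n / real s)) / 2)
      + 2 / \<pi>\<^sup>2 * ((real n * (\<integral>D. (N D / real n - \<pi>)\<^sup>2 \<partial>data n) + (\<integral>D. (E D)\<^sup>2 \<partial>data n) / real n) / 2)) / real n
    + 4 / \<pi>^3 * (\<integral>D. (N D / real n - \<pi>)\<^sup>2 \<partial>data n)"
    unfolding G_def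
    by (simp add: A2_int E2_int N2_int D.prob_space del: times_divide_eq_right times_divide_eq_left divide_divide_eq_right)
  also have "\<dots> \<le> 2 * real s / (real n * \<pi>)
    + (2 / \<pi> * ((real n / real s * ((real s)\<^sup>2 / real n) + real n / (real n / real s)) / 2)
      + 2 / \<pi>\<^sup>2 * ((real n * (1 / real n) + real n / real n) / 2)) / real n
    + 4 / \<pi>^3 * (1 / real n)"
    using n s \<pi> A2_le E2_le N2_le
    by (intro add_mono divide_right_mono mult_left_mono order_refl) auto
  also have "\<dots> = (2 * real s / \<pi> + 2 * real s / \<pi> + 2 / \<pi>\<^sup>2 + 4 / \<pi>^3) / real n"
    using n s by (simp add: power2_eq_square field_simps)
  \<comment> \<open>Since \<open>\<pi>\<close> is at most 1 and \<open>s\<close> at least 1, every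
    term is enlarged to a multiple of \<open>s / \<pi>^3\<close>; the coefficients add up to the 10
    of the statement.\<close>
  also have "\<dots> \<le> (2 * real s / \<pi>^3 + 2 * real s / \<pi>^3 + 2 * real s / \<pi>^3 + 4 * real s / \<pi>^3) / real n"
  proof -
    have "\<pi>^3 \<le> \<pi>^1" using \<pi> by (intro power_decreasing) auto
    moreover have "\<pi>^3 \<le> \<pi>\<^sup>2" using \<pi> by (intro power_decreasing) auto
    ultimately have "2 * real s / \<pi> \<le> 2 * real s / \<pi>^3" "2 / \<pi>\<^sup>2 \<le> 2 * real s / \<pi>^3"
      "4 / \<pi>^3 \<le> 4 * real s / \<pi>^3"
      using \<pi> s by (auto intro!: frac_le divide_right_mono)
    then show ?thesis using n s \<pi> by (intro divide_right_mono add_mono) auto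
  qed
  also have "\<dots> = 10 / \<pi>^3 * (real s / real n)" by (simp add: field_simps)
  finally show "?int \<le> 10 / (pmf Dx z)^3 * (real s / real n)" by (simp add: \<pi>_def)
qed

text \<open>The density of the mean class weights relative to \<open>Dx\<close>, that is, the
  coefficient of one residual in the linear term; off the support it is 0 because division by 0
  gives 0.\<close>

definition influence :: "nat \<Rightarrow> nat \<Rightarrow> nat \<Rightarrow> bool list \<Rightarrow> bool list \<Rightarrow> real" where
  "influence L n s x z = mean_class_weight L n s x z / pmf Dx z"

definition linear_part :: "nat \<Rightarrow> nat \<Rightarrow> nat \<Rightarrow> bool list \<Rightarrow> (nat \<Rightarrow> sample) \<Rightarrow> real" where
  "linear_part L n s x D = (\<Sum>k<n. influence L n s x (fst (D k)) * residual (D k)) / real n"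

text \<open>The support of \<open>Dx\<close> is finite, so the bounds for the single classes may be
  added, with a constant that does not depend on \<open>n\<close>, \<open>s\<close> or
  \<open>L\<close>.\<close>

lemma noise_approx:
  assumes s: "0 < s" "s \<le> n"
  shows "(\<integral>D. \<bar>(\<Sum>k<n. forest_weight d L n s D x k * residual (D k)) - linear_part L n s x D\<bar> \<partial>data n)
      \<le> (\<Sum>z\<in>set_pmf Dx. 10 / (pmf Dx z)^3) * (real s / real n)"
    and "integrable (data n) (\<lambda>D. \<bar>(\<Sum>k<n. forest_weight d L n s D x k * residual (D k)) - linear_part L n s x D\<bar>)"
proof -
  interpret D: prob_space "data n" by (rule prob_space_data)
  define \<Delta> where "\<Delta> z D = \<bar>(\<Sum>k | k < n \<and> fst (D k) = z. forest_weight d L n s D x k * residual (D k))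
      - mean_class_weight L n s x z / (real n * pmf Dx z) * (\<Sum>k | k < n \<and> fst (D k) = z. residual (D k))\<bar>" for z D
  note \<Delta> = noise_class_approx[OF s, of _ L x, folded \<Delta>_def]
  have int: "integrable (data n) (\<lambda>D. \<Sum>z\<in>set_pmf Dx. \<Delta> z D)"
    by (intro Bochner_Integration.integrable_sum \<Delta>(2))
  have bound: "AE D in data n. \<bar>\<bar>(\<Sum>k<n. forest_weight d L n s D x k * residual (D k)) - linear_part L n s x D\<bar>\<bar>
      \<le> (\<Sum>z\<in>set_pmf Dx. \<Delta> z D)"
    using AE_data
  proof eventually_elim
    case (elim D)
    have group: "(\<Sum>k<n. f k) = (\<Sum>z\<in>set_pmf Dx. \<Sum>k | k < n \<and> fst (D k) = z. f k)" for f :: "nat \<Rightarrow> real"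
      using elim finite_set_Dx by (subst sum.group[of "{..<n}" "set_pmf Dx" "\<lambda>k. fst (D k)" f, symmetric]) auto
    have "(\<Sum>k | k < n \<and> fst (D k) = z. influence L n s x (fst (D k)) * residual (D k)) / real n =
        mean_class_weight L n s x z / (real n * pmf Dx z) * (\<Sum>k | k < n \<and> fst (D k) = z. residual (D k))" for z
      by (simp add: influence_def sum_distrib_left sum_divide_distrib mult_ac)
    then have "linear_part L n s x D = (\<Sum>z\<in>set_pmf Dx. mean_class_weight L n s x z / (real n * pmf Dx z) *
        (\<Sum>k | k < n \<and> fst (D k) = z. residual (D k)))"
      unfolding linear_part_def group sum_divide_distrib by simp
    then show ?case
      unfolding group \<Delta>_def abs_abs by (simp add: sum_subtractf[symmetric] sum_abs)
  qed
  have "(\<lambda>D. \<Sum>k<n. forest_weight d L n s D x k * residual (D k)) \<in> borel_measurable (data n)"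
    using component_measurable[OF _ residual_measurable]
      forest_weight_measurable[OF samples_measurable_data d_pos s(2)]
    by (intro borel_measurable_sum borel_measurable_times) auto
  moreover have "linear_part L n s x \<in> borel_measurable (data n)"
    unfolding linear_part_def[abs_def]
    using component_measurable[OF _ residual_measurable] component_measurable[OF _ covariate_Z_measurable]
    by (intro borel_measurable_divide borel_measurable_sum borel_measurable_times) auto
  ultimately have meas: "(\<lambda>D. \<bar>(\<Sum>k<n. forest_weight d L n s D x k * residual (D k)) - linear_part L n s x D\<bar>)
      \<in> borel_measurable (data n)"
    by measurable
  show "integrable (data n) (\<lambda>D. \<bar>(\<Sum>k<n. forest_weight d L n s D x k * residual (D k)) - linear_part L n s x D\<bar>)"
    by (rule D.integral_le_of_AE(1)[OF meas int bound])
  have "(\<integral>D. \<bar>(\<Sum>k<n. forest_weight d L n s D x k * residual (D k)) - linear_part L n s x D\<bar> \<partial>data n)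
      \<le> (\<integral>D. (\<Sum>z\<in>set_pmf Dx. \<Delta> z D) \<partial>data n)"
    by (rule D.integral_le_of_AE(2)[OF meas int bound])
  also have "\<dots> = (\<Sum>z\<in>set_pmf Dx. \<integral>D. \<Delta> z D \<partial>data n)"
    by (intro Bochner_Integration.integral_sum \<Delta>(2))
  also have "\<dots> \<le> (\<Sum>z\<in>set_pmf Dx. 10 / (pmf Dx z)^3 * (real s / real n))"
    by (intro sum_mono \<Delta>(1))
  finally show "(\<integral>D. \<bar>(\<Sum>k<n. forest_weight d L n s D x k * residual (D k)) - linear_part L n s x D\<bar> \<partial>data n)
      \<le> (\<Sum>z\<in>set_pmf Dx. 10 / (pmf Dx z)^3) * (real s / real n)"
    unfolding sum_distrib_right .
qed

end

section \<open>Concentration of the split criterion\<close>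

lemma fully_grown_pred:
  assumes X: "samples_measurable M K X" and H: "finite H" "H \<subseteq> K" and P: "P \<subseteq> Pow (cube d)"
  shows "Measurable.pred M (\<lambda>w. fully_grown (X w) (H, P))"
proof -
  \<comment> \<open>The random set of points in a cell is replaced by a quantifier over the finitely
    many subsets \<open>C\<close> of \<open>H\<close>, exactly one of which describes the
    cell.\<close>
  have eq: "(card (points_in (X w) H A) \<in> {2, 3} \<or>
        (\<forall>k\<in>points_in (X w) H A. \<forall>l\<in>points_in (X w) H A. fst (X w k) = fst (X w l))) \<longleftrightarrow>
      (\<exists>C\<in>Pow H. (\<forall>k\<in>H. fst (X w k) \<in> A \<longleftrightarrow> k \<in> C) \<and>
        (card C \<in> {2, 3} \<or> (\<forall>k\<in>C. \<forall>l\<in>C. fst (X w k) = fst (X w l))))" (is "?l = ?r") for w A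
  proof -
    have *: "C = points_in (X w) H A" if "C \<in> Pow H" "\<forall>k\<in>H. fst (X w k) \<in> A \<longleftrightarrow> k \<in> C" for C
      using that by (auto simp: points_in_def)
    show ?thesis
    proof
      assume ?l then show ?r by (intro bexI[of _ "points_in (X w) H A"]) (auto simp: points_in_def)
    next
      assume ?r then show ?l using * by blast
    qed
  qed
  show ?thesis
    unfolding fully_grown.simps eq
  proof (rule pred_intros_finite(3))
    show "finite P" using finite_subset[OF P] by simp
    fix A
    show "Measurable.pred M (\<lambda>w. \<exists>C\<in>Pow H. (\<forall>k\<in>H. (fst (X w k) \<in> A) = (k \<in> C)) \<and>
        (card C \<in> {2, 3} \<or> (\<forall>k\<in>C. \<forall>l\<in>C. fst (X w k) = fst (X w l))))"
    proof (rule pred_intros_finite(4))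
      fix C assume C: "C \<in> Pow H"
      have "finite C" using C H(1) by (auto intro: finite_subset)
      have "Measurable.pred M (\<lambda>w. \<forall>k\<in>C. \<forall>l\<in>C. fst (X w k) = fst (X w l))"
      proof (intro pred_intros_finite(3) \<open>finite C\<close>)
        show "Measurable.pred M (\<lambda>w. fst (X w k) = fst (X w l))" if "k \<in> C" "l \<in> C" for k l
          using that C H by (intro covariate_eq_pred[OF X, of k l "\<lambda>z. z"]) auto
      qed
      moreover have "Measurable.pred M (\<lambda>w. \<forall>k\<in>H. (fst (X w k) \<in> A) = (k \<in> C))"
        using H by (intro pred_intros_finite(3) pred_intros_logic covariate_pred[OF X]) auto
      ultimately show "Measurable.pred M (\<lambda>w. (\<forall>k\<in>H. (fst (X w k) \<in> A) = (k \<in> C)) \<and>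
          (card C \<in> {2, 3} \<or> (\<forall>k\<in>C. \<forall>l\<in>C. fst (X w k) = fst (X w l))))"
        by (intro pred_intros_logic) auto
    qed (use H in auto)
  qed
qed

lemma expectation_random_tree:
  fixes f :: "nat set \<times> bool list set set \<Rightarrow> real"
  assumes "0 < d" "s \<le> n"
  shows "measure_pmf.expectation (random_tree d logt n s D) f =
    measure_pmf.expectation (pmf_of_set {\<pi>. \<pi> permutes {..<n}})
      (\<lambda>\<pi>. measure_pmf.expectation (base_tree d (tree_levels logt) n s (D \<circ> \<pi>)) (\<lambda>(H, P). f (\<pi> ` H, P)))"
  unfolding random_tree_eq_base_tree using permutes_finite_nonempty[of n]
  by (subst expectation_bind_pmf_finite)
     (auto simp: finite_set_pmf_base_tree[OF assms] case_prod_unfold map_pmf_def[symmetric])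

context regression
begin

text \<open>Exchangeability of the data: \<open>D \<circ> \<pi>\<close> has the law of
  \<open>D\<close>, so an average over permutations disappears under the integral.\<close>

lemma average_over_permutations:
  fixes f :: "(nat \<Rightarrow> sample) \<Rightarrow> real"
  assumes "integrable (data n) f"
  shows "(\<integral>D. measure_pmf.expectation (pmf_of_set {\<pi>. \<pi> permutes {..<n}}) (\<lambda>\<pi>. f (D \<circ> \<pi>)) \<partial>data n) = (\<integral>D. f D \<partial>data n)"
    and "integrable (data n) (\<lambda>D. measure_pmf.expectation (pmf_of_set {\<pi>. \<pi> permutes {..<n}}) (\<lambda>\<pi>. f (D \<circ> \<pi>)))"
proof -
  define Q where "Q = {\<pi>. \<pi> permutes {..<n}}"
  note Q = permutes_finite_nonempty[of n, folded Q_def]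
  have int: "integrable (data n) (\<lambda>D. f (D \<circ> \<pi>))" if "\<pi> \<in> Q" for \<pi>
  proof -
    have \<pi>: "\<pi> permutes {..<n}" using that by (simp add: Q_def)
    show ?thesis
      by (rule integrable_distr[OF data_permutes(2)[OF \<pi>]]) (simp add: data_permutes(1)[OF \<pi>] assms)
  qed
  have val: "(\<integral>D. f (D \<circ> \<pi>) \<partial>data n) = (\<integral>D. f D \<partial>data n)" if "\<pi> \<in> Q" for \<pi>
    using that assms by (intro integral_data_permutes) (auto simp: Q_def)
  have E: "measure_pmf.expectation (pmf_of_set Q) (\<lambda>\<pi>. f (D \<circ> \<pi>)) = (\<Sum>\<pi>\<in>Q. f (D \<circ> \<pi>)) / real (card Q)" for D
    by (rule integral_pmf_of_set[OF Q(2,1)])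
  show "integrable (data n) (\<lambda>D. measure_pmf.expectation (pmf_of_set {\<pi>. \<pi> permutes {..<n}}) (\<lambda>\<pi>. f (D \<circ> \<pi>)))"
    unfolding Q_def[symmetric] E by (intro integrable_divide Bochner_Integration.integrable_sum int)
  show "(\<integral>D. measure_pmf.expectation (pmf_of_set {\<pi>. \<pi> permutes {..<n}}) (\<lambda>\<pi>. f (D \<circ> \<pi>)) \<partial>data n) = (\<integral>D. f D \<partial>data n)"
    unfolding Q_def[symmetric] E using int val Q by (simp add: Bochner_Integration.integral_sum)
qed

text \<open>The split criterion as a function of the response mass \<open>u\<close> and the
  probability \<open>f\<close> of each covariate vector. \<open>V_bar\<close> is its value at the
  true quantities and \<open>V_emp\<close> its value at the empirical ones, so concentration reduces
  to continuity at one point.\<close>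

definition level_value :: "nat set \<Rightarrow> (bool list \<Rightarrow> real) \<Rightarrow> (bool list \<Rightarrow> real) \<Rightarrow> real" where
  "level_value S u f = (\<Sum>z\<in>set_pmf Dx. f z *
     ((\<Sum>w | w \<in> set_pmf Dx \<and> nths w S = nths z S. u w) / (\<Sum>w | w \<in> set_pmf Dx \<and> nths w S = nths z S. f w))\<^sup>2)"

lemma V_bar_eq_level_value: "V_bar Dx m S = level_value S (\<lambda>w. pmf Dx w * m w) (pmf Dx)"
proof -
  have "measure_pmf.expectation (cond_pmf Dx {w. nths w S = nths z S}) m =
      (\<Sum>w | w \<in> set_pmf Dx \<and> nths w S = nths z S. pmf Dx w * m w) /
      (\<Sum>w | w \<in> set_pmf Dx \<and> nths w S = nths z S. pmf Dx w)" if z: "z \<in> set_pmf Dx" for z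
  proof -
    define A where "A = {w. nths w S = nths z S}"
    have ne: "set_pmf Dx \<inter> A \<noteq> {}" using z by (auto simp: A_def)
    have B: "{w. w \<in> set_pmf Dx \<and> nths w S = nths z S} = set_pmf Dx \<inter> A" by (auto simp: A_def)
    have fin: "finite (set_pmf Dx \<inter> A)" using finite_set_Dx by simp
    have "measure_pmf.expectation (cond_pmf Dx A) m = (\<Sum>w\<in>set_pmf Dx \<inter> A. m w * pmf (cond_pmf Dx A) w)"
      using ne by (intro integral_measure_pmf_real fin) (simp add: set_cond_pmf)
    also have "\<dots> = (\<Sum>w\<in>set_pmf Dx \<inter> A. pmf Dx w * m w / measure_pmf.prob Dx A)"
      using ne by (intro sum.cong refl) (simp add: pmf_cond)
    also have "measure_pmf.prob Dx A = measure_pmf.prob Dx (A \<inter> set_pmf Dx)"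
      by (simp add: measure_Int_set_pmf)
    also have "\<dots> = (\<Sum>w\<in>set_pmf Dx \<inter> A. pmf Dx w)"
      using fin by (subst measure_measure_pmf_finite) (simp_all add: Int_commute)
    finally show ?thesis unfolding B A_def[symmetric] by (simp add: sum_divide_distrib)
  qed
  then show ?thesis
    unfolding V_bar_def level_value_def
    by (subst integral_measure_pmf_real[OF finite_set_Dx]) (auto intro!: sum.cong)
qed

definition class_freq :: "nat set \<Rightarrow> (nat \<Rightarrow> sample) \<Rightarrow> bool list \<Rightarrow> real" where
  "class_freq K D w = (\<Sum>k\<in>K. of_bool (fst (D k) = w)) / real (card K)"

definition class_response :: "nat set \<Rightarrow> (nat \<Rightarrow> sample) \<Rightarrow> bool list \<Rightarrow> real" where
  "class_response K D w = (\<Sum>k\<in>K. of_bool (fst (D k) = w) * snd (D k)) / real (card K)"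

text \<open>Sums over sample points are regrouped by covariate vector, which must lie in the
  support; the factor \<open>1 / card J\<close> cancels in the mean response.\<close>

lemma V_emp_eq_level_value:
  assumes J: "finite J" "J \<noteq> {}" and D: "\<And>k. k \<in> J \<Longrightarrow> fst (D k) \<in> set_pmf Dx"
  shows "V_emp D J S = level_value S (class_response J D) (class_freq J D)"
proof -
  have N: "real (card J) \<noteq> 0" using J by simp
  define W where "W z = {w. w \<in> set_pmf Dx \<and> nths w S = nths z S}" for z
  have "finite (W z)" for z using finite_set_Dx by (simp add: W_def)
  have sums: "(\<Sum>k | k \<in> J \<and> nths (fst (D k)) S = nths z S. f k) = (\<Sum>w\<in>W z. \<Sum>k\<in>J. of_bool (fst (D k) = w) * f k)"
    for f :: "nat \<Rightarrow> real" and z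
  proof -
    have "(\<Sum>w\<in>W z. \<Sum>k\<in>J. of_bool (fst (D k) = w) * f k) = (\<Sum>k\<in>J. (\<Sum>w\<in>W z. of_bool (fst (D k) = w)) * f k)"
      by (subst sum.swap) (simp add: sum_distrib_right)
    also have "\<dots> = (\<Sum>k\<in>J. of_bool (nths (fst (D k)) S = nths z S) * f k)"
    proof (intro sum.cong refl)
      fix k assume "k \<in> J"
      have "(\<Sum>w\<in>W z. of_bool (fst (D k) = w)) = (of_bool (fst (D k) \<in> W z) :: real)"
        using \<open>finite (W z)\<close> by (simp add: of_bool_def)
      then show "(\<Sum>w\<in>W z. of_bool (fst (D k) = w)) * f k = of_bool (nths (fst (D k)) S = nths z S) * f k"
        using D[OF \<open>k \<in> J\<close>] by (simp add: W_def)
    qed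
    also have "\<dots> = (\<Sum>k\<in>J. if nths (fst (D k)) S = nths z S then f k else 0)"
      by (intro sum.cong) auto
    finally show ?thesis using J(1) by (simp add: sum.inter_filter)
  qed
  have mean: "mean_response D {k\<in>J. nths (fst (D k)) S = nths z S} =
      (\<Sum>w\<in>W z. class_response J D w) / (\<Sum>w\<in>W z. class_freq J D w)" for z
  proof -
    have "mean_response D {k\<in>J. nths (fst (D k)) S = nths z S} =
        (\<Sum>w\<in>W z. \<Sum>k\<in>J. of_bool (fst (D k) = w) * snd (D k)) / (\<Sum>w\<in>W z. \<Sum>k\<in>J. of_bool (fst (D k) = w))"
      unfolding mean_response_def using sums[of "\<lambda>k. snd (D k)" z] sums[of "\<lambda>_. 1" z] by simp
    then show ?thesis
      using N by (simp add: class_response_def class_freq_def sum_divide_distrib[symmetric])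
  qed
  define Mz where "Mz z = (mean_response D {k\<in>J. nths (fst (D k)) S = nths z S})\<^sup>2" for z
  have "(\<Sum>j\<in>J. Mz (fst (D j))) = (\<Sum>j\<in>J. \<Sum>z\<in>set_pmf Dx. of_bool (fst (D j) = z) * Mz z)"
  proof (intro sum.cong refl)
    fix j assume "j \<in> J"
    have "(\<Sum>z\<in>set_pmf Dx. of_bool (fst (D j) = z) * Mz z) = (\<Sum>z\<in>set_pmf Dx. if fst (D j) = z then Mz z else 0)"
      by (intro sum.cong) auto
    then show "Mz (fst (D j)) = (\<Sum>z\<in>set_pmf Dx. of_bool (fst (D j) = z) * Mz z)"
      using D[OF \<open>j \<in> J\<close>] finite_set_Dx by simp
  qed
  also have "\<dots> = (\<Sum>z\<in>set_pmf Dx. (\<Sum>j\<in>J. of_bool (fst (D j) = z)) * Mz z)"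
    by (subst sum.swap) (simp add: sum_distrib_right)
  finally have "V_emp D J S = (\<Sum>z\<in>set_pmf Dx. class_freq J D z * Mz z)"
    unfolding V_emp_def Mz_def class_freq_def
    by (simp only: sum_divide_distrib[where A = "set_pmf Dx"] times_divide_eq_left)
  then show ?thesis unfolding level_value_def Mz_def mean W_def .
qed

lemma level_value_continuous:
  assumes "0 < \<eta>"
  shows "\<exists>\<delta>>0. \<forall>u f. (\<forall>w\<in>set_pmf Dx. \<bar>u w - u0 w\<bar> < \<delta> \<and> \<bar>f w - pmf Dx w\<bar> < \<delta>) \<longrightarrow>
    \<bar>level_value S u f - level_value S u0 (pmf Dx)\<bar> < \<eta>"
proof (rule ccontr)
  assume "\<not> ?thesis"
  then have "\<forall>k::nat. \<exists>u f. (\<forall>w\<in>set_pmf Dx. \<bar>u w - u0 w\<bar> < 1 / real (Suc k) \<and> \<bar>f w - pmf Dx w\<bar> < 1 / real (Suc k)) \<and>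
      \<eta> \<le> \<bar>level_value S u f - level_value S u0 (pmf Dx)\<bar>"
    by (force simp: not_less)
  then obtain u f where uf: "\<And>k::nat. \<forall>w\<in>set_pmf Dx. \<bar>u k w - u0 w\<bar> < 1 / real (Suc k) \<and> \<bar>f k w - pmf Dx w\<bar> < 1 / real (Suc k)"
      "\<And>k. \<eta> \<le> \<bar>level_value S (u k) (f k) - level_value S u0 (pmf Dx)\<bar>"
    by metis
  have lim: "(\<lambda>k. v k w) \<longlonglongrightarrow> v0 w" if "\<And>k. \<bar>v k w - v0 w\<bar> < 1 / real (Suc k)" for v v0 :: "_ \<Rightarrow> _" and w :: "bool list"
  proof (rule LIM_zero_cancel, rule Lim_null_comparison)
    show "\<forall>\<^sub>F k in sequentially. norm (v k w - v0 w) \<le> 1 / real (Suc k)"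
      using that by (intro always_eventually) (auto intro: less_imp_le)
    show "(\<lambda>k. 1 / real (Suc k)) \<longlonglongrightarrow> 0" by (rule LIMSEQ_Suc[OF lim_const_over_n])
  qed
  have "(\<lambda>k. level_value S (u k) (f k)) \<longlonglongrightarrow> level_value S u0 (pmf Dx)"
    unfolding level_value_def
  proof (intro tendsto_sum tendsto_mult tendsto_power tendsto_divide)
    fix z assume z: "z \<in> set_pmf Dx"
    show "(\<lambda>k. f k z) \<longlonglongrightarrow> pmf Dx z" using uf(1) z by (intro lim) auto
    \<comment> \<open>The class of \<open>z\<close> contains \<open>z\<close> itself, which has
      positive probability.\<close>
    show "(\<Sum>w | w \<in> set_pmf Dx \<and> nths w S = nths z S. pmf Dx w) \<noteq> 0"
    proof -
      have "pmf Dx z \<le> (\<Sum>w | w \<in> set_pmf Dx \<and> nths w S = nths z S. pmf Dx w)"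
        using z finite_set_Dx by (intro member_le_sum) auto
      then show ?thesis using pmf_positive[OF z] by linarith
    qed
  next
    fix z w assume "w \<in> {w. w \<in> set_pmf Dx \<and> nths w S = nths z S}"
    then show "(\<lambda>k. u k w) \<longlonglongrightarrow> u0 w" "(\<lambda>k. f k w) \<longlonglongrightarrow> pmf Dx w"
      using uf(1) by (auto intro!: lim)
  qed
  then have "(\<lambda>k. \<bar>level_value S (u k) (f k) - level_value S u0 (pmf Dx)\<bar>) \<longlonglongrightarrow> 0"
    by (intro tendsto_rabs_zero LIM_zero)
  then have "\<eta> \<le> 0" by (rule LIMSEQ_le_const) (use uf(2) in auto)
  with assms show False by simp
qed

definition typical :: "real \<Rightarrow> nat set \<Rightarrow> (nat \<Rightarrow> sample) \<Rightarrow> bool" where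
  "typical \<delta> K D \<longleftrightarrow> (\<forall>w\<in>set_pmf Dx. \<bar>class_response K D w - pmf Dx w * m w\<bar> < \<delta> \<and> \<bar>class_freq K D w - pmf Dx w\<bar> < \<delta>)"

text \<open>One \<open>\<delta>\<close> has to serve all feature sets. Every sufficiently small
  \<open>\<delta>\<close> serves a given \<open>S\<close>, and there are finitely many of them, so
  the \<open>eventually\<close> filters can be intersected.\<close>

lemma typical_V_emp:
  assumes "0 < \<eta>"
  shows "\<exists>\<delta>>0. \<forall>S\<in>Pow {..<d}. \<forall>J D. finite J \<longrightarrow> J \<noteq> {} \<longrightarrow> (\<forall>k\<in>J. fst (D k) \<in> set_pmf Dx) \<longrightarrow>
    typical \<delta> J D \<longrightarrow> \<bar>V_emp D J S - V_bar Dx m S\<bar> < \<eta>"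
proof -
  define Q where "Q S \<delta> \<longleftrightarrow> (\<forall>J D. finite J \<longrightarrow> J \<noteq> {} \<longrightarrow> (\<forall>k\<in>J. fst (D k) \<in> set_pmf Dx) \<longrightarrow>
    typical \<delta> J D \<longrightarrow> \<bar>V_emp D J S - V_bar Dx m S\<bar> < \<eta>)" for S \<delta>
  have "\<forall>\<^sub>F \<delta> in at_right 0. Q S \<delta>" for S
  proof -
    obtain \<delta> where \<delta>: "\<delta> > 0" "\<And>u f. (\<forall>w\<in>set_pmf Dx. \<bar>u w - pmf Dx w * m w\<bar> < \<delta> \<and> \<bar>f w - pmf Dx w\<bar> < \<delta>) \<Longrightarrow>
      \<bar>level_value S u f - level_value S (\<lambda>w. pmf Dx w * m w) (pmf Dx)\<bar> < \<eta>"
      using level_value_continuous[OF assms, of "\<lambda>w. pmf Dx w * m w" S] by blast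
    have "Q S y" if "0 < y" "y < \<delta>" for y
      unfolding Q_def
    proof (intro allI impI)
      fix J and D :: "nat \<Rightarrow> sample"
      assume J: "finite J" "J \<noteq> {}" "\<forall>k\<in>J. fst (D k) \<in> set_pmf Dx" and t: "typical y J D"
      have "\<forall>w\<in>set_pmf Dx. \<bar>class_response J D w - pmf Dx w * m w\<bar> < \<delta> \<and> \<bar>class_freq J D w - pmf Dx w\<bar> < \<delta>"
        using t that unfolding typical_def by fastforce
      from \<delta>(2)[OF this] J show "\<bar>V_emp D J S - V_bar Dx m S\<bar> < \<eta>"
        by (simp add: V_emp_eq_level_value V_bar_eq_level_value)
    qed
    with \<delta>(1) show ?thesis by (auto simp: eventually_at_right_field)
  qed
  then have "\<forall>\<^sub>F \<delta> in at_right (0::real). \<forall>S\<in>Pow {..<d}. Q S \<delta>"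
    by (intro eventually_ball_finite) auto
  then obtain b where "b > 0" "\<forall>y>0. y < b \<longrightarrow> (\<forall>S\<in>Pow {..<d}. Q S y)"
    by (auto simp: eventually_at_right_field)
  then show ?thesis unfolding Q_def[symmetric] by (intro exI[of _ "b / 2"]) auto
qed

text \<open>A missing relevant feature beats every irrelevant one by \<open>\<beta>\<close> in
  \<open>V_bar\<close>, and two errors below \<open>\<beta> / 2\<close> cannot reverse this.\<close>

lemma typical_best_features:
  assumes sparse: "strongly_sparse d Dx m \<beta> r R" and S: "S \<subset> R"
    and V: "\<And>T. T \<subseteq> {..<d} \<Longrightarrow> \<bar>V_emp D J T - V_bar Dx m T\<bar> < \<beta> / 2"
  shows "best_features d D J S \<subseteq> R"
proof
  fix i assume i: "i \<in> best_features d D J S"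
  show "i \<in> R"
  proof (rule ccontr)
    assume iR: "i \<notin> R"
    have R: "R \<subseteq> {..<d}" using sparse by (simp add: strongly_sparse_def sparse_wrt_def)
    obtain i0 where i0: "i0 \<in> R" "i0 \<notin> S" using S by blast
    have id: "i < d" using i by (simp add: best_features_def)
    have "S \<subseteq> {..<d} - {i0}" using S R i0 by auto
    moreover have "i \<in> {..<d} - {i0}" "i \<notin> S" using S iR id i0 by auto
    ultimately have "S \<subset> {..<d} - {i0}" by blast
    then have 1: "V_bar Dx m (S \<union> {i}) - V_bar Dx m S + \<beta> \<le> V_bar Dx m (S \<union> {i0}) - V_bar Dx m S"
      using sparse i0 iR id unfolding strongly_sparse_def by blast
    have 2: "V_emp D J (S \<union> {i0}) \<le> V_emp D J (S \<union> {i})"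
      using i i0(1) R by (auto simp: best_features_def)
    have "S \<union> {i} \<subseteq> {..<d}" "S \<union> {i0} \<subseteq> {..<d}" using S R id i0 by auto
    from V[OF this(1)] V[OF this(2)] 1 2 show False
      unfolding abs_less_iff by linarith
  qed
qed

lemma class_freq_response_measurable:
  assumes "K \<subseteq> {..<n}"
  shows "(\<lambda>D. class_freq K D w) \<in> borel_measurable (data n)"
    "(\<lambda>D. class_response K D w) \<in> borel_measurable (data n)"
proof -
  have "(\<lambda>v. of_bool (fst v = w) :: real) \<in> borel_measurable Z" by (rule covariate_Z_measurable)
  then have "(\<lambda>D. of_bool (fst (D k) = w) :: real) \<in> borel_measurable (data n)" if "k \<in> K" for k
    using component_measurable[of k n "\<lambda>v. of_bool (fst v = w)" borel] that assms by auto
  moreover have "(\<lambda>D. snd (D k)) \<in> borel_measurable (data n)" if "k \<in> K" for k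
    using component_measurable[OF _ snd_Z_measurable, of k n] that assms by auto
  ultimately show "(\<lambda>D. class_freq K D w) \<in> borel_measurable (data n)"
    "(\<lambda>D. class_response K D w) \<in> borel_measurable (data n)"
    unfolding class_freq_def class_response_def
    by (auto intro!: borel_measurable_divide borel_measurable_sum borel_measurable_times)
qed

lemma typical_measurable:
  assumes "K \<subseteq> {..<n}"
  shows "Measurable.pred (data n) (typical \<delta> K)"
  unfolding typical_def[abs_def] using class_freq_response_measurable[OF assms] finite_set_Dx
  by measurable

text \<open>Hoeffding's inequality for the indicator of a covariate vector and for this indicator
  times the response. Two events of probability at most \<open>2 * exp _\<close> for each vector in
  the support give the factor 4.\<close>

lemma not_typical_prob:
  assumes K: "K \<subseteq> {..<n}" "K \<noteq> {}" and \<delta>: "0 < \<delta>"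
  shows "measure (data n) {D\<in>space (data n). \<not> typical \<delta> K D} \<le>
    4 * real (card (set_pmf Dx)) * exp (- \<delta>\<^sup>2 * real (card K) / 2)"
proof -
  interpret D: prob_space "data n" by (rule prob_space_data)
  have N: "0 < real (card K)" using K finite_subset[OF K(1)] by (simp add: card_gt_0_iff)
  define g1 where "g1 w v = of_bool (fst v = w) * snd v" for w and v :: sample
  define g2 where "g2 w v = (of_bool (fst v = w) :: real)" for w and v :: sample
  define e where "e = exp (- \<delta>\<^sup>2 * real (card K) / 2)"
  have m2: "g2 w \<in> borel_measurable Z" for w
    unfolding g2_def by (rule covariate_Z_measurable)
  then have m1: "g1 w \<in> borel_measurable Z" for w
    using borel_measurable_times[OF _ snd_Z_measurable, of "g2 w"] by (simp add: g1_def[abs_def] g2_def)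
  have b2: "AE v in Z. \<bar>g2 w v\<bar> \<le> 1" for w by (simp add: g2_def)
  have b1: "AE v in Z. \<bar>g1 w v\<bar> \<le> 1" for w
    using AE_Z
  proof eventually_elim
    case (elim v)
    then have "\<bar>m (fst v)\<bar> \<le> 1/2" using m_bound set_Dx by blast
    moreover have "\<bar>snd v\<bar> \<le> \<bar>residual v\<bar> + \<bar>m (fst v)\<bar>" by (simp add: residual_def)
    ultimately show ?case using elim by (auto simp: g1_def)
  qed
  have ind: "measure_pmf.expectation Dx (\<lambda>v. of_bool (v = w) * c v) = pmf Dx w * c w" for w and c :: "bool list \<Rightarrow> real"
    by (subst integral_measure_pmf_real[of "{w}"]) auto
  have E2: "(\<integral>v. g2 w v \<partial>Z) = pmf Dx w" for w
    using integral_Z_covariate[of "\<lambda>v. of_bool (v = w)"] ind[of w "\<lambda>_. 1"] by (simp add: g2_def)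
  have E1: "(\<integral>v. g1 w v \<partial>Z) = pmf Dx w * m w" for w
  proof -
    have i: "integrable Z (g1 w)" by (rule Z.integrable_const_bound[OF _ m1]) (use b1 in simp)
    have mm: "(\<lambda>v. of_bool (fst v = w) * m (fst v)) \<in> borel_measurable Z"
      by (rule covariate_Z_measurable[of "\<lambda>v. of_bool (v = w) * m v"])
    have "AE v in Z. norm (of_bool (fst v = w) * m (fst v)) \<le> \<bar>m w\<bar>" by (intro AE_I2) auto
    then have i': "integrable Z (\<lambda>v. of_bool (fst v = w) * m (fst v))"
      by (rule Z.integrable_const_bound[OF _ mm])
    have "g1 w = (\<lambda>v. of_bool (fst v = w) * m (fst v) + of_bool (fst v = w) * residual v)"
      by (auto simp: g1_def residual_def algebra_simps)
    moreover have "integrable Z (\<lambda>v. of_bool (fst v = w) * residual v)"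
      using Bochner_Integration.integrable_diff[OF i i'] by (simp add: g1_def residual_def algebra_simps)
    ultimately have "(\<integral>v. g1 w v \<partial>Z) = (\<integral>v. of_bool (fst v = w) * m (fst v) \<partial>Z) + (\<integral>v. of_bool (fst v = w) * residual v \<partial>Z)"
      using i' by simp
    then show ?thesis
      using integral_Z_covariate[of "\<lambda>v. of_bool (v = w) * m v"] integral_Z_residual[of "\<lambda>v. of_bool (v = w)"] ind[of w m] by simp
  qed
  define B where "B g D \<longleftrightarrow> \<delta> * real (card K) \<le> \<bar>(\<Sum>k\<in>K. g (D k)) - real (card K) * (\<integral>z. g z \<partial>Z)\<bar>"
    for g :: "sample \<Rightarrow> real" and D
  have Bset: "{D\<in>space (data n). B g D} \<in> sets (data n)" if "g \<in> borel_measurable Z" for g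
  proof -
    have "(\<lambda>D. \<bar>(\<Sum>k\<in>K. g (D k)) - real (card K) * (\<integral>z. g z \<partial>Z)\<bar>) \<in> borel_measurable (data n)"
      using K(1) by (intro borel_measurable_abs borel_measurable_diff borel_measurable_sum
          component_measurable[OF _ that] borel_measurable_const) auto
    then show ?thesis unfolding B_def by (rule borel_measurable_le[OF borel_measurable_const])
  qed
  have PB: "measure (data n) {D\<in>space (data n). B g D} \<le> 2 * e"
    if "g \<in> borel_measurable Z" "AE z in Z. \<bar>g z\<bar> \<le> 1" for g
    unfolding B_def e_def using hoeffding_component[OF that K] \<delta> by simp
  have dev: "\<bar>a / real (card K) - b\<bar> < \<delta> \<longleftrightarrow> \<not> \<delta> * real (card K) \<le> \<bar>a - real (card K) * b\<bar>" for a b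
  proof -
    have "\<bar>a / real (card K) - b\<bar> = \<bar>a - real (card K) * b\<bar> / real (card K)"
    proof -
      have "a / real (card K) - b = (a - real (card K) * b) / real (card K)" using N by (simp add: field_simps)
      then show ?thesis using N by (simp add: abs_divide)
    qed
    then show ?thesis using N by (simp add: pos_divide_less_eq not_le)
  qed
  have "class_response K D w = (\<Sum>k\<in>K. g1 w (D k)) / real (card K)"
    "class_freq K D w = (\<Sum>k\<in>K. g2 w (D k)) / real (card K)" for D w
    by (simp_all add: class_response_def class_freq_def g1_def g2_def)
  then have "{D\<in>space (data n). \<not> typical \<delta> K D} =
      (\<Union>w\<in>set_pmf Dx. {D\<in>space (data n). B (g1 w) D} \<union> {D\<in>space (data n). B (g2 w) D})"
    by (auto simp: typical_def dev B_def E1 E2)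
  also have "measure (data n) \<dots> \<le>
      (\<Sum>w\<in>set_pmf Dx. measure (data n) ({D\<in>space (data n). B (g1 w) D} \<union> {D\<in>space (data n). B (g2 w) D}))"
    using Bset m1 m2 by (intro D.finite_measure_subadditive_finite finite_set_Dx) auto
  also have "\<dots> \<le> (\<Sum>w\<in>set_pmf Dx. 4 * e)"
  proof (intro sum_mono)
    fix w
    have "measure (data n) ({D\<in>space (data n). B (g1 w) D} \<union> {D\<in>space (data n). B (g2 w) D})
        \<le> measure (data n) {D\<in>space (data n). B (g1 w) D} + measure (data n) {D\<in>space (data n). B (g2 w) D}"
      using Bset m1 m2 by (intro measure_Un_le) auto
    also have "\<dots> \<le> 2 * e + 2 * e" by (intro add_mono PB m1 m2 b1 b2)
    finally show "measure (data n) ({D\<in>space (data n). B (g1 w) D} \<union> {D\<in>space (data n). B (g2 w) D}) \<le> 4 * e" by simp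
  qed
  finally show ?thesis by (simp add: e_def)
qed

end

section \<open>Bias and Monte Carlo error\<close>

text \<open>The two claims go through one induction because the cross term with the remaining list
  vanishes by the second claim.\<close>

lemma replicate_pmf_second_moment:
  fixes g :: "'a \<Rightarrow> real"
  assumes fin: "finite (set_pmf p)" and mean: "measure_pmf.expectation p g = 0"
  shows "measure_pmf.expectation (replicate_pmf N p) (\<lambda>hs. (\<Sum>h\<leftarrow>hs. g h)\<^sup>2) =
      real N * measure_pmf.expectation p (\<lambda>h. (g h)\<^sup>2)
    \<and> measure_pmf.expectation (replicate_pmf N p) (\<lambda>hs. \<Sum>h\<leftarrow>hs. g h) = 0"
proof (induction N)
  case 0
  show ?case by simp
next
  case (Suc N)
  define q where "q = replicate_pmf N p"
  have finq: "finite (set_pmf q)"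
  proof (rule finite_subset)
    show "set_pmf q \<subseteq> {hs. set hs \<subseteq> set_pmf p \<and> length hs = N}"
      by (auto simp: q_def set_replicate_pmf)
  qed (rule finite_lists_length_eq[OF fin])
  note int = integrable_measure_pmf_finite[OF finq] integrable_measure_pmf_finite[OF fin]
  have E: "measure_pmf.expectation (replicate_pmf (Suc N) p) F =
      measure_pmf.expectation p (\<lambda>h. measure_pmf.expectation q (\<lambda>hs. F (h # hs)))" for F :: "_ \<Rightarrow> real"
    unfolding replicate_pmf.simps q_def[symmetric] using fin finq
    by (subst expectation_bind_pmf_finite) (auto simp: map_pmf_def[symmetric])
  have "measure_pmf.expectation q (\<lambda>hs. (g h + (\<Sum>h\<leftarrow>hs. g h))\<^sup>2) =
      (g h)\<^sup>2 + real N * measure_pmf.expectation p (\<lambda>h. (g h)\<^sup>2)" for h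
  proof -
    have "measure_pmf.expectation q (\<lambda>hs. (g h + (\<Sum>h\<leftarrow>hs. g h))\<^sup>2) =
        measure_pmf.expectation q (\<lambda>hs. (g h)\<^sup>2 + (2 * g h) * (\<Sum>h\<leftarrow>hs. g h) + (\<Sum>h\<leftarrow>hs. g h)\<^sup>2)"
      by (intro Bochner_Integration.integral_cong refl) (simp add: power2_eq_square algebra_simps)
    also have "\<dots> = (g h)\<^sup>2 + (2 * g h) * measure_pmf.expectation q (\<lambda>hs. \<Sum>h\<leftarrow>hs. g h) +
        measure_pmf.expectation q (\<lambda>hs. (\<Sum>h\<leftarrow>hs. g h)\<^sup>2)"
      by (simp add: int)
    finally show ?thesis using Suc by (simp add: q_def)
  qed
  moreover have "measure_pmf.expectation q (\<lambda>hs. g h + (\<Sum>h\<leftarrow>hs. g h)) = g h" for h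
    using Suc by (simp add: int q_def[symmetric])
  ultimately show ?case unfolding E by (simp add: int mean algebra_simps)
qed

lemma prob_eq_expectation_of_bool:
  "measure_pmf.prob p {h. Q h} = measure_pmf.expectation p (\<lambda>h. of_bool (Q h))"
proof -
  have "(\<lambda>h. of_bool (Q h) :: real) = indicator {h. Q h}" by (auto simp: fun_eq_iff)
  then show ?thesis by simp
qed

lemma replicate_pmf_mean_error:
  fixes f :: "'a \<Rightarrow> real"
  assumes fin: "finite (set_pmf p)" and f: "\<And>h. h \<in> set_pmf p \<Longrightarrow> \<bar>f h\<bar> \<le> 1" and B: "0 < B"
  shows "measure_pmf.expectation (replicate_pmf B p)
      (\<lambda>hs. \<bar>(\<Sum>h\<leftarrow>hs. f h) / real B - measure_pmf.expectation p f\<bar>) \<le> 1 / sqrt (real B)"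
proof -
  define \<mu> where "\<mu> = measure_pmf.expectation p f"
  define g where "g h = f h - \<mu>" for h
  note intp = integrable_measure_pmf_finite[OF fin]
  have mean: "measure_pmf.expectation p g = 0"
    by (simp add: g_def[abs_def] intp \<mu>_def)
  have finq: "finite (set_pmf (replicate_pmf B p))"
  proof (rule finite_subset)
    show "set_pmf (replicate_pmf B p) \<subseteq> {hs. set hs \<subseteq> set_pmf p \<and> length hs = B}"
      by (auto simp: set_replicate_pmf)
  qed (rule finite_lists_length_eq[OF fin])
  note intq = integrable_measure_pmf_finite[OF finq]
  have "measure_pmf.expectation p (\<lambda>h. (g h)\<^sup>2) = measure_pmf.expectation p (\<lambda>h. (f h)\<^sup>2 - 2 * \<mu> * f h + \<mu>\<^sup>2)"
    by (simp add: g_def power2_eq_square algebra_simps)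
  also have "\<dots> = measure_pmf.expectation p (\<lambda>h. (f h)\<^sup>2) - \<mu>\<^sup>2"
    by (simp add: intp \<mu>_def[symmetric] power2_eq_square)
  also have "\<dots> \<le> measure_pmf.expectation p (\<lambda>h. 1)"
  proof -
    have "measure_pmf.expectation p (\<lambda>h. (f h)\<^sup>2) \<le> measure_pmf.expectation p (\<lambda>h. 1)"
      using f by (intro expectation_mono_finite fin) (simp add: abs_square_le_1)
    then show ?thesis using zero_le_power2[of \<mu>] by linarith
  qed
  finally have g2: "measure_pmf.expectation p (\<lambda>h. (g h)\<^sup>2) \<le> 1" by simp
  have sb: "0 < sqrt (real B)" using B by simp
  have eq: "(\<Sum>h\<leftarrow>hs. f h) / real B - \<mu> = (\<Sum>h\<leftarrow>hs. g h) / real B" if "hs \<in> set_pmf (replicate_pmf B p)" for hs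
  proof -
    have len: "length hs = B" using that by (simp add: set_replicate_pmf)
    have "(\<Sum>h\<leftarrow>hs. g h) = (\<Sum>h\<leftarrow>hs. f h) - real (length hs) * \<mu>"
      by (induction hs) (auto simp: g_def algebra_simps)
    then show ?thesis using B len by (simp add: field_simps)
  qed
  have "measure_pmf.expectation (replicate_pmf B p) (\<lambda>hs. \<bar>(\<Sum>h\<leftarrow>hs. f h) / real B - \<mu>\<bar>) =
      measure_pmf.expectation (replicate_pmf B p) (\<lambda>hs. \<bar>(\<Sum>h\<leftarrow>hs. g h) / real B\<bar>)"
    using eq by (intro expectation_cong_pmf) simp
  \<comment> \<open>AM-GM with weight \<open>sqrt B\<close> against the constant 1: the second
    moment of the mean is at most \<open>1 / B\<close>, so both terms contribute
    \<open>1 / sqrt B\<close>.\<close>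
  also have "\<dots> \<le> measure_pmf.expectation (replicate_pmf B p)
      (\<lambda>hs. (sqrt (real B) / (real B)\<^sup>2 * (\<Sum>h\<leftarrow>hs. g h)\<^sup>2 + 1 / sqrt (real B)) / 2)"
  proof (intro expectation_mono_finite finq)
    fix hs
    show "\<bar>(\<Sum>h\<leftarrow>hs. g h) / real B\<bar> \<le> (sqrt (real B) / (real B)\<^sup>2 * (\<Sum>h\<leftarrow>hs. g h)\<^sup>2 + 1 / sqrt (real B)) / 2"
      using abs_mult_le_AMGM[OF sb, of "(\<Sum>h\<leftarrow>hs. g h) / real B" 1] by (simp add: power_divide)
  qed
  also have "\<dots> = (sqrt (real B) / (real B)\<^sup>2 * (real B * measure_pmf.expectation p (\<lambda>h. (g h)\<^sup>2)) + 1 / sqrt (real B)) / 2"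
    using replicate_pmf_second_moment[OF fin mean, of B] by (simp add: intq del: times_divide_eq_left)
  also have "\<dots> \<le> (sqrt (real B) / (real B)\<^sup>2 * (real B * 1) + 1 / sqrt (real B)) / 2"
    using g2 by (intro divide_right_mono add_mono mult_left_mono) auto
  also have "\<dots> = 1 / sqrt (real B)"
    using B by (simp add: power2_eq_square real_div_sqrt field_simps)
  finally show ?thesis unfolding \<mu>_def .
qed

section \<open>The bias of fully grown trees\<close>

context regression
begin

text \<open>In a typical estimation sample the frequency of \<open>z0\<close> exceeds half of its
  probability, so the bound 6 provides more than three copies of \<open>z0\<close>: too many for a
  leaf with two or three samples.\<close>

lemma relevant_leaf:
  assumes sparse: "strongly_sparse d Dx m \<beta> r R" and x: "x \<in> cube d"
    and z0: "z0 \<in> set_pmf Dx" "nths z0 R = nths x R"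
    and \<delta>: "\<delta> \<le> pmf Dx z0 / 2"
    and V: "\<And>T. T \<subseteq> {..<d} \<Longrightarrow> \<bar>V_emp D J T - V_bar Dx m T\<bar> < \<beta> / 2"
    and H: "finite H" "6 < real (card H) * pmf Dx z0" "\<And>k. k \<in> H \<Longrightarrow> fst (D k) \<in> set_pmf Dx" "typical \<delta> H D"
    and SP: "(S, P) \<in> set_pmf (grow d D J H L)" "fully_grown D (H, P)"
    and k: "k \<in> leaf D H P x"
  shows "m (fst (D k)) = m x"
proof -
  obtain h0 where R: "R \<subseteq> {..<d}" and h0: "\<And>z. z \<in> cube d \<Longrightarrow> m z = h0 (nths z R)"
    using sparse by (auto simp: strongly_sparse_def sparse_wrt_def)
  have N: "0 < real (card H)" using H(2) by (cases "card H = 0") auto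
  have "real (card {k\<in>H. fst (D k) = z0}) = (\<Sum>k\<in>H. of_bool (fst (D k) = z0))"
    using H(1) by (simp add: of_bool_def sum.If_cases Int_def)
  also have "\<dots> = class_freq H D z0 * real (card H)" using N by (simp add: class_freq_def)
  finally have cnt: "real (card {k\<in>H. fst (D k) = z0}) = class_freq H D z0 * real (card H)" .
  have "\<bar>class_freq H D z0 - pmf Dx z0\<bar> < \<delta>" using H(4) z0(1) by (auto simp: typical_def)
  then have "pmf Dx z0 / 2 < class_freq H D z0" using \<delta> by linarith
  then have "pmf Dx z0 / 2 * real (card H) < class_freq H D z0 * real (card H)"
    using N by (intro mult_strict_right_mono)
  then have "3 < card {k\<in>H. fst (D k) = z0}" using cnt H(2) by (simp add: mult.commute)
  moreover have "fst (D k) \<in> cube d" if "k \<in> H" for k using H(3)[OF that] set_Dx by blast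
  ultimately have "nths (fst (D k)) R = nths x R"
    using z0 set_Dx
    by (intro fully_grown_leaf_relevant[OF d_pos x R typical_best_features[OF sparse _ V] _ _ z0(2) _ SP k]) auto
  moreover have "fst (D k) \<in> cube d" using k leaf_subset[of D H P x] H(3) set_Dx by blast
  ultimately show ?thesis using h0 x by simp
qed

text \<open>For a given split and tree the bias is at most 1 in absolute value, and it is exactly 0
  when the tree is fully grown and both halves of the sub-sample are typical. The right-hand side
  averages the indicators of the three failures.\<close>

lemma bias_pointwise:
  assumes sparse: "strongly_sparse d Dx m \<beta> r R" and x: "x \<in> cube d"
    and z0: "z0 \<in> set_pmf Dx" "nths z0 R = nths x R"
    and \<delta>: "\<delta> \<le> pmf Dx z0 / 2"
    and V: "\<forall>S\<in>Pow {..<d}. \<forall>J D. finite J \<longrightarrow> J \<noteq> {} \<longrightarrow> (\<forall>k\<in>J. fst (D k) \<in> set_pmf Dx) \<longrightarrow>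
      typical \<delta> J D \<longrightarrow> \<bar>V_emp D J S - V_bar Dx m S\<bar> < \<beta> / 2"
    and s: "s \<le> n" "0 < s div 2" "6 < real (s - s div 2) * pmf Dx z0"
    and D: "\<And>k. k < n \<Longrightarrow> fst (D k) \<in> set_pmf Dx"
  shows "\<bar>\<Sum>k<n. forest_weight d L n s D x k * (m (fst (D k)) - m x)\<bar> \<le>
    measure_pmf.prob (base_tree d L n s D) {h. \<not> fully_grown D h} +
    measure_pmf.expectation (splits n s) (\<lambda>(J, H). of_bool (\<not> typical \<delta> J D) + of_bool (\<not> typical \<delta> H D))"
proof -
  note fin = finite_set_pmf_splits[OF s(1)]
  note int = integrable_measure_pmf_finite[OF fin]
  define b where "b J H = measure_pmf.expectation (grow d D J H L)
    (\<lambda>(S, P). indicator {h. \<not> fully_grown D h} (H, P) :: real)" for J H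
  define c where "c J H = (\<Sum>k<n. grow_weight d L D J H x k * (m (fst (D k)) - m x))" for J H
  have c: "\<bar>c J H\<bar> \<le> b J H + (of_bool (\<not> typical \<delta> J D) + of_bool (\<not> typical \<delta> H D))"
    if p: "(J, H) \<in> set_pmf (splits n s)" for J H
  proof -
    note JH = splitsD[OF s(1) p]
    have fg: "finite (set_pmf (grow d D J H L))" by (rule finite_set_pmf_grow[OF d_pos])
    have "\<bar>c J H\<bar> \<le> measure_pmf.expectation (grow d D J H L)
        (\<lambda>p. \<bar>case p of (S, P) \<Rightarrow> \<Sum>k<n. tree_weight D H P x k * (m (fst (D k)) - m x)\<bar>)"
      unfolding c_def sum_grow_weight[OF d_pos] by (rule abs_expectation_le_finite[OF fg])
    also have "\<dots> \<le> measure_pmf.expectation (grow d D J H L)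
        (\<lambda>p. (case p of (S, P) \<Rightarrow> indicator {h. \<not> fully_grown D h} (H, P)) +
          (of_bool (\<not> typical \<delta> J D) + of_bool (\<not> typical \<delta> H D)))"
    proof (intro expectation_mono_finite fg)
      fix p assume p': "p \<in> set_pmf (grow d D J H L)"
      obtain S P where [simp]: "p = (S, P)" by (cases p)
      define t where "t = (\<Sum>k<n. tree_weight D H P x k * (m (fst (D k)) - m x))"
      have "\<bar>t\<bar> \<le> (\<Sum>k<n. tree_weight D H P x k)"
        unfolding t_def
      proof (intro sum_abs[THEN order_trans] sum_mono)
        fix k assume "k \<in> {..<n}"
        then have "\<bar>m (fst (D k))\<bar> \<le> 1/2" using D set_Dx by (intro m_bound) auto
        moreover have "\<bar>m x\<bar> \<le> 1/2" using x by (rule m_bound)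
        ultimately have "\<bar>m (fst (D k)) - m x\<bar> \<le> 1" by linarith
        from mult_left_mono[OF this tree_weight_nonneg[of D H P x k]]
        show "\<bar>tree_weight D H P x k * (m (fst (D k)) - m x)\<bar> \<le> tree_weight D H P x k"
          by (simp add: abs_mult tree_weight_nonneg)
      qed
      also have "\<dots> \<le> 1" using JH by (intro sum_tree_weight_le_1) auto
      finally have t1: "\<bar>t\<bar> \<le> 1" .
      have t0: "t = 0" if good: "fully_grown D (H, P)" "typical \<delta> J D" "typical \<delta> H D"
      proof -
        have "J \<noteq> {}" using JH(7) s(2) by auto
        moreover have "fst (D k) \<in> set_pmf Dx" if "k \<in> J \<union> H" for k
          using that JH(1,2) D by blast
        ultimately have "\<bar>V_emp D J T - V_bar Dx m T\<bar> < \<beta> / 2" if "T \<subseteq> {..<d}" for T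
          using V that JH(3) good(2) by blast
        then have "m (fst (D k)) = m x" if "k \<in> leaf D H P x" for k
          using that JH s(3) p' good D
          by (intro relevant_leaf[OF sparse x z0 \<delta>, of D J H S P L k]) auto
        then show ?thesis
          unfolding t_def by (intro sum.neutral) (auto simp: tree_weight_def)
      qed
      show "\<bar>case p of (S, P) \<Rightarrow> \<Sum>k<n. tree_weight D H P x k * (m (fst (D k)) - m x)\<bar> \<le>
         (case p of (S, P) \<Rightarrow> indicator {h. \<not> fully_grown D h} (H, P)) +
          (of_bool (\<not> typical \<delta> J D) + of_bool (\<not> typical \<delta> H D))"
        using t0 t1 by (auto simp: t_def[symmetric] indicator_def simp del: fully_grown.simps)
    qed
    also have "\<dots> = b J H + (of_bool (\<not> typical \<delta> J D) + of_bool (\<not> typical \<delta> H D))"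
      by (simp add: b_def integrable_measure_pmf_finite[OF fg])
    finally show ?thesis .
  qed
  have "\<bar>\<Sum>k<n. forest_weight d L n s D x k * (m (fst (D k)) - m x)\<bar> \<le>
      measure_pmf.expectation (splits n s) (\<lambda>p. \<bar>case p of (J, H) \<Rightarrow> c J H\<bar>)"
    unfolding sum_forest_weight[OF s(1)] c_def by (rule abs_expectation_le_finite[OF fin])
  also have "\<dots> \<le> measure_pmf.expectation (splits n s) (\<lambda>p. (case p of (J, H) \<Rightarrow> b J H) +
      (case p of (J, H) \<Rightarrow> of_bool (\<not> typical \<delta> J D) + of_bool (\<not> typical \<delta> H D)))"
    using c by (intro expectation_mono_finite fin) auto
  also have "\<dots> = measure_pmf.expectation (splits n s) (\<lambda>(J, H). b J H) +
      measure_pmf.expectation (splits n s) (\<lambda>(J, H). of_bool (\<not> typical \<delta> J D) + of_bool (\<not> typical \<delta> H D))"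
    by (rule Bochner_Integration.integral_add[OF int int])
  also have "measure_pmf.expectation (splits n s) (\<lambda>(J, H). b J H) =
      measure_pmf.prob (base_tree d L n s D) {h. \<not> fully_grown D h}"
    using expectation_base_tree[OF d_pos s(1), of L D "indicator {h. \<not> fully_grown D h}"] by (simp add: b_def)
  finally show ?thesis .
qed

text \<open>Transfers the assumption on full growth, which speaks of permuted trees, to trees
  without permutation: relabelling moves the permutation from the tree to the data, where
  exchangeability removes it.\<close>

lemma base_tree_not_fully_grown:
  assumes s: "s \<le> n"
  shows "(\<integral>D. measure_pmf.prob (base_tree d (tree_levels logt) n s D) {h. \<not> fully_grown D h} \<partial>data n) =
      not_fully_grown_prob d Dx \<E> m logt n s"
    and "integrable (data n) (\<lambda>D. measure_pmf.prob (base_tree d (tree_levels logt) n s D) {h. \<not> fully_grown D h})"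
proof -
  interpret D: prob_space "data n" by (rule prob_space_data)
  define f where "f D = measure_pmf.prob (base_tree d (tree_levels logt) n s D) {h. \<not> fully_grown D h}" for D
  have f: "f D = measure_pmf.expectation (base_tree d (tree_levels logt) n s D) (\<lambda>h. of_bool (\<not> fully_grown D h))" for D
    unfolding f_def by (rule prob_eq_expectation_of_bool)
  have "f \<in> borel_measurable (data n)"
    unfolding f[abs_def]
  proof (rule finite_kernel_expectation_measurable[OF base_tree_kernel[OF samples_measurable_data d_pos s]])
    fix h assume h: "h \<in> Pow {..<n} \<times> Pow (Pow (cube d))"
    obtain H P where [simp]: "h = (H, P)" by (cases h)
    have "Measurable.pred (data n) (\<lambda>D. fully_grown D (H, P))"
      using h finite_subset[of H "{..<n}"] by (intro fully_grown_pred[OF samples_measurable_data]) auto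
    then show "(\<lambda>D. of_bool (\<not> fully_grown D h) :: real) \<in> borel_measurable (data n)"
      by (simp add: of_bool_def del: fully_grown.simps)
  qed
  then have int: "integrable (data n) f"
    by (intro D.integrable_const_bound[of f 1]) (auto simp: f_def)
  then show "integrable (data n) (\<lambda>D. measure_pmf.prob (base_tree d (tree_levels logt) n s D) {h. \<not> fully_grown D h})"
    by (simp add: f_def[abs_def])
  have "measure_pmf.prob (random_tree d logt n s D) {h. \<not> fully_grown D h} =
      measure_pmf.expectation (pmf_of_set {\<pi>. \<pi> permutes {..<n}}) (\<lambda>\<pi>. f (D \<circ> \<pi>))" for D
  proof -
    have "measure_pmf.prob (random_tree d logt n s D) {h. \<not> fully_grown D h} =
        measure_pmf.expectation (random_tree d logt n s D) (\<lambda>h. of_bool (\<not> fully_grown D h))"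
      by (rule prob_eq_expectation_of_bool)
    also have "\<dots> = measure_pmf.expectation (pmf_of_set {\<pi>. \<pi> permutes {..<n}}) (\<lambda>\<pi>. f (D \<circ> \<pi>))"
      unfolding expectation_random_tree[OF d_pos s] f
    proof (rule expectation_cong_pmf)
      fix \<pi> :: "nat \<Rightarrow> nat" assume "\<pi> \<in> set_pmf (pmf_of_set {\<pi>. \<pi> permutes {..<n}})"
      then have "inj \<pi>" using permutes_finite_nonempty[of n] permutes_inj by auto
      then show "measure_pmf.expectation (base_tree d (tree_levels logt) n s (D \<circ> \<pi>)) (\<lambda>(H, P). of_bool (\<not> fully_grown D (\<pi> ` H, P))) =
          measure_pmf.expectation (base_tree d (tree_levels logt) n s (D \<circ> \<pi>)) (\<lambda>h. of_bool (\<not> fully_grown (D \<circ> \<pi>) h) :: real)"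
        by (intro expectation_cong_pmf) (auto simp: fully_grown_image simp del: fully_grown.simps)
    qed
    finally show ?thesis .
  qed
  then show "(\<integral>D. measure_pmf.prob (base_tree d (tree_levels logt) n s D) {h. \<not> fully_grown D h} \<partial>data n) =
      not_fully_grown_prob d Dx \<E> m logt n s"
    using average_over_permutations(1)[OF int] unfolding not_fully_grown_prob_def by (simp add: f_def)
qed

text \<open>Each half of a sub-sample has at least \<open>s div 2\<close> elements; the two halves
  double the factor 4 to 8. The split is independent of the data, so the bound for a fixed index set
  applies to each split.\<close>

lemma not_typical_splits_integral:
  assumes s: "s \<le> n" "0 < s div 2" and \<delta>: "0 < \<delta>"
  shows "(\<integral>D. measure_pmf.expectation (splits n s) (\<lambda>(J, H). of_bool (\<not> typical \<delta> J D) + of_bool (\<not> typical \<delta> H D)) \<partial>data n) \<le>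
      8 * real (card (set_pmf Dx)) * exp (- \<delta>\<^sup>2 * real (s div 2) / 2)"
    and "integrable (data n) (\<lambda>D. measure_pmf.expectation (splits n s) (\<lambda>(J, H). of_bool (\<not> typical \<delta> J D) + of_bool (\<not> typical \<delta> H D)) :: real)"
proof -
  interpret D: prob_space "data n" by (rule prob_space_data)
  define e where "e = 4 * real (card (set_pmf Dx)) * exp (- \<delta>\<^sup>2 * real (s div 2) / 2)"
  note fin = finite_set_pmf_splits[OF s(1)]
  define b where "b K D = (of_bool (\<not> typical \<delta> K D) :: real)" for K D
  have int: "integrable (data n) (b K)" and le: "s div 2 \<le> card K \<Longrightarrow> (\<integral>D. b K D \<partial>data n) \<le> e"
    if K: "K \<subseteq> {..<n}" for K
  proof -
    have bm: "b K \<in> borel_measurable (data n)"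
      using typical_measurable[OF K, of \<delta>] unfolding b_def[abs_def] of_bool_def by measurable
    show "integrable (data n) (b K)"
      by (rule D.integrable_const_bound[OF _ bm, of 1]) (simp add: b_def)
    assume card: "s div 2 \<le> card K"
    have "(\<integral>D. b K D \<partial>data n) = (\<integral>D. indicator {D\<in>space (data n). \<not> typical \<delta> K D} D \<partial>data n)"
      by (intro Bochner_Integration.integral_cong refl) (simp add: b_def indicator_def)
    also have "\<dots> = measure (data n) {D\<in>space (data n). \<not> typical \<delta> K D}"
      by (simp add: Int_absorb2)
    also have "\<dots> \<le> 4 * real (card (set_pmf Dx)) * exp (- \<delta>\<^sup>2 * real (card K) / 2)"
      using card s K \<delta> by (intro not_typical_prob) auto
    also have "\<dots> \<le> e"
      unfolding e_def using card by (intro mult_left_mono) (auto intro!: divide_right_mono mult_left_mono)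
    finally show "(\<integral>D. b K D \<partial>data n) \<le> e" .
  qed
  define Sp where "Sp = set_pmf (splits n s)"
  have E: "measure_pmf.expectation (splits n s) (\<lambda>(J, H). of_bool (\<not> typical \<delta> J D) + of_bool (\<not> typical \<delta> H D)) =
      (\<Sum>i\<in>Sp. pmf (splits n s) i * (b (fst i) D + b (snd i) D))" for D
    by (subst integral_measure_pmf[OF fin]) (auto simp: Sp_def b_def case_prod_unfold)
  have sub: "fst i \<subseteq> {..<n}" "snd i \<subseteq> {..<n}" "s div 2 \<le> card (fst i)" "s div 2 \<le> card (snd i)" if "i \<in> Sp" for i
    using splitsD[OF s(1), of "fst i" "snd i"] that by (auto simp: Sp_def)
  show "integrable (data n) (\<lambda>D. measure_pmf.expectation (splits n s) (\<lambda>(J, H). of_bool (\<not> typical \<delta> J D) + of_bool (\<not> typical \<delta> H D)) :: real)"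
    unfolding E using sub
    by (intro Bochner_Integration.integrable_sum integrable_mult_right Bochner_Integration.integrable_add int) auto
  have "(\<integral>D. (\<Sum>i\<in>Sp. pmf (splits n s) i * (b (fst i) D + b (snd i) D)) \<partial>data n) =
      (\<Sum>i\<in>Sp. \<integral>D. pmf (splits n s) i * (b (fst i) D + b (snd i) D) \<partial>data n)"
    using sub by (intro Bochner_Integration.integral_sum integrable_mult_right Bochner_Integration.integrable_add int) auto
  also have "\<dots> = (\<Sum>i\<in>Sp. pmf (splits n s) i * ((\<integral>D. b (fst i) D \<partial>data n) + (\<integral>D. b (snd i) D \<partial>data n)))"
    using sub int by (intro sum.cong refl) simp
  also have "\<dots> \<le> (\<Sum>i\<in>Sp. pmf (splits n s) i * (e + e))"
    using sub le by (intro sum_mono mult_left_mono add_mono) auto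
  also have "\<dots> = 2 * e"
    using sum_pmf_eq_1[OF fin[folded Sp_def]] by (simp add: sum_distrib_right[symmetric] Sp_def)
  finally show "(\<integral>D. measure_pmf.expectation (splits n s) (\<lambda>(J, H). of_bool (\<not> typical \<delta> J D) + of_bool (\<not> typical \<delta> H D)) \<partial>data n) \<le>
      8 * real (card (set_pmf Dx)) * exp (- \<delta>\<^sup>2 * real (s div 2) / 2)"
    unfolding E by (simp add: e_def)
qed

definition tree_mean :: "real \<Rightarrow> nat \<Rightarrow> nat \<Rightarrow> bool list \<Rightarrow> (nat \<Rightarrow> sample) \<Rightarrow> real" where
  "tree_mean logt n s x D = measure_pmf.expectation (random_tree d logt n s D) (\<lambda>h. tree_predict D h x)"

lemma linear_part_permutes:
  assumes "\<pi> permutes {..<n}"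
  shows "linear_part L n s x (D \<circ> \<pi>) = linear_part L n s x D"
  using sum.permute[OF assms, of "\<lambda>k. influence L n s x (fst (D k)) * residual (D k)"]
  by (simp add: linear_part_def o_def)

lemma linear_part_measurable: "linear_part L n s x \<in> borel_measurable (data n)"
  unfolding linear_part_def[abs_def]
  using component_measurable[OF _ residual_measurable] component_measurable[OF _ covariate_Z_measurable]
  by (intro borel_measurable_divide borel_measurable_sum borel_measurable_times) auto

lemma tree_mean_measurable:
  assumes "s \<le> n"
  shows "tree_mean logt n s x \<in> borel_measurable (data n)"
  unfolding tree_mean_def[abs_def]
proof (rule finite_kernel_expectation_measurable[OF random_tree_kernel[OF samples_measurable_data d_pos assms]])
  fix h assume "h \<in> Pow {..<n} \<times> Pow (Pow (cube d))"
  then obtain H P where "h = (H, P)" "H \<subseteq> {..<n}" by auto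
  then show "(\<lambda>D. tree_predict D h x) \<in> borel_measurable (data n)"
    using tree_predict_measurable[OF samples_measurable_data, of H n P x] finite_subset[of H "{..<n}"]
    by (simp del: tree_predict.simps)
qed

text \<open>The error of the tree mean is the average over permutations of the error
  \<open>U\<close> without permutation at \<open>D \<circ> \<pi>\<close>. Absolute values are moved
  inside this average, and exchangeability reduces it to the error of \<open>U\<close>, which splits
  into bias and noise.\<close>

lemma tree_mean_approx:
  assumes sparse: "strongly_sparse d Dx m \<beta> r R" and x: "x \<in> cube d"
    and z0: "z0 \<in> set_pmf Dx" "nths z0 R = nths x R"
    and \<delta>: "0 < \<delta>" "\<delta> \<le> pmf Dx z0 / 2"
    and V: "\<forall>S\<in>Pow {..<d}. \<forall>J D. finite J \<longrightarrow> J \<noteq> {} \<longrightarrow> (\<forall>k\<in>J. fst (D k) \<in> set_pmf Dx) \<longrightarrow>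
      typical \<delta> J D \<longrightarrow> \<bar>V_emp D J S - V_bar Dx m S\<bar> < \<beta> / 2"
    and s: "s \<le> n" "0 < s div 2" "6 < real (s - s div 2) * pmf Dx z0"
  shows "(\<integral>D. \<bar>tree_mean logt n s x D - m x - linear_part (tree_levels logt) n s x D\<bar> \<partial>data n) \<le>
      not_fully_grown_prob d Dx \<E> m logt n s + 8 * real (card (set_pmf Dx)) * exp (- \<delta>\<^sup>2 * real (s div 2) / 2)
      + (\<Sum>z\<in>set_pmf Dx. 10 / (pmf Dx z)^3) * (real s / real n)"
    and "integrable (data n) (\<lambda>D. \<bar>tree_mean logt n s x D - m x - linear_part (tree_levels logt) n s x D\<bar>)"
proof -
  interpret D: prob_space "data n" by (rule prob_space_data)
  define L where "L = tree_levels logt"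
  have s0: "0 < s" using s(2) by (cases s) auto
  define a where "a = forest_weight d L n s"
  define U where "U D = (\<Sum>k<n. a D x k * snd (D k)) - m x - linear_part L n s x D" for D
  define F where "F D = (\<integral>\<pi>. \<bar>U (D \<circ> \<pi>)\<bar> \<partial>measure_pmf (pmf_of_set {\<pi>. \<pi> permutes {..<n}}))" for D
  define G where "G D = measure_pmf.prob (base_tree d L n s D) {h. \<not> fully_grown D h} +
      measure_pmf.expectation (splits n s) (\<lambda>(J, H). of_bool (\<not> typical \<delta> J D) + of_bool (\<not> typical \<delta> H D)) +
      \<bar>(\<Sum>k<n. a D x k * residual (D k)) - linear_part L n s x D\<bar>" for D
  have G_int: "integrable (data n) G"
    unfolding G_def[abs_def] a_def L_def
    by (intro Bochner_Integration.integrable_add base_tree_not_fully_grown(2) not_typical_splits_integral(2)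
        noise_approx(2) s \<delta> s0)
  have bound: "AE D in data n. \<bar>\<bar>U D\<bar>\<bar> \<le> G D"
    using AE_data
  proof eventually_elim
    case (elim D)
    have "(\<Sum>k<n. a D x k) = 1"
      unfolding a_def using elim set_Dx by (intro sum_forest_weight_eq_1 d_pos s s0 x) auto
    \<comment> \<open>As the weights add up to 1, the target can be distributed over the samples and
      subtracted term by term.\<close>
    then have "m x = (\<Sum>k<n. a D x k * m x)" by (simp add: sum_distrib_right[symmetric])
    moreover have "(\<Sum>k<n. a D x k * snd (D k)) = (\<Sum>k<n. a D x k * m (fst (D k))) + (\<Sum>k<n. a D x k * residual (D k))"
      by (simp add: residual_def sum.distrib[symmetric] algebra_simps)
    ultimately have "U D = (\<Sum>k<n. a D x k * (m (fst (D k)) - m x)) + ((\<Sum>k<n. a D x k * residual (D k)) - linear_part L n s x D)"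
      unfolding U_def right_diff_distrib sum_subtractf by linarith
    moreover have "\<bar>\<Sum>k<n. a D x k * (m (fst (D k)) - m x)\<bar> \<le>
      measure_pmf.prob (base_tree d L n s D) {h. \<not> fully_grown D h} +
      measure_pmf.expectation (splits n s) (\<lambda>(J, H). of_bool (\<not> typical \<delta> J D) + of_bool (\<not> typical \<delta> H D))"
      unfolding a_def using elim by (intro bias_pointwise[OF sparse x z0 \<delta>(2) V s]) auto
    ultimately show ?case unfolding G_def by linarith
  qed
  have Um: "U \<in> borel_measurable (data n)"
  proof -
    have "(\<lambda>D. \<Sum>k<n. a D x k * snd (D k)) \<in> borel_measurable (data n)"
      unfolding a_def
      by (intro borel_measurable_sum borel_measurable_times component_measurable[OF _ snd_Z_measurable]
          forest_weight_measurable[OF samples_measurable_data d_pos s(1)]) auto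
    then show ?thesis
      unfolding U_def[abs_def]
      by (intro borel_measurable_diff linear_part_measurable borel_measurable_const)
  qed
  then have Uam: "(\<lambda>D. \<bar>U D\<bar>) \<in> borel_measurable (data n)" by (rule borel_measurable_abs)
  note U_int = D.integral_le_of_AE(1)[OF Uam G_int bound]
  note F_int = average_over_permutations(2)[OF U_int, folded F_def]
  have "tree_mean logt n s x D - m x - linear_part L n s x D = (\<integral>\<pi>. U (D \<circ> \<pi>) \<partial>measure_pmf (pmf_of_set {\<pi>. \<pi> permutes {..<n}}))" for D
  proof -
    let ?Q = "{\<pi>. \<pi> permutes {..<n}}"
    have fin: "finite (set_pmf (pmf_of_set ?Q))" using permutes_finite_nonempty[of n] by simp
    have "tree_mean logt n s x D = measure_pmf.expectation (pmf_of_set ?Q) (\<lambda>\<pi>. \<Sum>k<n. a (D \<circ> \<pi>) x k * snd ((D \<circ> \<pi>) k))"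
      unfolding tree_mean_def expectation_random_tree[OF d_pos s(1)]
    proof (rule expectation_cong_pmf)
      fix \<pi> :: "nat \<Rightarrow> nat" assume "\<pi> \<in> set_pmf (pmf_of_set ?Q)"
      then have "inj \<pi>" using permutes_finite_nonempty[of n] permutes_inj by auto
      then have "measure_pmf.expectation (base_tree d (tree_levels logt) n s (D \<circ> \<pi>)) (\<lambda>(H, P). tree_predict D (\<pi> ` H, P) x) =
          measure_pmf.expectation (base_tree d (tree_levels logt) n s (D \<circ> \<pi>)) (\<lambda>h. tree_predict (D \<circ> \<pi>) h x)"
        by (intro expectation_cong_pmf) (auto simp: tree_predict_image simp del: tree_predict.simps)
      then show "measure_pmf.expectation (base_tree d (tree_levels logt) n s (D \<circ> \<pi>)) (\<lambda>(H, P). tree_predict D (\<pi> ` H, P) x) =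
          (\<Sum>k<n. a (D \<circ> \<pi>) x k * snd ((D \<circ> \<pi>) k))"
        unfolding expectation_base_tree_predict[OF d_pos s(1)] a_def L_def .
    qed
    moreover have "measure_pmf.expectation (pmf_of_set ?Q) (\<lambda>\<pi>. linear_part L n s x (D \<circ> \<pi>)) =
        measure_pmf.expectation (pmf_of_set ?Q) (\<lambda>_. linear_part L n s x D)"
      using permutes_finite_nonempty[of n] by (intro expectation_cong_pmf) (auto intro: linear_part_permutes)
    ultimately show ?thesis
      unfolding U_def by (simp add: integrable_measure_pmf_finite[OF fin])
  qed
  then have le: "\<bar>tree_mean logt n s x D - m x - linear_part L n s x D\<bar> \<le> F D" for D
    unfolding F_def using permutes_finite_nonempty[of n] by (simp add: abs_expectation_le_finite)
  have meas: "(\<lambda>D. \<bar>tree_mean logt n s x D - m x - linear_part L n s x D\<bar>) \<in> borel_measurable (data n)"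
    by (intro borel_measurable_abs borel_measurable_diff tree_mean_measurable linear_part_measurable borel_measurable_const s(1))
  have AE: "AE D in data n. \<bar>\<bar>tree_mean logt n s x D - m x - linear_part L n s x D\<bar>\<bar> \<le> F D"
    using le by simp
  show "integrable (data n) (\<lambda>D. \<bar>tree_mean logt n s x D - m x - linear_part (tree_levels logt) n s x D\<bar>)"
    using D.integral_le_of_AE(1)[OF meas F_int AE] by (simp add: L_def)
  have "(\<integral>D. \<bar>tree_mean logt n s x D - m x - linear_part L n s x D\<bar> \<partial>data n) \<le> (\<integral>D. F D \<partial>data n)"
    by (rule D.integral_le_of_AE(2)[OF meas F_int AE])
  also have "\<dots> = (\<integral>D. \<bar>U D\<bar> \<partial>data n)"
    unfolding F_def by (rule average_over_permutations(1)[OF U_int])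
  also have "\<dots> \<le> (\<integral>D. G D \<partial>data n)" by (rule D.integral_le_of_AE(2)[OF Uam G_int bound])
  also have "\<dots> = not_fully_grown_prob d Dx \<E> m logt n s +
      (\<integral>D. measure_pmf.expectation (splits n s) (\<lambda>(J, H). of_bool (\<not> typical \<delta> J D) + of_bool (\<not> typical \<delta> H D)) \<partial>data n) +
      (\<integral>D. \<bar>(\<Sum>k<n. a D x k * residual (D k)) - linear_part L n s x D\<bar> \<partial>data n)"
    unfolding G_def a_def L_def base_tree_not_fully_grown(1)[OF s(1), symmetric]
    by (simp only: Bochner_Integration.integral_add Bochner_Integration.integrable_add
        base_tree_not_fully_grown(2)[OF s(1)] not_typical_splits_integral(2)[OF s(1,2) \<delta>(1)]
        noise_approx(2)[OF s0 s(1)])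
  also have "\<dots> \<le> not_fully_grown_prob d Dx \<E> m logt n s + 8 * real (card (set_pmf Dx)) * exp (- \<delta>\<^sup>2 * real (s div 2) / 2)
      + (\<Sum>z\<in>set_pmf Dx. 10 / (pmf Dx z)^3) * (real s / real n)"
    unfolding a_def by (intro add_mono order_refl not_typical_splits_integral(1) noise_approx(1) s \<delta> s0)
  finally show "(\<integral>D. \<bar>tree_mean logt n s x D - m x - linear_part (tree_levels logt) n s x D\<bar> \<partial>data n) \<le>
      not_fully_grown_prob d Dx \<E> m logt n s + 8 * real (card (set_pmf Dx)) * exp (- \<delta>\<^sup>2 * real (s div 2) / 2)
      + (\<Sum>z\<in>set_pmf Dx. 10 / (pmf Dx z)^3) * (real s / real n)"
    by (simp add: L_def)
qed

text \<open>Given the data, the trees are independent with mean \<open>tree_mean\<close>, and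
  responses of absolute value at most 1/2 + 1/2 bound every prediction by 1.\<close>

lemma mc_forest_error:
  assumes s: "s \<le> n" and B: "0 < B"
  shows "AE D in data n. measure_pmf.expectation (mc_forest d logt n s B x D) (\<lambda>v. \<bar>v - tree_mean logt n s x D\<bar>) \<le> 1 / sqrt (real B)"
  using AE_data
proof eventually_elim
  case (elim D)
  \<comment> \<open>The kernel lemma for data that are constant on a one-point space serves only to
    locate the finite support.\<close>
  have fk: "finite_kernel (count_space UNIV :: unit measure) (Pow {..<n} \<times> Pow (Pow (cube d))) (\<lambda>_. random_tree d logt n s D)"
    by (rule random_tree_kernel[OF _ d_pos s, of _ "\<lambda>_. D"]) (simp add: samples_measurable_def space_pair_measure)
  then have fin: "finite (set_pmf (random_tree d logt n s D))"
    unfolding finite_kernel_def by (auto intro: finite_subset)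
  have "\<bar>tree_predict D h x\<bar> \<le> 1" if "h \<in> set_pmf (random_tree d logt n s D)" for h
  proof -
    obtain H P where h: "h = (H, P)" by (cases h)
    have H: "H \<subseteq> {..<n}" using fk that unfolding h finite_kernel_def by auto
    have "\<bar>tree_predict D (H, P) x\<bar> \<le> (\<Sum>k<n. tree_weight D H P x k)"
      unfolding tree_predict_eq_sum_weight[OF finite_lessThan H]
    proof (intro sum_abs[THEN order_trans] sum_mono)
      fix k assume k: "k \<in> {..<n}"
      then have "fst (D k) \<in> set_pmf Dx" "\<bar>residual (D k)\<bar> \<le> 1/2" using elim by auto
      moreover from this have "\<bar>m (fst (D k))\<bar> \<le> 1/2" using set_Dx by (intro m_bound) auto
      moreover have "\<bar>snd (D k)\<bar> \<le> \<bar>residual (D k)\<bar> + \<bar>m (fst (D k))\<bar>" by (simp add: residual_def)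
      ultimately have "\<bar>snd (D k)\<bar> \<le> 1" by linarith
      from mult_left_mono[OF this tree_weight_nonneg[of D H P x k]]
      show "\<bar>tree_weight D H P x k * snd (D k)\<bar> \<le> tree_weight D H P x k"
        by (simp add: abs_mult tree_weight_nonneg)
    qed
    also have "\<dots> \<le> 1" by (rule sum_tree_weight_le_1[OF finite_lessThan H])
    finally show ?thesis by (simp add: h)
  qed
  from replicate_pmf_mean_error[OF fin this B] show ?case
    by (simp add: mc_forest_def tree_mean_def)
qed

end

section \<open>Asymptotic normality\<close>

text \<open>A central limit theorem for rows of \<open>n\<close> independent copies whose law
  changes with \<open>n\<close>. The uniform bound \<open>b n\<close> reduces the third absolute
  moment to the second, as in Lyapunov's condition.\<close>

lemma (in prob_space) char_power_tendsto:
  fixes X :: "nat \<Rightarrow> 'a \<Rightarrow> real" and b :: "nat \<Rightarrow> real"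
  assumes meas [measurable]: "\<And>n. random_variable borel (X n)"
    and mean: "\<And>n. expectation (X n) = 0"
    and var: "\<forall>\<^sub>F n in sequentially. expectation (\<lambda>x. (X n x)\<^sup>2) = 1 / real n"
    and bound: "\<forall>\<^sub>F n in sequentially. AE x in M. \<bar>X n x\<bar> \<le> b n"
    and b: "b \<longlonglongrightarrow> 0"
  shows "(\<lambda>n. (char (distr M borel (X n)) t) ^ n) \<longlonglongrightarrow> complex_of_real (exp (- (t\<^sup>2) / 2))"
proof -
  define \<phi> where "\<phi> n = char (distr M borel (X n)) t" for n
  have main: "\<forall>\<^sub>F n in sequentially.
      cmod (\<phi> n ^ n - complex_of_real ((1 + (- (t\<^sup>2) / 2) / real n) ^ n)) \<le> t\<^sup>2 / 6 * (\<bar>t\<bar> * b n)"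
    \<comment> \<open>From \<open>t\<^sup>2 / 4\<close> on, the number
      \<open>1 - t\<^sup>2 / (2 * n)\<close> lies in \<open>{-1..1}\<close>, as the comparison of
      powers requires.\<close>
    using var bound eventually_ge_at_top[of "nat \<lceil>t\<^sup>2 / 4\<rceil>"] eventually_gt_at_top[of 0]
  proof eventually_elim
    case (elim n)
    have n: "t\<^sup>2 / 4 \<le> real n" "0 < real n" using elim(3,4) by (simp_all add: nat_ceiling_le_eq)
    have Xi: "integrable M (X n)" by (rule integrable_const_bound[of _ "b n"]) (use elim(2) in auto)
    have X2i: "integrable M (\<lambda>x. (X n x)\<^sup>2)"
    proof (rule integrable_const_bound[of _ "(b n)\<^sup>2"])
      show "AE x in M. norm ((X n x)\<^sup>2) \<le> (b n)\<^sup>2"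
        using elim(2)
      proof eventually_elim
        case (elim x)
        then show ?case using power_mono[OF elim abs_ge_zero, of 2] by simp
      qed
    qed simp
    interpret d: real_distribution "distr M borel (X n)" by (rule real_distribution_distr) simp
    have "cmod (\<phi> n - (1 - t\<^sup>2 * (1 / real n) / 2)) \<le>
        (t\<^sup>2 / 6) * expectation (\<lambda>x. min (6 * (X n x)\<^sup>2) (\<bar>t\<bar> * \<bar>X n x\<bar> ^ 3))"
      unfolding \<phi>_def using elim(1) mean Xi X2i by (intro char_approx3') auto
    also have "\<dots> \<le> (t\<^sup>2 / 6) * expectation (\<lambda>x. \<bar>t\<bar> * b n * (X n x)\<^sup>2)"
    proof (intro mult_left_mono integral_mono_AE)
      have "\<bar>min (6 * (X n x)\<^sup>2) (\<bar>t\<bar> * \<bar>X n x\<bar> ^ 3)\<bar> \<le> 6 * (X n x)\<^sup>2" for x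
        by (simp add: min_def)
      then show "integrable M (\<lambda>x. min (6 * (X n x)\<^sup>2) (\<bar>t\<bar> * \<bar>X n x\<bar> ^ 3))"
        by (intro Bochner_Integration.integrable_bound[OF integrable_mult_right[OF X2i, of 6]]) auto
      show "AE x in M. min (6 * (X n x)\<^sup>2) (\<bar>t\<bar> * \<bar>X n x\<bar> ^ 3) \<le> \<bar>t\<bar> * b n * (X n x)\<^sup>2"
        using elim(2)
      proof eventually_elim
        case (elim x)
        have "\<bar>t\<bar> * \<bar>X n x\<bar> ^ 3 = \<bar>t\<bar> * \<bar>X n x\<bar> * (X n x)\<^sup>2"
          by (simp add: power3_eq_cube power2_eq_square)
        also have "\<dots> \<le> \<bar>t\<bar> * b n * (X n x)\<^sup>2"
          using elim by (intro mult_right_mono mult_left_mono) auto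
        finally show ?case by simp
      qed
    qed (use X2i in auto)
    also have "\<dots> = t\<^sup>2 / 6 * (\<bar>t\<bar> * b n / real n)" using elim(1) by simp
    finally have **: "cmod (\<phi> n - complex_of_real (1 + (- (t\<^sup>2) / 2) / real n)) \<le> t\<^sup>2 / 6 * (\<bar>t\<bar> * b n / real n)"
      by (simp add: mult.commute)
    \<comment> \<open>In the unit disc, \<open>n\<close>-th powers differ by at most
      \<open>n\<close> times the difference of the bases; this is why the error of one factor has to
      be \<open>o(1 / n)\<close>.\<close>
    have "cmod (\<phi> n ^ n - (complex_of_real (1 + (- (t\<^sup>2) / 2) / real n)) ^ n) \<le>
         real n * cmod (\<phi> n - complex_of_real (1 + (- (t\<^sup>2) / 2) / real n))"
    proof (rule norm_power_diff)
      show "norm (\<phi> n) \<le> 1" unfolding \<phi>_def by (rule d.cmod_char_le_1)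
      have "\<bar>1 + (- (t\<^sup>2) / 2) / real n\<bar> \<le> 1" using n by (intro abs_leI) (auto simp: field_simps)
      then show "norm (complex_of_real (1 + (- (t\<^sup>2) / 2) / real n)) \<le> 1" by (simp only: norm_of_real)
    qed
    also have "\<dots> \<le> real n * (t\<^sup>2 / 6 * (\<bar>t\<bar> * b n / real n))"
      by (rule mult_left_mono[OF **]) simp
    also have "\<dots> = t\<^sup>2 / 6 * (\<bar>t\<bar> * b n)" using n by simp
    finally show ?case by simp
  qed
  have "(\<lambda>n. t\<^sup>2 / 6 * (\<bar>t\<bar> * b n)) \<longlonglongrightarrow> t\<^sup>2 / 6 * (\<bar>t\<bar> * 0)" by (intro tendsto_intros b)
  then have lim0: "(\<lambda>n. t\<^sup>2 / 6 * (\<bar>t\<bar> * b n)) \<longlonglongrightarrow> 0" by simp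
  have "(\<lambda>n. complex_of_real ((1 + (- (t\<^sup>2) / 2) / real n) ^ n)) \<longlonglongrightarrow> complex_of_real (exp (- (t\<^sup>2) / 2))"
    by (rule isCont_tendsto_compose[OF _ tendsto_exp_limit_sequentially]) auto
  from tendsto_add[OF Lim_null_comparison[OF main lim0] this] show ?thesis
    by (simp add: \<phi>_def)
qed

section \<open>The variance of the linear term\<close>

context regression
begin

text \<open>The noise is independent of the covariates, so the conditional variance is the same at
  every point.\<close>

lemma response_variance_eq_noise_var: "response_variance \<E> m z = noise_var"
proof -
  have meas: "(\<lambda>e. m z + e) \<in> borel_measurable \<E>"
    by (simp add: measurable_cong_sets[OF sets_\<E> refl])
  have "AE e in \<E>. norm e \<le> 1/2" using AE_\<E> by eventually_elim (auto simp: abs_le_iff)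
  then have int: "integrable \<E> (\<lambda>e. e)"
    by (rule noise.integrable_const_bound) (simp add: measurable_cong_sets[OF sets_\<E> refl])
  have "(\<integral>e. m z + e \<partial>\<E>) = m z" using int by (simp add: mean_\<E> noise.prob_space)
  then have "(\<integral>y. y \<partial>response_law \<E> m z) = m z"
    unfolding response_law_def by (simp add: integral_distr[OF meas])
  then show ?thesis
    unfolding response_variance_def noise_var_def unfolding response_law_def
    by (simp add: integral_distr[OF meas])
qed

text \<open>The bound depends on \<open>Dx\<close> alone, so it is uniform in \<open>n\<close>,
  \<open>s\<close> and the number of levels; this gives bounded summands in the limit
  theorem.\<close>

lemma influence_bounds:
  assumes "s \<le> n"
  shows "0 \<le> influence L n s x z" "influence L n s x z \<le> (\<Sum>z\<in>set_pmf Dx. 1 / pmf Dx z)"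
proof -
  note mean_class_weight_bounds[OF assms, of L x z]
  then show "0 \<le> influence L n s x z" by (simp add: influence_def)
  show "influence L n s x z \<le> (\<Sum>z\<in>set_pmf Dx. 1 / pmf Dx z)"
  proof (cases "z \<in> set_pmf Dx")
    case True
    have "influence L n s x z \<le> 1 / pmf Dx z"
      unfolding influence_def using mean_class_weight_bounds[OF assms] by (intro divide_right_mono) auto
    also have "\<dots> \<le> (\<Sum>z\<in>set_pmf Dx. 1 / pmf Dx z)"
      using True finite_set_Dx by (intro member_le_sum) auto
    finally show ?thesis .
  next
    case False
    then have "influence L n s x z = 0" by (simp add: influence_def pmf_eq_0_set_pmf)
    then show ?thesis by (simp add: sum_nonneg)
  qed
qed

text \<open>The factor \<open>pmf Dx z\<close> cancels and leaves the mean of the total weight,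
  which is 1 because no leaf is empty.\<close>

lemma influence_mean:
  assumes s: "0 < s" "s \<le> n" and x: "x \<in> cube d"
  shows "measure_pmf.expectation Dx (influence L n s x) = 1"
proof -
  interpret D: prob_space "data n" by (rule prob_space_data)
  have "measure_pmf.expectation Dx (influence L n s x) = (\<Sum>z\<in>set_pmf Dx. influence L n s x z * pmf Dx z)"
    by (rule integral_measure_pmf_real[OF finite_set_Dx]) auto
  also have "\<dots> = (\<Sum>z\<in>set_pmf Dx. mean_class_weight L n s x z)"
    by (intro sum.cong refl) (simp add: influence_def pmf_eq_0_set_pmf)
  also have "\<dots> = (\<integral>D. (\<Sum>z\<in>set_pmf Dx. class_weight L n s x z D) \<partial>data n)"
    unfolding mean_class_weight_def
    by (intro Bochner_Integration.integral_sum[symmetric] class_weight_integrable s)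
  also have "\<dots> = (\<integral>D. 1 \<partial>data n)"
  proof (rule integral_cong_AE)
    show "(\<lambda>D. \<Sum>z\<in>set_pmf Dx. class_weight L n s x z D) \<in> borel_measurable (data n)"
      by (intro borel_measurable_sum class_weight_measurable s)
    show "AE D in data n. (\<Sum>z\<in>set_pmf Dx. class_weight L n s x z D) = 1"
      using AE_data
    proof eventually_elim
      case (elim D)
      have "(\<Sum>k<n. forest_weight d L n s D x k) = (\<Sum>z\<in>set_pmf Dx. class_weight L n s x z D)"
        unfolding class_weight_def using elim finite_set_Dx
        by (subst sum.group[of "{..<n}" "set_pmf Dx" "\<lambda>k. fst (D k)", symmetric]) auto
      moreover have "(\<Sum>k<n. forest_weight d L n s D x k) = 1"
        using elim set_Dx by (intro sum_forest_weight_eq_1 d_pos s x) auto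
      ultimately show ?case by simp
    qed
  qed simp
  finally show ?thesis by (simp add: D.prob_space)
qed

definition influence_var :: "nat \<Rightarrow> nat \<Rightarrow> nat \<Rightarrow> bool list \<Rightarrow> real" where
  "influence_var L n s x = (\<integral>v. (influence L n s x (fst v) * residual v)\<^sup>2 \<partial>Z)"

lemma influence_AE_bound:
  assumes "s \<le> n"
  shows "AE v in Z. \<bar>influence L n s x (fst v) * residual v\<bar> \<le> (\<Sum>z\<in>set_pmf Dx. 1 / pmf Dx z)"
  using AE_Z
proof eventually_elim
  case (elim v)
  have "\<bar>influence L n s x (fst v)\<bar> \<le> (\<Sum>z\<in>set_pmf Dx. 1 / pmf Dx z)"
    using influence_bounds[OF assms, of L x "fst v"] by simp
  moreover have "\<bar>residual v\<bar> \<le> 1" using elim by linarith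
  ultimately have "\<bar>influence L n s x (fst v)\<bar> * \<bar>residual v\<bar> \<le> (\<Sum>z\<in>set_pmf Dx. 1 / pmf Dx z) * 1"
    by (intro mult_mono) (auto intro: sum_nonneg)
  then show ?case by (simp add: abs_mult)
qed

lemma influence_residual_measurable:
  "(\<lambda>v. influence L n s x (fst v) * residual v) \<in> borel_measurable Z"
  by (intro borel_measurable_times covariate_Z_measurable residual_measurable)

lemma influence_var_bounds:
  assumes s: "0 < s" "s \<le> n" and x: "x \<in> cube d"
  shows "noise_var \<le> influence_var L n s x"
    and "influence_var L n s x \<le> (\<Sum>z\<in>set_pmf Dx. 1 / pmf Dx z)\<^sup>2"
proof -
  define f where "f = influence L n s x"
  note int = integrable_measure_pmf_finite[OF finite_set_Dx]
  \<comment> \<open>A density with mean 1 has second moment at least 1, by expanding the mean of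
    \<open>(f - 1)\<^sup>2\<close>. Without this the variance could degenerate.\<close>
  have "0 \<le> measure_pmf.expectation Dx (\<lambda>z. (f z - 1)\<^sup>2)" by (intro expectation_nonneg_pmf) simp
  also have "\<dots> = measure_pmf.expectation Dx (\<lambda>z. (f z)\<^sup>2 - 2 * f z + 1)"
    by (intro Bochner_Integration.integral_cong refl) (simp add: power2_eq_square algebra_simps)
  also have "\<dots> = measure_pmf.expectation Dx (\<lambda>z. (f z)\<^sup>2) - 2 * measure_pmf.expectation Dx f + 1"
    by (simp add: int)
  finally have "1 \<le> measure_pmf.expectation Dx (\<lambda>z. (f z)\<^sup>2)"
    using influence_mean[OF s x, of L] by (simp add: f_def)
  moreover have "0 \<le> noise_var" unfolding noise_var_def by (intro integral_nonneg_AE) simp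
  ultimately have "1 * noise_var \<le> measure_pmf.expectation Dx (\<lambda>z. (f z)\<^sup>2) * noise_var"
    by (intro mult_right_mono)
  then show "noise_var \<le> influence_var L n s x"
    by (simp add: influence_var_def integral_Z_residual_sq f_def)
  define C where "C = (\<Sum>z\<in>set_pmf Dx. 1 / pmf Dx z)"
  have "AE v in Z. \<bar>(influence L n s x (fst v) * residual v)\<^sup>2\<bar> \<le> C\<^sup>2"
    using influence_AE_bound[OF s(2), of L x]
  proof eventually_elim
    case (elim v)
    then show ?case using power_mono[OF elim abs_ge_zero, of 2] by (simp add: C_def)
  qed
  then have "influence_var L n s x \<le> (\<integral>v. C\<^sup>2 \<partial>Z)"
    unfolding influence_var_def
    by (intro Z.integral_le_of_AE(2)) (auto intro: borel_measurable_power influence_residual_measurable)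
  then show "influence_var L n s x \<le> C\<^sup>2" using Z.prob_space by simp
qed

section \<open>The law of the forest and its characteristic function\<close>

lemma finite_set_pmf_mc_forest:
  assumes "s \<le> n"
  shows "finite (set_pmf (mc_forest d logt n s B x D))"
proof -
  have fk: "finite_kernel (count_space UNIV :: unit measure) (Pow {..<n} \<times> Pow (Pow (cube d))) (\<lambda>_. random_tree d logt n s D)"
    by (rule random_tree_kernel[OF _ d_pos assms, of _ "\<lambda>_. D"]) (simp add: samples_measurable_def space_pair_measure)
  from finite_kernel_replicate[OF this, of B] have "finite (set_pmf (replicate_pmf B (random_tree d logt n s D)))"
    unfolding finite_kernel_def by (auto intro: finite_subset)
  then show ?thesis by (simp add: mc_forest_def)
qed

abbreviation forest_law :: "real \<Rightarrow> nat \<Rightarrow> nat \<Rightarrow> nat \<Rightarrow> bool list \<Rightarrow> real measure" where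
  "forest_law logt n s B x \<equiv> mc_forest_law d Dx \<E> m logt n s B x"

lemma data_not_empty: "space (data n) \<noteq> {}"
  by (rule prob_space.not_empty[OF prob_space_data])

lemma prob_space_forest_law:
  assumes "s \<le> n"
  shows "prob_space (forest_law logt n s B x)" "sets (forest_law logt n s B x) = sets borel"
proof -
  interpret D: prob_space "data n" by (rule prob_space_data)
  note K = mc_forest_kernel_measurable[OF samples_measurable_data d_pos assms, of logt B x]
  show "sets (forest_law logt n s B x) = sets borel"
    unfolding mc_forest_law_def by (rule sets_bind[OF _ data_not_empty]) simp
  show "prob_space (forest_law logt n s B x)"
    unfolding mc_forest_law_def
    by (rule D.prob_space_bind[OF _ K]) (intro AE_I2 measure_pmf.prob_space_distr, simp)
qed

lemma integral_forest_law:
  fixes f :: "real \<Rightarrow> real"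
  assumes s: "s \<le> n" and f: "f \<in> borel_measurable borel" "\<And>v. \<bar>f v\<bar> \<le> 1"
  shows "(\<integral>v. f v \<partial>forest_law logt n s B x) = (\<integral>D. measure_pmf.expectation (mc_forest d logt n s B x D) f \<partial>data n)"
proof -
  interpret D: prob_space "data n" by (rule prob_space_data)
  note K = mc_forest_kernel_measurable[OF samples_measurable_data d_pos s, of logt B x]
  have "(\<integral>v. f v \<partial>forest_law logt n s B x) =
      (\<integral>D. (\<integral>v. f v \<partial>distr (measure_pmf (mc_forest d logt n s B x D)) borel (\<lambda>v. v)) \<partial>data n)"
    unfolding mc_forest_law_def
  proof (rule integral_bind[OF f(1) f(2) K])
    show "AE D in data n. emeasure (distr (measure_pmf (mc_forest d logt n s B x D)) borel (\<lambda>v. v))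
        (space (distr (measure_pmf (mc_forest d logt n s B x D)) borel (\<lambda>v. v))) \<le> ennreal 1"
      by (simp add: emeasure_distr)
  qed unfold_locales
  then show ?thesis using f(1) by (simp add: integral_distr)
qed

text \<open>A 1-Lipschitz test function turns the mean distance between forest and linear term,
  Monte Carlo error plus \<open>\<eta>\<close>, into a bound for the difference of expectations,
  although the two live on different probability spaces.\<close>

lemma forest_law_compare:
  fixes f :: "real \<Rightarrow> real"
  assumes s: "s \<le> n" and B: "0 < B" and \<sigma>: "0 < \<sigma>"
    and f: "f \<in> borel_measurable borel" "\<And>v. \<bar>f v\<bar> \<le> 1" "\<And>a b. \<bar>f a - f b\<bar> \<le> \<bar>a - b\<bar>"
    and \<eta>: "(\<integral>D. \<bar>tree_mean logt n s x D - m x - linear_part L n s x D\<bar> \<partial>data n) \<le> \<eta>"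
      "integrable (data n) (\<lambda>D. \<bar>tree_mean logt n s x D - m x - linear_part L n s x D\<bar>)"
  shows "\<bar>(\<integral>v. f (t * ((v - m x) / \<sigma>)) \<partial>forest_law logt n s B x) - (\<integral>D. f (t * (linear_part L n s x D / \<sigma>)) \<partial>data n)\<bar>
    \<le> \<bar>t\<bar> / \<sigma> * (1 / sqrt (real B) + \<eta>)"
proof -
  interpret D: prob_space "data n" by (rule prob_space_data)
  define g where "g v = f (t * ((v - m x) / \<sigma>))" for v
  define l where "l D = f (t * (linear_part L n s x D / \<sigma>))" for D
  define E where "E D = measure_pmf.expectation (mc_forest d logt n s B x D) g" for D
  have g: "g \<in> borel_measurable borel" "\<And>v. \<bar>g v\<bar> \<le> 1"
    using f by (auto simp: g_def[abs_def])
  have lm: "l \<in> borel_measurable (data n)"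
    unfolding l_def[abs_def]
    by (rule measurable_compose[OF _ f(1)]) (use linear_part_measurable[of L n s x] in measurable)
  have li: "integrable (data n) l"
    by (rule D.integrable_const_bound[OF _ lm, of 1]) (simp add: l_def f)
  have Em: "E \<in> borel_measurable (data n)"
    unfolding E_def[abs_def] using g(1)
    by (intro mc_forest_expectation_measurable[OF samples_measurable_data d_pos s]) simp
  have Eb: "\<bar>E D\<bar> \<le> 1" for D
  proof -
    note fin = finite_set_pmf_mc_forest[OF s, of logt B x D]
    have "\<bar>E D\<bar> \<le> measure_pmf.expectation (mc_forest d logt n s B x D) (\<lambda>v. \<bar>g v\<bar>)"
      unfolding E_def by (rule abs_expectation_le_finite[OF fin])
    also have "\<dots> \<le> measure_pmf.expectation (mc_forest d logt n s B x D) (\<lambda>_. 1)"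
      using g(2) by (intro expectation_mono_finite fin) auto
    finally show ?thesis by simp
  qed
  have Ei: "integrable (data n) E"
    by (rule D.integrable_const_bound[OF _ Em, of 1]) (simp add: Eb)
  define G where "G D = \<bar>t\<bar> / \<sigma> * (1 / sqrt (real B) + \<bar>tree_mean logt n s x D - m x - linear_part L n s x D\<bar>)" for D
  have Gi: "integrable (data n) G"
    unfolding G_def by (intro integrable_mult_right Bochner_Integration.integrable_add \<eta>(2)) simp
  have AE: "AE D in data n. \<bar>E D - l D\<bar> \<le> G D"
    using mc_forest_error[OF s B, of logt x]
  proof eventually_elim
    case (elim D)
    define p where "p = mc_forest d logt n s B x D"
    note fin = finite_set_pmf_mc_forest[OF s, of logt B x D, folded p_def]
    note int = integrable_measure_pmf_finite[OF fin]
    define \<Delta> where "\<Delta> = \<bar>tree_mean logt n s x D - m x - linear_part L n s x D\<bar>"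
    have "E D - l D = measure_pmf.expectation p (\<lambda>v. g v - l D)"
      unfolding E_def p_def[symmetric] by (simp add: int)
    also have "\<bar>\<dots>\<bar> \<le> measure_pmf.expectation p (\<lambda>v. \<bar>g v - l D\<bar>)"
      by (rule abs_expectation_le_finite[OF fin])
    also have "\<dots> \<le> measure_pmf.expectation p (\<lambda>v. \<bar>t\<bar> / \<sigma> * (\<bar>v - tree_mean logt n s x D\<bar> + \<Delta>))"
    proof (intro expectation_mono_finite fin)
      fix v
      have "\<bar>g v - l D\<bar> \<le> \<bar>t * ((v - m x) / \<sigma>) - t * (linear_part L n s x D / \<sigma>)\<bar>"
        unfolding g_def l_def by (rule f(3))
      also have "t * ((v - m x) / \<sigma>) - t * (linear_part L n s x D / \<sigma>) = t / \<sigma> * (v - m x - linear_part L n s x D)"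
        using \<sigma> by (simp add: field_simps)
      also have "\<bar>\<dots>\<bar> = \<bar>t\<bar> / \<sigma> * \<bar>v - m x - linear_part L n s x D\<bar>" using \<sigma> by (simp add: abs_mult)
      also have "\<dots> \<le> \<bar>t\<bar> / \<sigma> * (\<bar>v - tree_mean logt n s x D\<bar> + \<Delta>)"
        unfolding \<Delta>_def using \<sigma> by (intro mult_left_mono) auto
      finally show "\<bar>g v - l D\<bar> \<le> \<bar>t\<bar> / \<sigma> * (\<bar>v - tree_mean logt n s x D\<bar> + \<Delta>)" .
    qed
    also have "\<dots> = \<bar>t\<bar> / \<sigma> * (measure_pmf.expectation p (\<lambda>v. \<bar>v - tree_mean logt n s x D\<bar>) + \<Delta>)"
      by (simp add: int)
    also have "\<dots> \<le> G D"
      unfolding G_def \<Delta>_def[symmetric] using elim \<sigma> by (intro mult_left_mono add_right_mono) (auto simp: p_def)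
    finally show ?case .
  qed
  have "(\<integral>v. g v \<partial>forest_law logt n s B x) - (\<integral>D. l D \<partial>data n) = (\<integral>D. E D - l D \<partial>data n)"
    unfolding integral_forest_law[OF s g] E_def[symmetric] using Ei li by simp
  also have "\<bar>\<dots>\<bar> \<le> (\<integral>D. \<bar>E D - l D\<bar> \<partial>data n)" by (rule integral_abs_bound)
  also have "\<dots> \<le> (\<integral>D. G D \<partial>data n)"
    using AE Em lm by (intro D.integral_le_of_AE(2)[OF _ Gi]) auto
  also have "\<dots> = \<bar>t\<bar> / \<sigma> * (1 / sqrt (real B) + (\<integral>D. \<bar>tree_mean logt n s x D - m x - linear_part L n s x D\<bar> \<partial>data n))"
    unfolding G_def using \<eta>(2) by (simp add: D.prob_space)
  also have "\<dots> \<le> \<bar>t\<bar> / \<sigma> * (1 / sqrt (real B) + \<eta>)"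
    using \<eta>(1) \<sigma> by (intro mult_left_mono add_left_mono) auto
  finally show ?thesis unfolding g_def l_def .
qed

text \<open>Cosine and sine are bounded 1-Lipschitz functions, so the comparison applies to real and
  imaginary part separately; this is the factor 2. By independence of the samples the characteristic
  function of the linear term is an \<open>n\<close>-th power.\<close>

lemma forest_char_compare:
  assumes s: "s \<le> n" and B: "0 < B" and \<sigma>: "0 < \<sigma>" and n: "0 < n"
    and \<eta>: "(\<integral>D. \<bar>tree_mean logt n s x D - m x - linear_part L n s x D\<bar> \<partial>data n) \<le> \<eta>"
      "integrable (data n) (\<lambda>D. \<bar>tree_mean logt n s x D - m x - linear_part L n s x D\<bar>)"
  shows "cmod (char (distr (forest_law logt n s B x) borel (\<lambda>v. (v - m x) / \<sigma>)) t -
      (char (distr Z borel (\<lambda>v. influence L n s x (fst v) * residual v / (real n * \<sigma>))) t) ^ n)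
    \<le> 2 * (\<bar>t\<bar> / \<sigma> * (1 / sqrt (real B) + \<eta>))"
proof -
  interpret D: prob_space "data n" by (rule prob_space_data)
  interpret F: prob_space "forest_law logt n s B x" by (rule prob_space_forest_law[OF s])
  have Fm: "h \<in> borel_measurable (forest_law logt n s B x)" if "h \<in> borel_measurable borel" for h :: "real \<Rightarrow> real"
    using that by (simp add: measurable_cong_sets[OF prob_space_forest_law(2)[OF s] refl])
  define h where "h v = t * ((v - m x) / \<sigma>)" for v
  define l where "l D = t * (linear_part L n s x D / \<sigma>)" for D
  define X where "X v = influence L n s x (fst v) * residual v / (real n * \<sigma>)" for v
  have Xm: "X \<in> borel_measurable Z"
    unfolding X_def[abs_def] by (intro borel_measurable_divide influence_residual_measurable borel_measurable_const)
  have hm: "h \<in> borel_measurable borel" unfolding h_def[abs_def] by measurable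
  have lm: "l \<in> borel_measurable (data n)"
    unfolding l_def[abs_def] using linear_part_measurable[of L n s x] by measurable
  have char1: "char (distr (forest_law logt n s B x) borel (\<lambda>v. (v - m x) / \<sigma>)) t = (\<integral>v. iexp (h v) \<partial>forest_law logt n s B x)"
    unfolding char_def h_def by (subst integral_distr) (auto intro!: Fm)
  have iexp_int: "integrable M' (\<lambda>v. iexp (k v))" if "prob_space M'" "k \<in> borel_measurable M'" for M' :: "'z measure" and k
  proof -
    interpret M': prob_space M' by fact
    have "(\<lambda>v. iexp (k v)) \<in> borel_measurable M'" using that(2) by measurable
    then show ?thesis by (intro M'.integrable_const_bound[of _ 1]) auto
  qed
  have re_im: "Re (\<integral>v. iexp (k v) \<partial>M') = (\<integral>v. cos (k v) \<partial>M')" "Im (\<integral>v. iexp (k v) \<partial>M') = (\<integral>v. sin (k v) \<partial>M')"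
    if "prob_space M'" "k \<in> borel_measurable M'" for M' :: "'z measure" and k
    using integral_Re[OF iexp_int[OF that]] integral_Im[OF iexp_int[OF that]] by (simp_all add: Re_exp Im_exp)
  have "l D = (\<Sum>k<n. t * X (D k))" for D
    using n \<sigma> by (simp add: l_def linear_part_def X_def sum_distrib_left sum_divide_distrib mult_ac)
  then have "iexp (l D) = (\<Prod>k<n. iexp (t * X (D k)))" for D
    by (simp add: sum_distrib_left exp_sum[symmetric] of_real_sum)
  then have "(\<integral>D. iexp (l D) \<partial>data n) = (\<Prod>k<n. \<integral>v. iexp (t * X v) \<partial>Z)"
    using iexp_int[OF prob_space_Z, of "\<lambda>v. t * X v"] Xm
      integral_product[of n "\<lambda>_ v. iexp (t * X v)"] by simp
  also have "\<dots> = (char (distr Z borel X) t) ^ n"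
    using Xm by (simp add: char_def integral_distr)
  finally have char2: "(char (distr Z borel X) t) ^ n = (\<integral>D. iexp (l D) \<partial>data n)" by simp
  have sin_lip: "\<bar>sin a - sin b\<bar> \<le> \<bar>a - b\<bar>" for a b :: real
  proof -
    have "\<bar>sin a - sin b\<bar> = 2 * (\<bar>sin ((a - b) / 2)\<bar> * \<bar>cos ((a + b) / 2)\<bar>)"
      by (simp add: sin_diff_sin abs_mult)
    also have "\<dots> \<le> 2 * (\<bar>(a - b) / 2\<bar> * 1)"
      by (intro mult_left_mono mult_mono abs_sin_x_le_abs_x abs_cos_le_one) auto
    finally show ?thesis by simp
  qed
  have cos_lip: "\<bar>cos a - cos b\<bar> \<le> \<bar>a - b\<bar>" for a b :: real
    using sin_lip[of "pi / 2 - a" "pi / 2 - b"] by (simp add: sin_diff abs_minus_commute)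
  define \<Delta> where "\<Delta> = (\<integral>v. iexp (h v) \<partial>forest_law logt n s B x) - (\<integral>D. iexp (l D) \<partial>data n)"
  have "\<bar>Re \<Delta>\<bar> \<le> \<bar>t\<bar> / \<sigma> * (1 / sqrt (real B) + \<eta>)"
    unfolding \<Delta>_def minus_complex.sel re_im[OF F.prob_space_axioms Fm[OF hm]] re_im[OF prob_space_data lm]
    unfolding h_def l_def by (rule forest_law_compare[OF s B \<sigma> _ _ cos_lip \<eta>]) auto
  moreover have "\<bar>Im \<Delta>\<bar> \<le> \<bar>t\<bar> / \<sigma> * (1 / sqrt (real B) + \<eta>)"
    unfolding \<Delta>_def minus_complex.sel re_im[OF F.prob_space_axioms Fm[OF hm]] re_im[OF prob_space_data lm]
    unfolding h_def l_def by (rule forest_law_compare[OF s B \<sigma> _ _ sin_lip \<eta>]) auto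
  ultimately have "cmod \<Delta> \<le> 2 * (\<bar>t\<bar> / \<sigma> * (1 / sqrt (real B) + \<eta>))"
    using cmod_le[of \<Delta>] by linarith
  then show ?thesis unfolding char1 \<Delta>_def char2[symmetric] X_def .
qed

text \<open>The square of the logarithm matters: \<open>\<delta>\<close> depends on the model, and
  \<open>exp (- c' * log n)\<close> with small \<open>c'\<close> need not beat
  \<open>sqrt n\<close>, while \<open>exp (- c' * (log n)\<^sup>2)\<close> does for every
  \<open>c' > 0\<close>.\<close>

theorem forest_asymptotic_normality:
  fixes s B :: "nat \<Rightarrow> nat" and logt :: "nat \<Rightarrow> real"
  assumes sparse: "strongly_sparse d Dx m \<beta> r R" and \<beta>: "0 < \<beta>" and x: "x \<in> cube d"
    and class_x: "0 < measure_pmf.prob Dx {z. nths z R = nths x R}"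
    and \<sigma>: "0 < \<sigma>" "\<sigma>\<^sup>2 \<le> noise_var"
    and B: "\<forall>\<^sub>F n in sequentially. (real n)\<^sup>2 \<le> real (B n)"
    and full: "(\<lambda>n. not_fully_grown_prob d Dx \<E> m (logt n) n (s n)) \<in> o(\<lambda>n. 1 / sqrt (real n))"
    and c: "0 < c" and s_lower: "\<forall>\<^sub>F n in sequentially. c * (log 2 (real n))\<^sup>2 \<le> real (s n)"
    and s_upper: "(\<lambda>n. real (s n)) \<in> o(\<lambda>n. sqrt (real n))"
  shows "\<exists>\<sigma>n::nat \<Rightarrow> real. (\<forall>n. \<sigma>n n > 0) \<and>
    (\<lambda>n. (\<sigma>n n)\<^sup>2) \<in> O(\<lambda>n. (real (s n))\<^sup>2 / real n) \<and>
    weak_conv_m (\<lambda>n. distr (forest_law (logt n) n (s n) (B n) x) borel (\<lambda>v. (v - m x) / \<sigma>n n)) std_normal_distribution"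
proof -
  \<comment> \<open>The point \<open>x\<close> itself may have probability 0; a vector
    \<open>z0\<close> of positive probability in its class supplies the copies for the bias
    argument.\<close>
  have "{z. nths z R = nths x R} \<inter> set_pmf Dx \<noteq> {}"
    using class_x by (metis measure_empty measure_Int_set_pmf less_irrefl)
  then obtain z0 where z0: "z0 \<in> set_pmf Dx" "nths z0 R = nths x R" by blast
  define \<pi> where "\<pi> = pmf Dx z0"
  have \<pi>: "0 < \<pi>" using z0(1) by (simp add: \<pi>_def pmf_positive)
  obtain \<delta>0 where \<delta>0: "0 < \<delta>0" "\<forall>S\<in>Pow {..<d}. \<forall>J D. finite J \<longrightarrow> J \<noteq> {} \<longrightarrow> (\<forall>k\<in>J. fst (D k) \<in> set_pmf Dx) \<longrightarrow>
    typical \<delta>0 J D \<longrightarrow> \<bar>V_emp D J S - V_bar Dx m S\<bar> < \<beta> / 2"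
    using typical_V_emp[of "\<beta> / 2"] \<beta> by auto
  \<comment> \<open>\<open>\<delta>0\<close> controls the split criterion, \<open>\<pi> / 2\<close>
    the number of copies of \<open>z0\<close>.\<close>
  define \<delta> where "\<delta> = min \<delta>0 (\<pi> / 2)"
  have \<delta>: "0 < \<delta>" "\<delta> \<le> pmf Dx z0 / 2" using \<delta>0(1) \<pi> by (auto simp: \<delta>_def \<pi>_def)
  have typical_mono: "typical \<delta> J D \<Longrightarrow> typical \<delta>0 J D" for J D
    unfolding typical_def \<delta>_def by fastforce
  have V: "\<forall>S\<in>Pow {..<d}. \<forall>J D. finite J \<longrightarrow> J \<noteq> {} \<longrightarrow> (\<forall>k\<in>J. fst (D k) \<in> set_pmf Dx) \<longrightarrow>
    typical \<delta> J D \<longrightarrow> \<bar>V_emp D J S - V_bar Dx m S\<bar> < \<beta> / 2"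
    using \<delta>0(2) typical_mono by blast
  define C where "C = (\<Sum>z\<in>set_pmf Dx. 1 / pmf Dx z)"
  define C3 where "C3 = (\<Sum>z\<in>set_pmf Dx. 10 / (pmf Dx z)^3)"
  define L where "L n = tree_levels (logt n)" for n
  define good where "good n \<longleftrightarrow> 0 < n \<and> 0 < s n \<and> s n \<le> n" for n
  \<comment> \<open>The scale of the linear term, hence of exact order \<open>1 / sqrt n\<close> for
    good \<open>n\<close>. The default 1 keeps it positive at the finitely many other
    \<open>n\<close>.\<close>
  define \<sigma>n where "\<sigma>n n = (if good n then sqrt (influence_var (L n) n (s n) x / real n) else 1)" for n
  have var_pos: "\<sigma>\<^sup>2 \<le> influence_var (L n) n (s n) x" "influence_var (L n) n (s n) x \<le> C\<^sup>2" if "good n" for n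
    using influence_var_bounds[of "s n" n x "L n"] that x \<sigma>(2) by (auto simp: good_def C_def)
  have \<sigma>2: "0 < \<sigma>\<^sup>2" using \<sigma>(1) by simp
  have \<sigma>n_pos: "0 < \<sigma>n n" for n
    using less_le_trans[OF \<sigma>2 var_pos(1), of n] by (auto simp: \<sigma>n_def good_def)
  have \<sigma>n_sq: "(\<sigma>n n)\<^sup>2 = influence_var (L n) n (s n) x / real n" if "good n" for n
    using that less_le_trans[OF \<sigma>2 var_pos(1)[OF that]] by (simp add: \<sigma>n_def)
  have \<sigma>n_lower: "\<sigma> / sqrt (real n) \<le> \<sigma>n n" if "good n" for n
  proof -
    have "\<sigma> / sqrt (real n) = sqrt (\<sigma>\<^sup>2 / real n)" using \<sigma>(1) by (simp add: real_sqrt_divide)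
    also have "\<dots> \<le> \<sigma>n n" using that var_pos(1)[OF that] by (simp add: \<sigma>n_def divide_right_mono)
    finally show ?thesis .
  qed
  have s_ratio: "(\<lambda>n. real (s n) / sqrt (real n)) \<longlonglongrightarrow> 0"
    by (rule smalloD_tendsto[OF s_upper])
  have s_inf: "filterlim (\<lambda>n. real (s n)) at_top sequentially"
  proof (rule filterlim_at_top_mono[OF _ s_lower])
    show "filterlim (\<lambda>n. c * (log 2 (real n))\<^sup>2) at_top sequentially" using c by real_asymp
  qed
  \<comment> \<open>Beyond 4 both halves of the sub-sample are non-empty; beyond
    \<open>12 / \<pi>\<close> one has \<open>6 < s / 2 * \<pi>\<close>, the count needed in the
    estimation sample.\<close>
  define s0 where "s0 = max 4 (12 / \<pi>)"
  have ev_s: "\<forall>\<^sub>F n in sequentially. s0 < real (s n)"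
    using s_inf unfolding filterlim_at_top_dense by blast
  have ev_good: "\<forall>\<^sub>F n in sequentially. good n \<and> s0 < real (s n)"
    using ev_s order_tendstoD(2)[OF s_ratio zero_less_one] eventually_gt_at_top[of 0]
  proof eventually_elim
    case (elim n)
    then have "real (s n) < sqrt (real n)" by (simp add: field_simps)
    also have "\<dots> \<le> real n" using elim(3) self_le_power[of "real n" 2] by (intro real_le_lsqrt) auto
    finally show ?case using elim by (auto simp: good_def s0_def)
  qed
  have bigO: "(\<lambda>n. (\<sigma>n n)\<^sup>2) \<in> O(\<lambda>n. (real (s n))\<^sup>2 / real n)"
  proof (rule bigoI)
    show "\<forall>\<^sub>F n in sequentially. norm ((\<sigma>n n)\<^sup>2) \<le> C\<^sup>2 * norm ((real (s n))\<^sup>2 / real n)"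
      using ev_good
    proof eventually_elim
      case (elim n)
      have "1 \<le> (real (s n))\<^sup>2" using elim by (simp add: good_def)
      then have "C\<^sup>2 * 1 / real n \<le> C\<^sup>2 * (real (s n))\<^sup>2 / real n"
        by (intro divide_right_mono mult_left_mono) auto
      moreover have "(\<sigma>n n)\<^sup>2 \<le> C\<^sup>2 / real n"
        using \<sigma>n_sq var_pos(2) elim by (simp add: divide_right_mono)
      ultimately show ?case by simp
    qed
  qed
  define X where "X n v = influence (L n) n (s n) x (fst v) * residual v / (real n * \<sigma>n n)" for n v
  have char_lim: "(\<lambda>n. (char (distr Z borel (X n)) t) ^ n) \<longlonglongrightarrow> complex_of_real (exp (- (t\<^sup>2) / 2))" for t
  proof (rule Z.char_power_tendsto)
    show "X n \<in> borel_measurable Z" for n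
      unfolding X_def[abs_def] by (intro borel_measurable_divide influence_residual_measurable borel_measurable_const)
    show "(\<integral>v. X n v \<partial>Z) = 0" for n
      unfolding X_def using integral_Z_residual[of "influence (L n) n (s n) x"] by simp
    show "\<forall>\<^sub>F n in sequentially. (\<integral>v. (X n v)\<^sup>2 \<partial>Z) = 1 / real n"
      using ev_good
    proof eventually_elim
      case (elim n)
      have "(\<integral>v. (X n v)\<^sup>2 \<partial>Z) = influence_var (L n) n (s n) x / (real n * \<sigma>n n)\<^sup>2"
        unfolding X_def power_divide by (simp add: influence_var_def)
      also have "(real n * \<sigma>n n)\<^sup>2 = real n * influence_var (L n) n (s n) x"
        using \<sigma>n_sq[of n] elim unfolding power_mult_distrib by (simp add: power2_eq_square)
      also have "influence_var (L n) n (s n) x / \<dots> = 1 / real n"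
        using less_le_trans[OF \<sigma>2 var_pos(1)[of n]] elim by simp
      finally show ?case .
    qed
    show "\<forall>\<^sub>F n in sequentially. AE v in Z. \<bar>X n v\<bar> \<le> C / (\<sigma> * sqrt (real n))"
      using ev_good
    proof eventually_elim
      case (elim n)
      then have n: "0 < real n" "good n" by (auto simp: good_def)
      have "\<sigma> * sqrt (real n) = real n * (\<sigma> / sqrt (real n))" using n by (simp add: real_div_sqrt field_simps)
      also have "\<dots> \<le> real n * \<sigma>n n" using \<sigma>n_lower[OF n(2)] n by (intro mult_left_mono) auto
      finally have le: "\<sigma> * sqrt (real n) \<le> real n * \<sigma>n n" .
      have "s n \<le> n" using elim by (simp add: good_def)
      from influence_AE_bound[OF this, of "L n" x] show ?case
      proof eventually_elim
        case (elim v)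
        then have "\<bar>X n v\<bar> \<le> C / (real n * \<sigma>n n)"
          unfolding X_def C_def using n \<sigma>n_pos[of n] by (simp add: abs_mult divide_right_mono)
        also have "\<dots> \<le> C / (\<sigma> * sqrt (real n))"
          using le n \<sigma>(1) \<sigma>n_pos[of n] by (intro divide_left_mono) (auto simp: C_def sum_nonneg)
        finally show ?case .
      qed
    qed
    show "(\<lambda>n. C / (\<sigma> * sqrt (real n))) \<longlonglongrightarrow> 0" using \<sigma>(1) by real_asymp
  qed
  define N where "N n = distr (forest_law (logt n) n (s n) (B n) x) borel (\<lambda>v. (v - m x) / \<sigma>n n)" for n
  define \<eta> where "\<eta> n = not_fully_grown_prob d Dx \<E> m (logt n) n (s n)
      + 8 * real (card (set_pmf Dx)) * exp (- \<delta>\<^sup>2 * real (s n div 2) / 2) + C3 * (real (s n) / real n)" for n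
  \<comment> \<open>The factor \<open>sqrt n\<close> from \<open>1 / \<sigma>n\<close> is multiplied
    into every error term, so that each of them is a sequence tending to 0. The first term comes
    from at least \<open>n\<^sup>2\<close> trees.\<close>
  define bnd where "bnd t n = 2 * (\<bar>t\<bar> / \<sigma>) * (sqrt (real n) * (1 / real n)
      + (sqrt (real n) * not_fully_grown_prob d Dx \<E> m (logt n) n (s n)
      + 8 * real (card (set_pmf Dx)) * (sqrt (real n) * exp (- (\<delta>\<^sup>2 * (c * (log 2 (real n))\<^sup>2 - 1) / 4)))
      + C3 * (real (s n) / sqrt (real n))))" for t n
  have char_diff: "\<forall>\<^sub>F n in sequentially. cmod (char (N n) t - (char (distr Z borel (X n)) t) ^ n) \<le> bnd t n" for t
    using ev_good B s_lower
  proof eventually_elim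
    case (elim n)
    have n: "0 < n" "0 < real n" "good n" "s n \<le> n" using elim by (auto simp: good_def)
    have s4: "4 < real (s n)" "12 / \<pi> < real (s n)" using elim by (auto simp: s0_def)
    have s2: "0 < s n div 2" using s4 by simp
    have half: "real (s n) / 2 \<le> real (s n - s n div 2)" "(real (s n) - 1) / 2 \<le> real (s n div 2)"
    proof -
      have "2 * (s n div 2) \<le> s n" "s n \<le> 2 * (s n div 2) + 1" by simp_all
      then have "2 * real (s n div 2) \<le> real (s n)" "real (s n) \<le> 2 * real (s n div 2) + 1" by linarith+
      then show "real (s n) / 2 \<le> real (s n - s n div 2)" "(real (s n) - 1) / 2 \<le> real (s n div 2)"
        by (simp_all add: of_nat_diff)
    qed
    have "6 < real (s n) / 2 * \<pi>" using s4(2) \<pi> by (simp add: field_simps)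
    also have "\<dots> \<le> real (s n - s n div 2) * \<pi>" using half(1) \<pi> by (intro mult_right_mono) auto
    finally have s6: "6 < real (s n - s n div 2) * pmf Dx z0" by (simp add: \<pi>_def)
    note approx = tree_mean_approx[OF sparse x z0 \<delta> V n(4) s2 s6, of "logt n"]
    have Bpos: "0 < B n" using elim(2) n(2) by (metis less_le_trans of_nat_0_less_iff zero_less_power)
    have "cmod (char (N n) t - (char (distr Z borel (X n)) t) ^ n) \<le> 2 * (\<bar>t\<bar> / \<sigma>n n * (1 / sqrt (real (B n)) + \<eta> n))"
      unfolding N_def X_def[abs_def] L_def
      by (rule forest_char_compare[OF n(4) Bpos \<sigma>n_pos n(1) _ approx(2)])
        (use approx(1) in \<open>simp add: \<eta>_def C3_def\<close>)
    also have "\<dots> \<le> 2 * (\<bar>t\<bar> / (\<sigma> / sqrt (real n)) * (1 / real n + (not_fully_grown_prob d Dx \<E> m (logt n) n (s n)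
      + 8 * real (card (set_pmf Dx)) * exp (- (\<delta>\<^sup>2 * (c * (log 2 (real n))\<^sup>2 - 1) / 4)) + C3 * (real (s n) / real n))))"
    proof (intro mult_left_mono mult_mono add_mono order_refl)
      show "\<bar>t\<bar> / \<sigma>n n \<le> \<bar>t\<bar> / (\<sigma> / sqrt (real n))"
        using \<sigma>n_lower[OF n(3)] \<sigma>n_pos[of n] \<sigma>(1) n by (intro divide_left_mono) auto
      have "real n \<le> sqrt (real (B n))" using elim(2) by (rule real_le_rsqrt)
      then show "1 / sqrt (real (B n)) \<le> 1 / real n" using n Bpos by (intro divide_left_mono) auto
      have "\<delta>\<^sup>2 * ((c * (log 2 (real n))\<^sup>2 - 1) / 2) \<le> \<delta>\<^sup>2 * real (s n div 2)"
        using half(2) elim(3) by (intro mult_left_mono) auto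
      then have le: "exp (- \<delta>\<^sup>2 * real (s n div 2) / 2) \<le> exp (- (\<delta>\<^sup>2 * (c * (log 2 (real n))\<^sup>2 - 1) / 4))"
        by simp
      show "\<eta> n \<le> not_fully_grown_prob d Dx \<E> m (logt n) n (s n)
        + 8 * real (card (set_pmf Dx)) * exp (- (\<delta>\<^sup>2 * (c * (log 2 (real n))\<^sup>2 - 1) / 4)) + C3 * (real (s n) / real n)"
        unfolding \<eta>_def by (intro add_mono order_refl mult_left_mono[OF le]) auto
      have "0 \<le> not_fully_grown_prob d Dx \<E> m (logt n) n (s n)"
        unfolding not_fully_grown_prob_def by (intro integral_nonneg_AE) simp
      moreover have "0 \<le> C3" unfolding C3_def by (intro sum_nonneg) simp
      ultimately show "0 \<le> 1 / sqrt (real (B n)) + \<eta> n" unfolding \<eta>_def by simp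
    qed (use \<sigma>(1) in auto)
    also have "\<dots> = bnd t n"
    proof -
      have "real (s n) / sqrt (real n) = sqrt (real n) * (real (s n) / real n)"
        using n by (simp add: field_simps)
      moreover have "2 * (a / (\<sigma> / q) * (u + (v + k * w + l * y))) =
          2 * (a / \<sigma>) * (q * u + (q * v + k * (q * w) + l * (q * y)))" for a q u v k w l y
        by (simp add: algebra_simps)
      ultimately show ?thesis unfolding bnd_def by (simp only:)
    qed
    finally show ?case .
  qed
  have bnd_lim: "bnd t \<longlonglongrightarrow> 0" for t
  proof -
    have 1: "(\<lambda>n. sqrt (real n) * (1 / real n)) \<longlonglongrightarrow> 0" by real_asymp
    have 2: "(\<lambda>n. sqrt (real n) * not_fully_grown_prob d Dx \<E> m (logt n) n (s n)) \<longlonglongrightarrow> 0"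
      using smalloD_tendsto[OF full] by (simp add: mult.commute)
    have 3: "(\<lambda>n. sqrt (real n) * exp (- (\<delta>\<^sup>2 * (c * (log 2 (real n))\<^sup>2 - 1) / 4))) \<longlonglongrightarrow> 0"
      using c \<delta>(1) by real_asymp
    have "bnd t \<longlonglongrightarrow> 2 * (\<bar>t\<bar> / \<sigma>) * (0 + (0 + 8 * real (card (set_pmf Dx)) * 0 + C3 * 0))"
      unfolding bnd_def by (intro tendsto_intros 1 2 3 s_ratio)
    then show ?thesis by simp
  qed
  have N_char: "(\<lambda>n. char (N n) t) \<longlonglongrightarrow> char std_normal_distribution t" for t
    using tendsto_add[OF Lim_null_comparison[OF char_diff[of t] bnd_lim] char_lim[of t]]
    by (simp add: char_std_normal_distribution)
  have N_dist: "real_distribution (N n)" if "good n" for n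
  proof -
    have sn: "s n \<le> n" using that by (simp add: good_def)
    interpret F: prob_space "forest_law (logt n) n (s n) (B n) x" by (rule prob_space_forest_law[OF sn])
    show ?thesis
      unfolding N_def
      by (rule F.real_distribution_distr) (simp add: measurable_cong_sets[OF prob_space_forest_law(2)[OF sn] refl])
  qed
  \<comment> \<open>Levy's theorem wants a probability distribution for every \<open>n\<close>, but
    with \<open>s n > n\<close> there is no sub-sample to draw from and \<open>pmf_of_set\<close> is
    unspecified. Such \<open>n\<close> are replaced by the limit law, which changes no
    limit.\<close>
  define N' where "N' n = (if good n then N n else std_normal_distribution)" for n
  have eq: "\<forall>\<^sub>F n in sequentially. N' n = N n"
    using ev_good by eventually_elim (simp add: N'_def)
  have "weak_conv_m N' std_normal_distribution"
  proof (rule levy_continuity)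
    show "real_distribution (N' n)" for n
      using N_dist[of n] real_dist_normal_dist by (simp add: N'_def)
    show "(\<lambda>n. char (N' n) t) \<longlonglongrightarrow> char std_normal_distribution t" for t
      by (rule Lim_transform_eventually[OF N_char]) (use eq in eventually_elim, simp)
  qed (rule real_dist_normal_dist)
  then have "weak_conv_m N std_normal_distribution"
    unfolding weak_conv_m_def weak_conv_def
  proof (intro allI impI)
    fix y assume *: "\<forall>y. isCont (cdf std_normal_distribution) y \<longrightarrow> (\<lambda>n. cdf (N' n) y) \<longlonglongrightarrow> cdf std_normal_distribution y"
      and y: "isCont (cdf std_normal_distribution) y"
    have "\<forall>\<^sub>F n in sequentially. cdf (N' n) y = cdf (N n) y" using eq by eventually_elim simp
    with * y show "(\<lambda>n. cdf (N n) y) \<longlonglongrightarrow> cdf std_normal_distribution y"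
      by (blast intro: Lim_transform_eventually)
  qed
  with \<sigma>n_pos bigO show ?thesis unfolding N_def by blast
qed

end

theorem theorem3p5:
  shows "\<exists>K>0. \<exists>p::nat.
    \<forall>(d::nat) (Dx::bool list pmf) (\<E>::real measure) (m::bool list \<Rightarrow> real)
     (r::nat) (R::nat set) (\<beta>::real) (\<zeta>::real) (\<sigma>::real) (x::bool list)
     (s::nat \<Rightarrow> nat) (B::nat \<Rightarrow> nat) (logt::nat \<Rightarrow> real).
      regression_model d Dx \<E> m \<longrightarrow>
      \<beta> > 0 \<longrightarrow>
      strongly_sparse d Dx m \<beta> r R \<longrightarrow>
      \<zeta> > 0 \<longrightarrow>
      (\<forall>w\<in>cube r. measure_pmf.prob Dx {z. nths z R = w} \<notin> {0<..<\<zeta> / 2 ^ r}) \<longrightarrow>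
      \<sigma> > 0 \<longrightarrow>
      (\<forall>z\<in>cube d. response_variance \<E> m z \<ge> \<sigma>\<^sup>2) \<longrightarrow>
      x \<in> cube d \<longrightarrow>
      measure_pmf.prob Dx {z. nths z R = nths x R} \<ge> \<zeta> / 2 ^ r \<longrightarrow>
      (\<forall>\<^sub>F n in sequentially. real (B n) \<ge> (real n)\<^sup>2 * log 2 (real n)) \<longrightarrow>
      (\<lambda>n. not_fully_grown_prob d Dx \<E> m (logt n) n (s n)) \<in> o(\<lambda>n. 1 / sqrt (real n)) \<longrightarrow>
      (\<forall>\<^sub>F n in sequentially. subsample_bound K p d r \<beta> \<zeta> n \<le> real (s n)) \<longrightarrow>
      (\<lambda>n. real (s n)) \<in> o(\<lambda>n. sqrt (real n)) \<longrightarrow>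
      (\<exists>\<sigma>n::nat \<Rightarrow> real.
         (\<forall>n. \<sigma>n n > 0) \<and>
         (\<lambda>n. (\<sigma>n n)\<^sup>2) \<in> O(\<lambda>n. (real (s n))\<^sup>2 / real n) \<and>
         weak_conv_m
           (\<lambda>n. distr (mc_forest_law d Dx \<E> m (logt n) n (s n) (B n) x) borel
                  (\<lambda>v. (v - m x) / \<sigma>n n))
           std_normal_distribution)"
proof (intro exI[of _ "1::real"] exI[of _ "1::nat"] conjI allI impI)
  fix d r :: nat and Dx :: "bool list pmf" and \<E> :: "real measure" and m :: "bool list \<Rightarrow> real"
    and R :: "nat set" and \<beta> \<zeta> \<sigma> :: real and x :: "bool list"
    and s B :: "nat \<Rightarrow> nat" and logt :: "nat \<Rightarrow> real"
  assume model: "regression_model d Dx \<E> m" and \<beta>: "\<beta> > 0" and sparse: "strongly_sparse d Dx m \<beta> r R"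
    and \<zeta>: "\<zeta> > 0" and \<sigma>: "\<sigma> > 0" "\<forall>z\<in>cube d. response_variance \<E> m z \<ge> \<sigma>\<^sup>2" and x: "x \<in> cube d"
    and class_x: "measure_pmf.prob Dx {z. nths z R = nths x R} \<ge> \<zeta> / 2 ^ r"
    and B: "\<forall>\<^sub>F n in sequentially. real (B n) \<ge> (real n)\<^sup>2 * log 2 (real n)"
    and full: "(\<lambda>n. not_fully_grown_prob d Dx \<E> m (logt n) n (s n)) \<in> o(\<lambda>n. 1 / sqrt (real n))"
    and s_lower: "\<forall>\<^sub>F n in sequentially. subsample_bound 1 1 d r \<beta> \<zeta> n \<le> real (s n)"
    and s_upper: "(\<lambda>n. real (s n)) \<in> o(\<lambda>n. sqrt (real n))"
  interpret regression d Dx \<E> m by standard (rule model)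
  have pos: "0 < measure_pmf.prob Dx {z. nths z R = nths x R}"
    using class_x \<zeta> by (intro less_le_trans[OF _ class_x]) simp
  have noise: "\<sigma>\<^sup>2 \<le> noise_var" using \<sigma>(2) x by (auto simp: response_variance_eq_noise_var)
  have B': "\<forall>\<^sub>F n in sequentially. (real n)\<^sup>2 \<le> real (B n)"
    using B eventually_ge_at_top[of 2]
  proof eventually_elim
    case (elim n)
    then have "1 \<le> log 2 (real n)" by (simp add: le_log_iff)
    then have "(real n)\<^sup>2 * 1 \<le> (real n)\<^sup>2 * log 2 (real n)" by (intro mult_left_mono) auto
    from order_trans[OF this elim(1)] show ?case by simp
  qed
  \<comment> \<open>Why \<open>K = 1\<close> and \<open>p = 1\<close> suffice: the term
    \<open>2 ^ r * log 2 n / \<zeta>\<close> contributes one logarithm and the polylogarithmic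
    factor another, which is the growth that beats every power of \<open>n\<close>.\<close>
  have s': "\<forall>\<^sub>F n in sequentially. (1 / \<zeta>) * (log 2 (real n))\<^sup>2 \<le> real (s n)"
    using s_lower eventually_ge_at_top[of 2]
  proof eventually_elim
    case (elim n)
    define l where "l = log 2 (real n)"
    have l: "0 \<le> l" using elim(2) by (simp add: l_def)
    have one: "1 \<le> log 2 (2 + y)" if "0 \<le> y" for y :: real
      using that by (simp add: le_log_iff)
    have "l \<le> log 2 (2 + real n)" using elim(2) by (simp add: l_def)
    \<comment> \<open>The summand 2 inside each logarithm makes the three remaining factors at least
      1.\<close>
    then have "l * 1 * 1 * 1 \<le> log 2 (2 + real n) * log 2 (2 + 2 ^ r) * log 2 (2 + 1 / \<beta>) * log 2 (2 + 1 / \<zeta>)"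
      using l \<beta> \<zeta> by (intro mult_mono one) (auto intro!: mult_nonneg_nonneg order_trans[OF zero_le_one one])
    then have poly: "l \<le> polylog 1 n r \<beta> \<zeta>" by (simp add: polylog_def)
    have "1 / \<zeta> * l = 1 * l / \<zeta>" by simp
    also have "\<dots> \<le> 2 ^ r * l / \<zeta>"
      using l \<zeta> by (intro divide_right_mono mult_right_mono) auto
    also have "\<dots> \<le> 2 ^ r * (log 2 (real d) + l) / \<beta>\<^sup>2 + 2 ^ r * l / \<zeta>"
      using l d_pos by simp
    finally have "1 / \<zeta> * l * l \<le> (2 ^ r * (log 2 (real d) + l) / \<beta>\<^sup>2 + 2 ^ r * l / \<zeta>) * polylog 1 n r \<beta> \<zeta>"
      using poly l \<zeta> d_pos by (intro mult_mono) auto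
    also have "\<dots> = subsample_bound 1 1 d r \<beta> \<zeta> n" by (simp add: subsample_bound_def l_def)
    also note elim(1)
    finally show ?case by (simp add: l_def power2_eq_square)
  qed
  show "\<exists>\<sigma>n::nat \<Rightarrow> real.
      (\<forall>n. \<sigma>n n > 0) \<and>
      (\<lambda>n. (\<sigma>n n)\<^sup>2) \<in> O(\<lambda>n. (real (s n))\<^sup>2 / real n) \<and>
      weak_conv_m
        (\<lambda>n. distr (mc_forest_law d Dx \<E> m (logt n) n (s n) (B n) x) borel (\<lambda>v. (v - m x) / \<sigma>n n))
        std_normal_distribution"
    using \<zeta> by (intro forest_asymptotic_normality[OF sparse \<beta> x pos \<sigma>(1) noise B' full _ s' s_upper]) simp
qed simp

end
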